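(* Let $G$ be a finite simple graph. Then $G$ is ternary if and only if for every induced subgraph $H$ of $G$, the independence complex $I(H)$ is either contractible or homotopy equivalent to a sphere.
   Context: All graphs are finite, with no loops and no multiple edges. An induced subgraph is obtained by deleting vertices together with all incident edges; an induced cycle is an induced subgraph that is a cycle. A graph is ternary if it contains no induced cycle whose length is divisible by $3$. The independence complex $I(G)$ of a graph $G$ is the abstract simplicial complex on vertex set $V(G)$ whose faces are the independent sets (sets of pairwise non-adjacent vertices) of $G$. *)

theory Defs
  imports "HOL-Homology.Homology"
begin

type_synonym 'a graph = "'a set \<times> 'a set set"

abbreviation verts :: "'a graph \<Rightarrow> 'a set" where
  "verts G \<equiv> fst G"

abbreviation edges :: "'a graph \<Rightarrow> 'a set set" where
  "edges G \<equiv> snd G"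

definition finite_simple_graph :: "'a graph \<Rightarrow> bool" where
  "finite_simple_graph G \<longleftrightarrow> finite (verts G) \<and> (\<forall>e\<in>edges G. e \<subseteq> verts G \<and> card e = 2)"

definition induced_subgraph :: "'a graph \<Rightarrow> 'a graph \<Rightarrow> bool" where
  "induced_subgraph H G \<longleftrightarrow>
     verts H \<subseteq> verts G \<and> edges H = {e \<in> edges G. e \<subseteq> verts H}"

definition cycle_of_length :: "nat \<Rightarrow> 'a graph \<Rightarrow> bool" where
  "cycle_of_length n G \<longleftrightarrow>
     3 \<le> n \<and> (\<exists>c. bij_betw c {..<n} (verts G) \<and>
                  edges G = {{c i, c (Suc i mod n)} | i. i < n})"

definition ternary :: "'a graph \<Rightarrow> bool" where
  "ternary G \<longleftrightarrow> \<not> (\<exists>C n. induced_subgraph C G \<and> cycle_of_length n C \<and> 3 dvd n)"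

text \<open>The empty set is a face, so the independence complex of the null graph is
  \<open>{{}}\<close>. Loops do not occur, so \<open>u = v\<close> is harmless below.\<close>

definition independence_complex :: "'a graph \<Rightarrow> 'a set set" where
  "independence_complex G = {S. S \<subseteq> verts G \<and> (\<forall>u\<in>S. \<forall>v\<in>S. {u, v} \<notin> edges G)}"

text \<open>Geometric realization by barycentric coordinates, extended by \<open>0\<close> to all of
  \<^typ>\<open>'a\<close> (as the library does for \<^const>\<open>standard_simplex\<close> and \<^const>\<open>nsphere\<close>).
  For a finite complex, the only case used here, the product topology on the coordinates
  agrees with the weak (coherent) topology.\<close>

definition geometric_realization :: "'a set set \<Rightarrow> ('a \<Rightarrow> real) topology" where
  "geometric_realization K =
     subtopology (powertop_real UNIV)
       {x. (\<forall>v. 0 \<le> x v) \<and> {v. x v \<noteq> 0} \<in> K \<and> (\<Sum>v\<in>{v. x v \<noteq> 0}. x v) = 1}"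

text \<open>The usual convention for simplicial complexes: the complex \<open>{{}}\<close>, whose realization is
  the empty space, is the sphere of dimension \<open>-1\<close>. The spheres of dimension \<open>n \<ge> 0\<close>
  are \<^term>\<open>nsphere n\<close>.\<close>

definition homotopy_equivalent_to_sphere :: "'b topology \<Rightarrow> bool" where
  "homotopy_equivalent_to_sphere X \<longleftrightarrow>
     topspace X = {} \<or> (\<exists>n. X homotopy_equivalent_space nsphere n)"

end

theory Submission
  imports Defs "HOL-Library.Z2" "HOL-Library.Function_Algebras"
begin

text \<open>
  Write \<open>L = U - N[v]\<close> and \<open>D = U - v\<close> for a vertex \<open>v\<close> of an induced subgraph on \<open>U\<close>. The
  independence complex of \<open>U\<close> is the mapping cone of the inclusion of that of \<open>L\<close> into that of
  \<open>D\<close>, so it is equivalent to \<open>D\<close> if \<open>L\<close> is contractible and to the suspension of \<open>L\<close> if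
  \<open>D\<close> is. By induction, a ternary graph can only fail to be contractible or a sphere if
  for every vertex both \<open>L\<close> and \<open>D\<close> are spheres. In that case let \<open>c(v)\<close> be the image of the generator
  of the homology of \<open>D\<close>, with coefficients in the field of two elements, in the homology of the
  whole complex, which has rank 2. There are only three nonzero classes; adjacent vertices have
  different classes, and every vertex has neighbours in both of the other classes. Directing all edges
  cyclically through the three classes, every vertex has an out-neighbour, and a shortest directed
  cycle is an induced cycle of length divisible by 3.

  Conversely, for a cycle of length \<open>3m\<close> the two induced matchings \<open>{3i, 3i+1}\<close> and
  \<open>{3i+1, 3i+2}\<close> span spheres of dimension \<open>m - 1\<close> onto which the independence complex retracts, and
  one of the retractions is null-homotopic on the other sphere. Brouwer degrees exclude this in
  a space equivalent to a sphere.
\<close>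

section \<open>Mod 2 homology of independence complexes\<close>

text \<open>Homotopy types are computed only where some \<open>L\<close> or \<open>D\<close> is
  contractible, or for an isolated vertex or the empty graph. The remaining case is refuted by
  homology alone. Two elements of coefficients are essential there: a plane over that field has just
  three nonzero vectors, and these become the three colours.

  The obstacle is that rank 2 is not automatic. If the homology of \<open>L\<close> mapped
  isomorphically onto that of \<open>D\<close>, the whole would be acyclic and no classes would be
  left to use as colours. What excludes this is the identity \<open>lam_eq\<close>: the degree of
  \<open>D\<close> is one more than that of \<open>L\<close>, so the map vanishes for degree reasons
  and both spheres contribute to one degree of the whole. Its source is a set of neighbours of a
  vertex, minimal among those whose deletion leaves an acyclic complex. A degree count shows that a
  two-element set of this kind always exists. The same pairs supply the neighbours in the two other
  classes, since vertices whose joint deletion is acyclic have different classes.\<close>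

declare add_bit_eq_xor [simp del] bit_not_zero_iff [simp del] bit_not_one_iff [simp del]

definition indep :: "'a set set \<Rightarrow> 'a set \<Rightarrow> 'a set set" where
  "indep E U = {S. S \<subseteq> U \<and> (\<forall>u\<in>S. \<forall>v\<in>S. {u, v} \<notin> E)}"

definition cnbr :: "'a set set \<Rightarrow> 'a \<Rightarrow> 'a set" where
  "cnbr E v = insert v {u. {v, u} \<in> E}"

lemma self_mem_cnbr [simp]: "v \<in> cnbr E v"
  by (simp add: cnbr_def)

lemma link_subset_deletion [simp]: "U - cnbr E v \<subseteq> U - {v}"
  by auto

lemma indep_mono: "A \<subseteq> B \<Longrightarrow> indep E A \<subseteq> indep E B"
  by (auto simp: indep_def)

lemma indep_Diff_singleton: "\<sigma> \<in> indep E (U - {v}) \<longleftrightarrow> \<sigma> \<in> indep E U \<and> v \<notin> \<sigma>"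
  by (auto simp: indep_def)

lemma indep_down: "\<sigma> \<in> indep E U \<Longrightarrow> \<tau> \<subseteq> \<sigma> \<Longrightarrow> \<tau> \<in> indep E U"
  by (auto simp: indep_def)

lemma insert_in_indep_iff:
  assumes "{v} \<notin> E" "v \<notin> \<sigma>"
  shows "insert v \<sigma> \<in> indep E U \<longleftrightarrow> v \<in> U \<and> \<sigma> \<in> indep E (U - cnbr E v)"
proof -
  have "{v, v} \<notin> E" using assms by simp
  then show ?thesis
    using assms(2) by (auto simp: indep_def cnbr_def insert_commute)
qed

type_synonym 'a chain = "'a set \<Rightarrow> bit"

lemma bit_add_self [simp]: "(a::bit) + a = 0"
  by (cases a) (auto simp: add_bit_eq_xor)

lemma chain_add_self [simp]: "(c::'a chain) + c = 0"
  by (simp add: fun_eq_iff)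

lemma chain_add_self_left [simp]: "(c::'a chain) + (c + d) = d"
  by (simp add: add.assoc [symmetric])

lemma chain_add_eq_iff: "(a::'a chain) + b = c \<longleftrightarrow> a = c + b"
  by (auto simp: add.assoc)

text \<open>Every unordered pair is counted twice, which vanishes mod 2; hence \<open>bd\<close>
  squares to zero without signs.\<close>

lemma bit_sum_off_diagonal:
  fixes f :: "'a \<Rightarrow> 'a \<Rightarrow> bit"
  assumes "finite A" "\<And>x y. f x y = f y x"
  shows "(\<Sum>x\<in>A. \<Sum>y\<in>A - {x}. f x y) = 0"
  using assms(1)
proof (induction A rule: finite_induct)
  case (insert a A)
  have "(\<Sum>y\<in>insert a A - {x}. f x y) = f x a + (\<Sum>y\<in>A - {x}. f x y)" if "x \<in> A" for x
  proof -
    have "insert a A - {x} = insert a (A - {x})" using that insert.hyps by auto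
    then show ?thesis using insert.hyps by simp
  qed
  then have "(\<Sum>x\<in>A. \<Sum>y\<in>insert a A - {x}. f x y) = (\<Sum>x\<in>A. f x a)"
    using insert.IH by (simp add: sum.distrib)
  moreover have "insert a A - {a} = A" using insert.hyps by auto
  ultimately show ?case
    using insert.hyps assms(2) by simp
qed simp

locale stable_complex =
  fixes W :: "'a set" and E :: "'a set set"
  assumes fin: "finite W" and no_loop: "\<And>v. {v} \<notin> E"
begin

text \<open>Extensions of a face are taken in the fixed ambient set \<open>W\<close>, so one
  operator serves all induced subgraphs; supports are controlled separately by
  \<open>chain\<close>.\<close>

definition bd :: "'a chain \<Rightarrow> 'a chain" where
  "bd c = (\<lambda>\<tau>. \<Sum>x\<in>W - \<tau>. c (insert x \<tau>))"

text \<open>The degree of a chain is the cardinality of its faces, one more than their dimension. In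
  particular the empty set is a face of degree 0, so all homology is reduced.\<close>

definition chain :: "'a set \<Rightarrow> nat \<Rightarrow> 'a chain \<Rightarrow> bool" where
  "chain U k c \<longleftrightarrow> (\<forall>\<sigma>. c \<sigma> \<noteq> 0 \<longrightarrow> \<sigma> \<in> indep E U \<and> card \<sigma> = k)"

definition cyc :: "'a set \<Rightarrow> nat \<Rightarrow> 'a chain \<Rightarrow> bool" where
  "cyc U k z \<longleftrightarrow> chain U k z \<and> bd z = 0"

definition bnd :: "'a set \<Rightarrow> nat \<Rightarrow> 'a chain \<Rightarrow> bool" where
  "bnd U k z \<longleftrightarrow> (\<exists>c. chain U (Suc k) c \<and> z = bd c)"

definition nbc :: "'a set \<Rightarrow> nat \<Rightarrow> 'a chain \<Rightarrow> bool" where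
  "nbc U k z \<longleftrightarrow> cyc U k z \<and> \<not> bnd U k z"

definition acy :: "'a set \<Rightarrow> bool" where
  "acy U \<longleftrightarrow> (\<forall>k z. cyc U k z \<longrightarrow> bnd U k z)"

text \<open>Total reduced homology of dimension at most one, phrased with representing cycles; over
  two elements, any two nonzero classes then coincide.\<close>

definition rank1 :: "'a set \<Rightarrow> bool" where
  "rank1 U \<longleftrightarrow> (\<forall>j k y z. nbc U j y \<longrightarrow> nbc U k z \<longrightarrow> j = k \<and> bnd U k (y + z))"

definition sph :: "'a set \<Rightarrow> nat \<Rightarrow> bool" where
  "sph U k \<longleftrightarrow> rank1 U \<and> (\<exists>z. nbc U k z)"

text \<open>\<open>lk\<close>, \<open>dl\<close> and \<open>jn\<close> split a chain at
  \<open>v\<close>: \<open>dl v c\<close> is the part avoiding \<open>v\<close>, and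
  \<open>jn v (lk v c)\<close> is the part through \<open>v\<close>, a cone over a chain in the
  link.\<close>

definition lk :: "'a \<Rightarrow> 'a chain \<Rightarrow> 'a chain" where
  "lk v c = (\<lambda>\<tau>. if v \<in> \<tau> then 0 else c (insert v \<tau>))"

definition dl :: "'a \<Rightarrow> 'a chain \<Rightarrow> 'a chain" where
  "dl v c = (\<lambda>\<tau>. if v \<in> \<tau> then 0 else c \<tau>)"

definition jn :: "'a \<Rightarrow> 'a chain \<Rightarrow> 'a chain" where
  "jn v c = (\<lambda>\<tau>. if v \<in> \<tau> then c (\<tau> - {v}) else 0)"

lemma bd_add [simp]: "bd (a + b) = bd a + bd b"
  by (simp add: bd_def fun_eq_iff sum.distrib)

lemma bd_0 [simp]: "bd 0 = 0"
  by (simp add: bd_def fun_eq_iff)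

lemma lk_add [simp]: "lk v (a + b) = lk v a + lk v b"
  by (simp add: lk_def fun_eq_iff)

lemma dl_add [simp]: "dl v (a + b) = dl v a + dl v b"
  by (simp add: dl_def fun_eq_iff)

lemma lk_0 [simp]: "lk v 0 = 0" and dl_0 [simp]: "dl v 0 = 0"
  by (simp_all add: lk_def dl_def fun_eq_iff)

lemma bd_bd [simp]: "bd (bd c) = 0"
proof
  fix \<tau>
  have *: "W - insert x \<tau> = (W - \<tau>) - {x}" for x by auto
  have "bd (bd c) \<tau> = (\<Sum>x\<in>W - \<tau>. \<Sum>y\<in>(W - \<tau>) - {x}. c (insert y (insert x \<tau>)))"
    by (simp add: bd_def *)
  also have "\<dots> = 0"
    using fin by (intro bit_sum_off_diagonal) (simp_all add: insert_commute)
  finally show "bd (bd c) \<tau> = 0 \<tau>" by simp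
qed

lemma lk_bd: "lk v (bd c) = bd (lk v c)"
proof
  fix \<tau>
  show "lk v (bd c) \<tau> = bd (lk v c) \<tau>"
  proof (cases "v \<in> \<tau>")
    case False
    have "bd (lk v c) \<tau> = (\<Sum>x\<in>W - insert v \<tau>. lk v c (insert x \<tau>))"
      unfolding bd_def using fin by (intro sum.mono_neutral_right) (auto simp: lk_def)
    also have "\<dots> = (\<Sum>x\<in>W - insert v \<tau>. c (insert x (insert v \<tau>)))"
      using False by (intro sum.cong) (auto simp: lk_def insert_commute)
    finally show ?thesis using False by (simp add: lk_def bd_def)
  qed (simp add: lk_def bd_def)
qed

text \<open>Among the one-vertex extensions of a face avoiding \<open>v\<close>, exactly one
  contains \<open>v\<close> and gives the extra term. For a cycle \<open>z\<close> it follows that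
  \<open>lk v z\<close> is the boundary of \<open>dl v z\<close>.\<close>

lemma dl_bd: assumes "v \<in> W" shows "dl v (bd c) = bd (dl v c) + lk v c"
proof
  fix \<tau>
  show "dl v (bd c) \<tau> = (bd (dl v c) + lk v c) \<tau>"
  proof (cases "v \<in> \<tau>")
    case False
    have "bd c \<tau> = c (insert v \<tau>) + (\<Sum>x\<in>W - \<tau> - {v}. c (insert x \<tau>))"
      unfolding bd_def using fin False assms by (subst sum.remove [of _ v]) auto
    moreover have "bd (dl v c) \<tau> = (\<Sum>x\<in>W - \<tau> - {v}. dl v c (insert x \<tau>))"
      unfolding bd_def using fin by (intro sum.mono_neutral_right) (auto simp: dl_def)
    moreover have "\<dots> = (\<Sum>x\<in>W - \<tau> - {v}. c (insert x \<tau>))"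
      using False by (intro sum.cong) (auto simp: dl_def)
    ultimately show ?thesis using False by (simp add: dl_def lk_def add.commute)
  qed (simp add: dl_def lk_def bd_def)
qed

lemma lk_dl [simp]: "lk v (dl v c) = 0" and dl_jn [simp]: "dl v (jn v c) = 0"
  by (auto simp: lk_def dl_def jn_def fun_eq_iff)

lemma dl_jn_lk: "dl v c + jn v (lk v c) = c"
  by (auto simp: lk_def dl_def jn_def fun_eq_iff insert_absorb)

lemma chain_eqI: "dl v a = dl v b \<Longrightarrow> lk v a = lk v b \<Longrightarrow> a = b"
  by (metis dl_jn_lk)

lemma chain_zero: "chain U k c \<Longrightarrow> \<sigma> \<notin> indep E U \<Longrightarrow> c \<sigma> = 0"
  by (auto simp: chain_def)

lemma chain_add [simp, intro]: "chain U k a \<Longrightarrow> chain U k b \<Longrightarrow> chain U k (a + b)"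
  unfolding chain_def by (metis add.right_neutral plus_fun_apply add.left_neutral)

lemma chain_0 [simp, intro]: "chain U k 0"
  by (simp add: chain_def)

lemma chain_mono: "chain A k c \<Longrightarrow> A \<subseteq> B \<Longrightarrow> chain B k c"
  using indep_mono [of A B E] by (auto simp: chain_def)

lemma chain_bd: assumes "chain U (Suc k) c" "U \<subseteq> W" shows "chain U k (bd c)"
  unfolding chain_def
proof (intro allI impI)
  fix \<tau> assume "bd c \<tau> \<noteq> 0"
  then obtain x where x: "x \<in> W - \<tau>" "c (insert x \<tau>) \<noteq> 0"
    unfolding bd_def by (meson sum.neutral)
  then have i: "insert x \<tau> \<in> indep E U" "card (insert x \<tau>) = Suc k"
    using assms by (auto simp: chain_def)
  then have "finite \<tau>"
    using fin assms(2) by (metis card.infinite finite_insert nat.distinct(1))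
  then show "\<tau> \<in> indep E U \<and> card \<tau> = k"
    using i x indep_down [OF i(1), of \<tau>] by auto
qed

lemma chain_0_bd: assumes "chain U 0 c" "U \<subseteq> W" shows "bd c = 0"
proof
  fix \<tau>
  have "c (insert x \<tau>) = 0" for x
  proof (rule ccontr)
    assume "c (insert x \<tau>) \<noteq> 0"
    then have "insert x \<tau> \<subseteq> U" "card (insert x \<tau>) = 0"
      using assms by (auto simp: chain_def indep_def)
    then show False
      using fin assms(2) by (metis card_eq_0_iff finite_subset insert_not_empty)
  qed
  then show "bd c \<tau> = 0 \<tau>" by (simp add: bd_def)
qed

lemma chain_lk: assumes "chain U (Suc k) c" shows "chain (U - cnbr E v) k (lk v c)"
  unfolding chain_def
proof (intro allI impI)
  fix \<tau> assume "lk v c \<tau> \<noteq> 0"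
  then have v: "v \<notin> \<tau>" "c (insert v \<tau>) \<noteq> 0" by (auto simp: lk_def split: if_splits)
  then have "insert v \<tau> \<in> indep E U" "card (insert v \<tau>) = Suc k"
    using assms by (auto simp: chain_def)
  moreover then have "finite \<tau>"
    by (metis card.infinite finite_insert nat.distinct(1))
  ultimately show "\<tau> \<in> indep E (U - cnbr E v) \<and> card \<tau> = k"
    using v insert_in_indep_iff [OF no_loop v(1)] by auto
qed

lemma lk_eq_0: assumes "chain U k c" "v \<notin> U" shows "lk v c = 0"
proof
  fix \<tau>
  have "insert v \<tau> \<notin> indep E U" using assms(2) by (auto simp: indep_def)
  then show "lk v c \<tau> = 0 \<tau>" using chain_zero [OF assms(1)] by (auto simp: lk_def)
qed

lemma dl_eq: assumes "chain U k c" "v \<notin> U" shows "dl v c = c"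
proof
  fix \<tau>
  have "\<tau> \<notin> indep E U" if "v \<in> \<tau>" using assms(2) that by (auto simp: indep_def)
  then show "dl v c \<tau> = c \<tau>" using chain_zero [OF assms(1)] by (auto simp: dl_def)
qed

lemma chain_dl: "chain U k c \<Longrightarrow> chain (U - {v}) k (dl v c)"
  by (auto simp: chain_def dl_def indep_Diff_singleton split: if_splits)

lemma chain_jn: assumes "chain (U - cnbr E v) k b" "v \<in> U" "U \<subseteq> W"
  shows "chain U (Suc k) (jn v b)"
  unfolding chain_def
proof (intro allI impI)
  fix \<sigma> assume "jn v b \<sigma> \<noteq> 0"
  then have v: "v \<in> \<sigma>" "b (\<sigma> - {v}) \<noteq> 0" by (auto simp: jn_def split: if_splits)
  then have t: "\<sigma> - {v} \<in> indep E (U - cnbr E v)" "card (\<sigma> - {v}) = k"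
    using assms by (auto simp: chain_def)
  then have "\<sigma> - {v} \<subseteq> W" using assms(3) by (auto simp: indep_def)
  then have f: "finite (\<sigma> - {v})" using fin by (rule finite_subset)
  have "insert v (\<sigma> - {v}) \<in> indep E U"
    using insert_in_indep_iff [OF no_loop, of v "\<sigma> - {v}"] t(1) assms(2) by blast
  moreover have "card (insert v (\<sigma> - {v})) = Suc k"
    using f t(2) by (subst card_insert_disjoint) auto
  ultimately show "\<sigma> \<in> indep E U \<and> card \<sigma> = Suc k"
    using v(1) by (simp add: insert_absorb)
qed

lemma lk_jn_eq_dl [simp]: "lk v (jn v c) = dl v c"
  by (auto simp: lk_def dl_def jn_def fun_eq_iff)

lemma jn_0 [simp]: "jn v 0 = 0"
  by (simp add: jn_def fun_eq_iff)

lemma lk_jn: assumes "chain (U - cnbr E v) k b" shows "lk v (jn v b) = b"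
  using dl_eq [OF assms, of v] by simp

text \<open>The cone formula. A cycle of the link bounds as soon as \<open>v\<close> may be
  used.\<close>

lemma bd_jn:
  assumes "chain (U - cnbr E v) k b" "v \<in> W"
  shows "bd (jn v b) = b + jn v (bd b)"
proof (rule chain_eqI [of v])
  have lb: "lk v b = 0" "dl v b = b"
    using lk_eq_0 [OF assms(1), of v] dl_eq [OF assms(1), of v] by auto
  show "dl v (bd (jn v b)) = dl v (b + jn v (bd b))"
    using lb by (simp add: dl_bd [OF assms(2)])
  have "dl v (bd b) = bd b" using dl_bd [OF assms(2), of b] lb by simp
  then show "lk v (bd (jn v b)) = lk v (b + jn v (bd b))"
    by (simp add: lk_bd lb)
qed

lemma cyc_add: "cyc U k a \<Longrightarrow> cyc U k b \<Longrightarrow> cyc U k (a + b)"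
  by (simp add: cyc_def)

lemma bnd_add: "bnd U k a \<Longrightarrow> bnd U k b \<Longrightarrow> bnd U k (a + b)"
  by (metis bnd_def bd_add chain_add)

lemma bnd_add_iff: "bnd U k b \<Longrightarrow> bnd U k (a + b) \<longleftrightarrow> bnd U k a"
  by (metis bnd_add add.commute chain_add_self_left)

lemma bnd_add_trans: "bnd U k (a + b) \<Longrightarrow> bnd U k (b + c) \<Longrightarrow> bnd U k (a + c)"
  using bnd_add [of U k "a + b" "b + c"] by (simp add: add.assoc)

lemma bnd_0 [simp]: "bnd U k 0"
  by (metis bnd_def bd_0 chain_0)

lemma cyc_mono: "cyc A k z \<Longrightarrow> A \<subseteq> B \<Longrightarrow> cyc B k z"
  by (auto simp: cyc_def chain_mono)

lemma bnd_mono: "bnd A k z \<Longrightarrow> A \<subseteq> B \<Longrightarrow> bnd B k z"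
  by (metis bnd_def chain_mono)

lemma acy_or_sph: "rank1 U \<Longrightarrow> acy U \<or> (\<exists>k. sph U k)"
  by (auto simp: sph_def acy_def nbc_def)

lemma sph_not_acy: "sph U k \<Longrightarrow> \<not> acy U"
  by (auto simp: sph_def acy_def nbc_def)

lemma sph_unique: "sph U k \<Longrightarrow> sph U m \<Longrightarrow> k = m"
  by (auto simp: sph_def rank1_def)

lemma sph_rank1: "sph U k \<Longrightarrow> rank1 U"
  by (simp add: sph_def)

lemma acy_rank1: "acy U \<Longrightarrow> rank1 U"
  by (auto simp: acy_def rank1_def nbc_def)

lemma lk_cyc: "cyc U (Suc k) z \<Longrightarrow> cyc (U - cnbr E v) k (lk v z)"
  by (simp add: cyc_def chain_lk lk_bd [symmetric])

text \<open>Exactness of the long homology sequence of \<open>U - cnbr E v\<close>, \<open>U - {v}\<close> and \<open>U\<close>, in terms of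
  representing cycles; \<open>lk v\<close> is its connecting map.\<close>

lemma cyc_pull_to_deletion:
  assumes U: "U \<subseteq> W" "v \<in> U" and z: "cyc U (Suc k) z" and b: "bnd (U - cnbr E v) k (lk v z)"
  shows "\<exists>y. cyc (U - {v}) (Suc k) y \<and> bnd U (Suc k) (z + y)"
proof -
  obtain e where e: "chain (U - cnbr E v) (Suc k) e" "lk v z = bd e"
    using b by (auto simp: bnd_def)
  have v: "v \<in> W" using U by auto
  have j: "bd (jn v e) = e + jn v (lk v z)" using bd_jn [OF e(1) v] e(2) by simp
  \<comment> \<open>Adding the boundary of the cone over \<open>e\<close> cancels all faces of
    \<open>z\<close> through \<open>v\<close>.\<close>
  have "z + bd (jn v e) = dl v z + e"
    using j dl_jn_lk [of v z] by (metis add.assoc add.commute chain_add_self_left)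
  moreover have "chain (U - {v}) (Suc k) (dl v z + e)"
    using z e(1) by (intro chain_add chain_dl chain_mono [OF e(1)]) (auto simp: cyc_def)
  moreover have "bd (z + bd (jn v e)) = 0" using z by (simp add: cyc_def)
  moreover have "bnd U (Suc k) (bd (jn v e))"
    using chain_jn [OF e(1) U(2,1)] by (auto simp: bnd_def)
  ultimately show ?thesis
    by (intro exI [of _ "z + bd (jn v e)"]) (metis cyc_def chain_add_self_left)
qed

text \<open>The connecting map starts in degree 1. In degree 0 the only face is the empty set, which
  avoids \<open>v\<close> anyway.\<close>

lemma cyc0_pull_to_deletion:
  assumes U: "U \<subseteq> W" and z: "cyc U 0 z"
  shows "cyc (U - {v}) 0 z"
  unfolding cyc_def chain_def
proof (intro conjI allI impI)
  fix \<sigma> assume "z \<sigma> \<noteq> 0"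
  then have *: "\<sigma> \<in> indep E U" "card \<sigma> = 0" using z by (auto simp: cyc_def chain_def)
  then have "\<sigma> = {}" using fin U by (auto simp: indep_def dest: finite_subset)
  then show "\<sigma> \<in> indep E (U - {v})" "card \<sigma> = 0" by (auto simp: indep_def)
qed (use z in \<open>simp add: cyc_def\<close>)

lemma bnd_pull_to_link:
  assumes U: "U \<subseteq> W" "v \<in> U" and y: "cyc (U - {v}) k y" and b: "bnd U k y"
  shows "\<exists>b. cyc (U - cnbr E v) k b \<and> bnd (U - {v}) k (y + b)"
proof -
  obtain c where c: "chain U (Suc k) c" "y = bd c" using b by (auto simp: bnd_def)
  have v: "v \<in> W" using U by auto
  have y': "lk v y = 0" "dl v y = y"
    using y by (auto simp: cyc_def intro!: lk_eq_0 dl_eq)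
  have "cyc (U - cnbr E v) k (lk v c)"
    using chain_lk [OF c(1)] y' c(2) by (simp add: cyc_def lk_bd [symmetric])
  moreover have "y = bd (dl v c) + lk v c" using dl_bd [OF v, of c] y' c(2) by simp
  ultimately show ?thesis
    using chain_dl [OF c(1), of v] by (metis bnd_def chain_add_eq_iff)
qed

lemma cyc_from_link:
  assumes U: "U \<subseteq> W" "v \<in> U" and b: "cyc (U - cnbr E v) k b" and bb: "bnd (U - {v}) k b"
  shows "\<exists>z. cyc U (Suc k) z \<and> lk v z = b"
proof -
  obtain a where a: "chain (U - {v}) (Suc k) a" "b = bd a" using bb by (auto simp: bnd_def)
  have v: "v \<in> W" using U by auto
  have cb: "chain (U - cnbr E v) k b" using b by (simp add: cyc_def)
  have "bd (a + jn v b) = 0"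
    using bd_jn [OF cb v] a(2) b by (simp add: cyc_def)
  moreover have "chain U (Suc k) (a + jn v b)"
    using chain_jn [OF cb U(2,1)] chain_mono [OF a(1)] by auto
  moreover have "lk v (a + jn v b) = b"
    using lk_eq_0 [OF a(1), of v] lk_jn [OF cb] by simp
  ultimately show ?thesis by (auto simp: cyc_def)
qed

lemma lk_bnd:
  assumes "bnd U (Suc k) z" shows "bnd (U - cnbr E v) k (lk v z)"
proof -
  obtain c where "chain U (Suc (Suc k)) c" "z = bd c" using assms by (auto simp: bnd_def)
  then show ?thesis using chain_lk [of U "Suc k" c v] by (auto simp: bnd_def lk_bd)
qed

text \<open>By exactness the deletion has the same homology as the whole; the two parts are
  surjectivity and injectivity of the inclusion.\<close>

lemma nbc_deletion_of_acy_link: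
  assumes U: "U \<subseteq> W" "v \<in> U" and L: "acy (U - cnbr E v)"
  shows "nbc U k z \<Longrightarrow> \<exists>y. nbc (U - {v}) k y \<and> bnd U k (z + y)"
    and "nbc (U - {v}) k y \<Longrightarrow> nbc U k y"
proof -
  assume z: "nbc U k z"
  have "\<exists>y. cyc (U - {v}) k y \<and> bnd U k (z + y)"
  proof (cases k)
    case 0
    then show ?thesis using z cyc0_pull_to_deletion [OF U(1)] by (force simp: nbc_def)
  next
    case (Suc j)
    then show ?thesis
      using z L lk_cyc [of U j z v] cyc_pull_to_deletion [OF U, of j z] by (auto simp: nbc_def acy_def)
  qed
  then obtain y where y: "cyc (U - {v}) k y" "bnd U k (z + y)" by auto
  then have "\<not> bnd (U - {v}) k y"
    using z bnd_mono [of "U - {v}" k y U] bnd_add_iff by (auto simp: nbc_def)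
  with y show "\<exists>y. nbc (U - {v}) k y \<and> bnd U k (z + y)" by (auto simp: nbc_def)
next
  assume y: "nbc (U - {v}) k y"
  have "\<not> bnd U k y"
  proof
    assume "bnd U k y"
    then obtain b where "cyc (U - cnbr E v) k b" "bnd (U - {v}) k (y + b)"
      using bnd_pull_to_link [OF U] y by (auto simp: nbc_def)
    moreover then have "bnd (U - {v}) k b"
      using L bnd_mono [of "U - cnbr E v" k b "U - {v}"] by (auto simp: acy_def)
    ultimately show False using y bnd_add_iff by (auto simp: nbc_def)
  qed
  then show "nbc U k y" using y cyc_mono [of "U - {v}" k y U] by (auto simp: nbc_def)
qed

lemma acy_of_acy_link:
  assumes U: "U \<subseteq> W" "v \<in> U" and "acy (U - cnbr E v)" "acy (U - {v})"
  shows "acy U"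
  using nbc_deletion_of_acy_link(1) [OF U assms(3)] assms(4) by (metis acy_def nbc_def)

lemma sph_of_acy_link:
  assumes U: "U \<subseteq> W" "v \<in> U" and L: "acy (U - cnbr E v)" and D: "sph (U - {v}) k"
  shows "sph U k"
  unfolding sph_def rank1_def
proof (intro conjI allI impI)
  fix i j y z assume "nbc U i y" "nbc U j z"
  then obtain y' z' where *: "nbc (U - {v}) i y'" "bnd U i (y + y')" "nbc (U - {v}) j z'" "bnd U j (z + z')"
    using nbc_deletion_of_acy_link(1) [OF U L] by metis
  then have ij: "i = j" "bnd (U - {v}) j (y' + z')" using D by (auto simp: sph_def rank1_def)
  then have "bnd U j (y' + z')" using bnd_mono [of "U - {v}" j _ U] by auto
  then show "i = j" "bnd U j (y + z)"
    using ij * bnd_add_trans [of U j y y' z'] bnd_add_trans [of U j y z' z] by (auto simp: add.commute)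
qed (use D nbc_deletion_of_acy_link(2) [OF U L] in \<open>auto simp: sph_def\<close>)

text \<open>An acyclic deletion turns the connecting map \<open>lk v\<close> into an isomorphism
  that lowers the degree by one.\<close>

lemma sph_of_acy_deletion:
  assumes U: "U \<subseteq> W" "v \<in> U" and D: "acy (U - {v})" and L: "sph (U - cnbr E v) k"
  shows "sph U (Suc k)"
proof -
  have nb: "\<exists>m. i = Suc m \<and> nbc (U - cnbr E v) m (lk v z)" if z: "nbc U i z" for i z
  proof (cases i)
    case 0
    then have "cyc (U - {v}) i z" using z cyc0_pull_to_deletion [OF U(1)] by (simp add: nbc_def)
    then have "bnd U i z" using D bnd_mono [of "U - {v}" i z U] by (auto simp: acy_def)
    then show ?thesis using z by (simp add: nbc_def)
  next
    case (Suc m)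
    have "\<not> bnd (U - cnbr E v) m (lk v z)"
    proof
      assume "bnd (U - cnbr E v) m (lk v z)"
      then obtain y where "cyc (U - {v}) (Suc m) y" "bnd U (Suc m) (z + y)"
        using cyc_pull_to_deletion [OF U] z Suc by (auto simp: nbc_def)
      moreover then have "bnd U (Suc m) y"
        using D bnd_mono [of "U - {v}" _ y U] by (auto simp: acy_def)
      ultimately show False using z Suc bnd_add_iff by (auto simp: nbc_def)
    qed
    then show ?thesis using Suc z lk_cyc [of U m z v] by (simp add: nbc_def)
  qed
  have inj: "bnd U (Suc m) z" if z: "cyc U (Suc m) z" "bnd (U - cnbr E v) m (lk v z)" for m z
    using nb [of "Suc m" z] that by (auto simp: nbc_def)
  obtain b where b: "nbc (U - cnbr E v) k b" using L by (auto simp: sph_def)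
  then have "bnd (U - {v}) k b"
    using D cyc_mono [of "U - cnbr E v" k b "U - {v}"] by (auto simp: nbc_def acy_def)
  then obtain z where z: "cyc U (Suc k) z" "lk v z = b"
    using cyc_from_link [OF U, of k b] b by (auto simp: nbc_def)
  then have "nbc U (Suc k) z" using b lk_bnd [of U k z v] by (auto simp: nbc_def)
  moreover have "rank1 U"
    unfolding rank1_def
  proof (intro allI impI)
    fix i j y z assume yz: "nbc U i y" "nbc U j z"
    then obtain m n where mn: "i = Suc m" "nbc (U - cnbr E v) m (lk v y)"
      "j = Suc n" "nbc (U - cnbr E v) n (lk v z)"
      using nb by metis
    then have "m = n" "bnd (U - cnbr E v) n (lk v y + lk v z)"
      using L by (auto simp: sph_def rank1_def)
    then show "i = j \<and> bnd U j (y + z)"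
      using mn yz inj [of n "y + z"] by (auto simp: nbc_def cyc_add)
  qed
  ultimately show ?thesis by (auto simp: sph_def)
qed

text \<open>If the class of the link died in the deletion, it would lift to a class of
  \<open>U\<close> independent of the one from the deletion, against rank one. So the link maps
  isomorphically onto the deletion in homology, and the cone of this inclusion is acyclic.\<close>

lemma acy_of_sph_sph:
  assumes U: "U \<subseteq> W" "v \<in> U" and D: "sph (U - {v}) k" and L: "sph (U - cnbr E v) j"
    and G: "rank1 U"
  shows "acy U \<and> j = k"
proof -
  obtain b where b: "nbc (U - cnbr E v) j b" using L by (auto simp: sph_def)
  obtain y where y: "nbc (U - {v}) k y" using D by (auto simp: sph_def)
  have bU: "cyc (U - {v}) j b"
    using b cyc_mono [of "U - cnbr E v" j b "U - {v}"] by (auto simp: nbc_def)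
  have bnd_L: "bnd (U - cnbr E v) m c \<or> m = j \<and> bnd (U - cnbr E v) j (b + c)"
    if "cyc (U - cnbr E v) m c" for m c
    using that L b unfolding sph_def rank1_def nbc_def by metis
  show ?thesis
  proof (cases "bnd (U - {v}) j b")
    \<comment> \<open>The lift \<open>z\<close> of \<open>b\<close> and the cycle \<open>y\<close>
      are both nonzero in \<open>U\<close>, hence homologous; but then
      \<open>lk v (z + y) = b\<close> would bound.\<close>
    case True
    then obtain z where z: "cyc U (Suc j) z" "lk v z = b"
      using cyc_from_link [OF U, of j b] b by (auto simp: nbc_def)
    then have nz: "nbc U (Suc j) z" using b lk_bnd [of U j z v] by (auto simp: nbc_def)
    have "\<not> bnd U k y"
    proof
      assume "bnd U k y"
      then obtain c where c: "cyc (U - cnbr E v) k c" "bnd (U - {v}) k (y + c)"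
        using bnd_pull_to_link [OF U] y by (auto simp: nbc_def)
      have "bnd (U - {v}) k c"
        using bnd_L [OF c(1)] True bnd_mono [of "U - cnbr E v" _ _ "U - {v}"] bnd_add_iff
        by (metis add.commute link_subset_deletion)
      then show False using c y bnd_add_iff by (auto simp: nbc_def)
    qed
    then have "nbc U k y" using y cyc_mono [of "U - {v}" k y U] by (auto simp: nbc_def)
    then have *: "Suc j = k" "bnd U (Suc j) (z + y)"
      using nz G by (metis rank1_def)+
    have "lk v (z + y) = b"
      using y z by (auto simp: nbc_def cyc_def lk_eq_0 [of "U - {v}"])
    then show ?thesis using lk_bnd [OF *(2), of v] b by (auto simp: nbc_def)
  next
    case False
    then have jk: "j = k" "bnd (U - {v}) k (b + y)"
      using bU y D unfolding sph_def rank1_def nbc_def by metis+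
    have v: "v \<in> W" using U by auto
    have bd_b: "bnd U j b"
      using bd_jn [of U v j b] b v chain_jn [of U v j b] U
      by (auto simp: bnd_def nbc_def cyc_def intro!: exI [of _ "jn v b"])
    have "bnd U m z" if z: "cyc U m z" for m z
    proof -
      have "\<exists>w. cyc (U - {v}) m w \<and> bnd U m (z + w)"
      proof (cases m)
        case 0
        then show ?thesis using z cyc0_pull_to_deletion [OF U(1)] by force
      next
        case (Suc i)
        \<comment> \<open>Otherwise \<open>lk v z\<close> is homologous to \<open>b\<close> in the
          link, yet it bounds \<open>dl v z\<close> in the deletion, where \<open>b\<close> does not
          bound.\<close>
        have "bnd (U - cnbr E v) i (lk v z)"
        proof (rule ccontr)
          assume "\<not> ?thesis"
          then have *: "i = j" "bnd (U - cnbr E v) j (b + lk v z)"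
            using bnd_L lk_cyc z Suc by blast+
          have "lk v z = bd (dl v z)"
            using dl_bd [OF v, of z] z chain_add_eq_iff [of "bd (dl v z)" "lk v z" 0] by (simp add: cyc_def)
          then have "bnd (U - {v}) j (lk v z)"
            using chain_dl [of U m z v] z Suc *(1) by (auto simp: bnd_def cyc_def)
          then show False
            using False bnd_mono [OF *(2), of "U - {v}"] bnd_add_iff by auto
        qed
        then show ?thesis using cyc_pull_to_deletion [OF U] z Suc by simp
      qed
      then obtain w where w: "cyc (U - {v}) m w" "bnd U m (z + w)" by auto
      have "bnd U m w"
      proof (cases "bnd (U - {v}) m w")
        case True
        then show ?thesis using bnd_mono [of "U - {v}" m w U] by auto
      next
        case nw: False
        then have "m = j" "bnd (U - {v}) m (w + b)"
          using bU False w D unfolding sph_def rank1_def nbc_def by metis+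
        then show ?thesis using bnd_mono [of "U - {v}" m "w + b" U] bd_b bnd_add_iff by auto
      qed
      then show ?thesis using w(2) bnd_add_iff by auto
    qed
    then show ?thesis using jk by (auto simp: acy_def)
  qed
qed

end

section \<open>Acyclicity and degrees of link, deletion and whole complex\<close>

context stable_complex
begin

text \<open>This and the next four lemmas are cases of one fact: in an exact triangle of three
  complexes of rank at most one, either all are acyclic or exactly one is, and the remaining
  isomorphism fixes the degrees.\<close>

lemma sph_deletion_sph:
  assumes "U \<subseteq> W" "v \<in> U" "sph U m" "sph (U - {v}) k" "rank1 (U - cnbr E v)"
  shows "acy (U - cnbr E v) \<and> k = m"
  using acy_or_sph [OF assms(5)] acy_of_sph_sph [OF assms(1,2,4)] sph_of_acy_link [OF assms(1,2)]
    sph_not_acy sph_unique sph_rank1 assms by metis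

lemma sph_link_sph:
  assumes "U \<subseteq> W" "v \<in> U" "sph U m" "sph (U - cnbr E v) j" "rank1 (U - {v})"
  shows "acy (U - {v}) \<and> m = Suc j"
  using acy_or_sph [OF assms(5)] acy_of_sph_sph [OF assms(1,2) _ assms(4)]
    sph_of_acy_deletion [OF assms(1,2)] sph_not_acy sph_unique sph_rank1 assms by metis

lemma sph_link_of_acy_deletion:
  assumes "U \<subseteq> W" "v \<in> U" "sph U m" "acy (U - {v})" "rank1 (U - cnbr E v)"
  shows "\<exists>j. sph (U - cnbr E v) j \<and> m = Suc j"
  using acy_or_sph [OF assms(5)] acy_of_acy_link [OF assms(1,2)]
    sph_of_acy_deletion [OF assms(1,2)] sph_not_acy sph_unique assms by metis

lemma acy_link_of_acy_deletion:
  assumes "U \<subseteq> W" "v \<in> U" "acy U" "acy (U - {v})" "rank1 (U - cnbr E v)"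
  shows "acy (U - cnbr E v)"
  using acy_or_sph [OF assms(5)] sph_of_acy_deletion [OF assms(1,2)] sph_not_acy assms by metis

lemma sph_link_of_acy:
  assumes "U \<subseteq> W" "v \<in> U" "acy U" "sph (U - {v}) k" "rank1 (U - cnbr E v)"
  shows "sph (U - cnbr E v) k"
  using acy_or_sph [OF assms(5)] sph_of_acy_link [OF assms(1,2)] sph_not_acy
    acy_of_sph_sph [OF assms(1,2,4)] acy_rank1 assms by metis

text \<open>The complex is a cone with apex \<open>v\<close>, and the cone over
  \<open>dl v z\<close> fills \<open>z\<close>.\<close>

lemma acy_isolated:
  assumes U: "U \<subseteq> W" "v \<in> U" and iso: "\<And>u. u \<in> U \<Longrightarrow> {v, u} \<notin> E"
  shows "acy U"
  unfolding acy_def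
proof (intro allI impI)
  fix k z assume z: "cyc U k z"
  have v: "v \<in> W" using U by auto
  have L: "U - cnbr E v = U - {v}" using iso by (auto simp: cnbr_def)
  then have d: "chain (U - cnbr E v) k (dl v z)" using z chain_dl by (simp add: cyc_def)
  have "bd (dl v z) = lk v z"
    using dl_bd [OF v, of z] z chain_add_eq_iff [of "bd (dl v z)" "lk v z" 0] by (simp add: cyc_def)
  then have "z = bd (jn v (dl v z))"
    using bd_jn [OF d v] dl_jn_lk [of v z] by simp
  then show "bnd U k z"
    using chain_jn [OF d U(2,1)] by (auto simp: bnd_def)
qed

lemma sph_empty: "sph {} 0"
proof -
  have i: "indep E {} = {{}}" by (auto simp: indep_def)
  have b0: "bnd {} k z \<Longrightarrow> z = 0" for k z
  proof -
    assume "bnd {} k z"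
    then obtain c where c: "chain {} (Suc k) c" "z = bd c" by (auto simp: bnd_def)
    have "c \<sigma> = 0" for \<sigma> using c(1) i by (force simp: chain_def)
    then show "z = 0" using c(2) by (simp add: bd_def fun_eq_iff)
  qed
  have cy: "cyc {} k z \<Longrightarrow> z \<noteq> 0 \<Longrightarrow> k = 0 \<and> z = (\<lambda>\<sigma>. if \<sigma> = {} then 1 else 0)" for k z
  proof -
    assume z: "cyc {} k z" "z \<noteq> 0"
    then obtain \<sigma> where "z \<sigma> \<noteq> 0" by (auto simp: fun_eq_iff)
    then have "\<sigma> = {}" "k = 0" "z {} \<noteq> 0" using z i by (auto simp: cyc_def chain_def)
    moreover have "z \<tau> = 0" if "\<tau> \<noteq> {}" for \<tau> using z i that by (auto simp: cyc_def chain_def)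
    ultimately show ?thesis by (cases "z {}") (auto simp: fun_eq_iff)
  qed
  let ?z = "\<lambda>\<sigma>::'a set. if \<sigma> = {} then 1 else 0 :: bit"
  have "chain {} 0 ?z" by (auto simp: chain_def i)
  then have "cyc {} 0 ?z" by (simp add: cyc_def chain_0_bd)
  moreover have "?z \<noteq> 0" by (auto simp: fun_eq_iff)
  ultimately have "nbc {} 0 ?z" using b0 by (auto simp: nbc_def)
  moreover have "rank1 {}"
    unfolding rank1_def
  proof (intro allI impI)
    fix j k y z assume "nbc {} j y" "nbc {} k z"
    then have "j = 0 \<and> y = ?z" "k = 0 \<and> z = ?z"
      using cy by (metis nbc_def bnd_0)+
    then show "j = k \<and> bnd {} k (y + z)" by simp
  qed
  ultimately show ?thesis by (auto simp: sph_def)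
qed

end

section \<open>Minimal counterexamples: degrees of deletions and links\<close>

locale critical_graph = stable_complex +
  fixes V :: "'a set"
  assumes VW: "V \<subseteq> W"
    and proper_rank1: "\<And>U. U \<subset> V \<Longrightarrow> rank1 U"
    and deletion_not_acy: "\<And>v. v \<in> V \<Longrightarrow> \<not> acy (V - {v})"
    and link_not_acy: "\<And>v. v \<in> V \<Longrightarrow> \<not> acy (V - cnbr E v)"
    and not_isolated: "\<And>v. v \<in> V \<Longrightarrow> \<exists>u\<in>V. {v, u} \<in> E"
begin

text \<open>In a critical graph proper induced subgraphs have rank at most one and no deletion or
  link of a vertex is acyclic, so all of them are spheres. \<open>lam\<close> and \<open>ml\<close>
  are their degrees.\<close>

definition lam :: "'a \<Rightarrow> nat" where "lam v = (SOME k. sph (V - {v}) k)"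

definition ml :: "'a \<Rightarrow> nat" where "ml v = (SOME k. sph (V - cnbr E v) k)"

lemma sph_lam: assumes "v \<in> V" shows "sph (V - {v}) (lam v)"
  unfolding lam_def
  using deletion_not_acy [OF assms] acy_or_sph [of "V - {v}"] proper_rank1 [of "V - {v}"] assms
  by (intro someI_ex [of "sph (V - {v})"]) auto

lemma sph_ml: assumes "v \<in> V" shows "sph (V - cnbr E v) (ml v)"
  unfolding ml_def
  using link_not_acy [OF assms] acy_or_sph [of "V - cnbr E v"] proper_rank1 [of "V - cnbr E v"]
    assms self_mem_cnbr [of v E]
  by (intro someI_ex [of "sph (V - cnbr E v)"]) blast

text \<open>Deleting \<open>u\<close> does not change the link of its neighbour \<open>v\<close>. So
  in the sphere \<open>V - {u}\<close> the link of \<open>v\<close> is a sphere, which leaves only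
  the deletion of \<open>v\<close> to be acyclic.\<close>

lemma edge_props:
  assumes uv: "u \<in> V" "v \<in> V" "{u, v} \<in> E"
  shows "acy (V - {u} - {v})" and "lam u = Suc (ml v)"
proof -
  have ne: "u \<noteq> v" using uv no_loop by auto
  have "V - {u} - cnbr E v = V - cnbr E v" using uv(3) by (auto simp: cnbr_def insert_commute)
  then have L: "sph (V - {u} - cnbr E v) (ml v)" using sph_ml [OF uv(2)] by simp
  have "rank1 (V - {u} - {v})" using uv by (intro proper_rank1) auto
  then show "acy (V - {u} - {v})" "lam u = Suc (ml v)"
    using sph_link_sph [OF _ _ sph_lam [OF uv(1)] L] VW uv ne by auto
qed

text \<open>For nonadjacent vertices, \<open>V - {u} - cnbr E v\<close> is a link inside
  \<open>V - {u}\<close> and also a deletion inside \<open>V - cnbr E v\<close>; comparing the two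
  readings gives both claims.\<close>

lemma acy_pair_props:
  assumes uv: "u \<in> V" "v \<in> V" "u \<noteq> v" and a: "acy (V - {u} - {v})"
  shows "lam u = Suc (ml v)"
    and "{u, v} \<notin> E \<Longrightarrow> acy (V - cnbr E v - cnbr E u)"
proof -
  have *: "lam u = Suc (ml v) \<and> acy (V - cnbr E v - cnbr E u)" if ne: "{u, v} \<notin> E"
  proof -
    have "rank1 (V - {u} - cnbr E v)" using uv by (intro proper_rank1) auto
    then obtain l where l: "sph (V - {u} - cnbr E v) l" "lam u = Suc l"
      using sph_link_of_acy_deletion [OF _ _ sph_lam [OF uv(1)] a] VW uv by auto
    have "V - {u} - cnbr E v = V - cnbr E v - {u}" by auto
    moreover have "u \<in> V - cnbr E v" using uv ne by (auto simp: cnbr_def insert_commute)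
    moreover have "rank1 (V - cnbr E v - cnbr E u)"
      using uv self_mem_cnbr [of v E] by (intro proper_rank1) blast
    ultimately show ?thesis
      using sph_deletion_sph [OF _ _ sph_ml [OF uv(2)], of u l] VW l by auto
  qed
  then show "{u, v} \<notin> E \<Longrightarrow> acy (V - cnbr E v - cnbr E u)" by simp
  show "lam u = Suc (ml v)" using * edge_props(2) [OF uv(1,2)] by blast
qed

text \<open>The complex after taking links at \<open>X\<close> and deleting \<open>Y\<close>;
  enlarging \<open>X\<close> or \<open>Y\<close> by one vertex is one use of the exact
  sequence.\<close>

definition Q :: "'a set \<Rightarrow> 'a set \<Rightarrow> 'a set" where
  "Q X Y = V - (\<Union>x\<in>X. cnbr E x) - Y"

lemma Q_delete: "Q X Y - {w} = Q X (insert w Y)"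
  and Q_link: "Q X Y - cnbr E w = Q (insert w X) Y"
  and Q_empty: "Q {} Y = V - Y"
  and Q_subset: "Q X Y \<subseteq> V"
  by (auto simp: Q_def)

lemma Q_psubset: "X \<subseteq> V \<Longrightarrow> Y \<subseteq> V \<Longrightarrow> X \<union> Y \<noteq> {} \<Longrightarrow> Q X Y \<subset> V"
  using self_mem_cnbr unfolding Q_def by fast

text \<open>If all \<open>V - A\<close> with \<open>{} \<noteq> A \<subset> S\<close> are spheres but \<open>V - S\<close> is acyclic, then \<open>Q X (S - X)\<close>
  has degree \<open>lam w - 1\<close> for every \<open>{} \<noteq> X \<subset> S\<close>, while \<open>Q X {}\<close> has degree \<open>ml w + 1 - card X\<close>.
  The two agree when \<open>S - X\<close> is a singleton.\<close>

lemma lam_le_ml_of_minimal_acy: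
  assumes S: "S \<subseteq> V" "acy (V - S)" "3 \<le> card S"
    and min: "\<And>A. A \<noteq> {} \<Longrightarrow> A \<subset> S \<Longrightarrow> \<not> acy (V - A)"
    and w: "w \<in> S"
  shows "lam w \<le> ml w"
proof -
  have finS: "finite S" using S(3) by (metis card.infinite not_numeral_le_zero)
  \<comment> \<open>An adjacent pair in \<open>S\<close> already has an acyclic complement, and it
    is a proper subset of \<open>S\<close>.\<close>
  have indS: "{u, u'} \<notin> E" if u: "u \<in> S" "u' \<in> S" for u u'
  proof (cases "u = u'")
    case False
    have "card {u, u'} < card S" using S(3) False by simp
    then have "{u, u'} \<subset> S" using u by (metis psubsetI insert_subset empty_subsetI order_less_irrefl)
    then have "\<not> acy (V - {u, u'})" by (intro min) auto
    moreover have "V - {u} - {u'} = V - {u, u'}" by auto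
    ultimately show ?thesis using edge_props(1) [of u u'] S(1) u by auto
  qed (use no_loop in auto)
  have mem: "u \<in> Q X Y" if "u \<in> S" "X \<subseteq> S" "u \<notin> X" "u \<notin> Y" for u X Y
    using that S(1) indS by (auto simp: Q_def cnbr_def)
  have rk: "rank1 (Q X Y)" if "X \<subseteq> S" "Y \<subseteq> S" "X \<union> Y \<noteq> {}" for X Y
    using Q_psubset [of X Y] that S(1) by (intro proper_rank1) auto
  have QW: "Q X Y \<subseteq> W" for X Y using Q_subset VW by blast
  \<comment> \<open>By minimality each deletion inside \<open>S\<close> leads from a sphere to a
    sphere, and so preserves the degree.\<close>
  have sphA: "sph (Q {} (insert u B)) (lam u)" if "finite B" "u \<in> S" "insert u B \<subset> S" for u B
    using that
  proof (induction B rule: finite_induct)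
    case empty
    then show ?case using sph_lam [of u] S(1) by (auto simp: Q_empty)
  next
    case (insert x B)
    show ?case
    proof (cases "x = u")
      case True then show ?thesis using insert by simp
    next
      case False
      let ?U = "Q {} (insert u B)"
      have xm: "x \<in> ?U" using insert False by (intro mem) auto
      have D: "?U - {x} = Q {} (insert u (insert x B))" by (simp add: Q_delete insert_commute)
      have "\<not> acy (?U - {x})" using insert.prems min [of "insert u (insert x B)"] D by (auto simp: Q_empty)
      then obtain k where k: "sph (?U - {x}) k"
        using acy_or_sph rk [of "{}" "insert u (insert x B)"] insert.prems D by fastforce
      have "rank1 (?U - cnbr E x)"
        unfolding Q_link using insert.prems by (intro rk) auto
      then have "k = lam u"
        using sph_deletion_sph [OF QW xm _ k] insert by blast
      then show ?thesis using k D by simp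
    qed
  qed
  have lam_eq: "lam u = lam w" if u: "u \<in> S" for u
  proof (cases "u = w")
    case False
    have "card {u, w} < card S" using S(3) False by simp
    then have "{u, w} \<subset> S" using u w by (metis psubsetI insert_subset empty_subsetI order_less_irrefl)
    then have "sph (Q {} {u, w}) (lam u)" "sph (Q {} {w, u}) (lam w)"
      using sphA [of "{w}" u] sphA [of "{u}" w] u w by (auto simp: insert_commute)
    then show ?thesis by (metis insert_commute sph_unique)
  qed simp
  have sphA': "sph (Q {} A) (lam w)" if A: "A \<noteq> {}" "A \<subset> S" for A
  proof -
    obtain u where u: "u \<in> A" using A by auto
    then have "sph (Q {} (insert u A)) (lam u)" using A finS
      by (intro sphA) (auto simp: insert_absorb dest: finite_subset)
    then show ?thesis using u lam_eq A by (simp add: insert_absorb subset_iff psubset_eq)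
  qed
  \<comment> \<open>The link between two spheres joined by a deletion is acyclic; from then on whole
    and deletion are both acyclic, hence so is the next link.\<close>
  have Z: "acy (Q X Y)" if "finite X" "X \<noteq> {}" "Y \<noteq> {}" "X \<inter> Y = {}" "X \<union> Y \<subset> S" for X Y
    using that
  proof (induction X arbitrary: Y rule: finite_ne_induct)
    case (singleton x)
    have xm: "x \<in> Q {} Y" using singleton by (intro mem) auto
    have "sph (Q {} Y) (lam w)" "sph (Q {} Y - {x}) (lam w)"
      unfolding Q_delete using singleton by (auto intro!: sphA')
    then show ?case
      using sph_deletion_sph [OF QW xm] rk [of "{x}" Y] singleton by (auto simp: Q_link)
  next
    case (insert x X)
    have xm: "x \<in> Q X Y" using insert by (intro mem) auto
    have "acy (Q X Y)" using insert.prems by (intro insert.IH) auto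
    moreover have "acy (Q X Y - {x})" unfolding Q_delete using insert.prems insert.hyps by (intro insert.IH) auto
    ultimately show ?case
      using acy_link_of_acy_deletion [OF QW xm] rk [of "insert x X" Y] insert by (auto simp: Q_link)
  qed
  \<comment> \<open>The deletion that completes \<open>S\<close> reaches an acyclic complex, which
    lowers the degree of the link by one. Trading a further deletion for a link keeps the degree, as
    the complex before it is acyclic by \<open>Z\<close>.\<close>
  have a: "\<exists>l. lam w = Suc l \<and> sph (Q X Y) l"
    if "finite X" "X \<noteq> {}" "Y \<noteq> {}" "X \<inter> Y = {}" "X \<union> Y = S" for X Y
    using that
  proof (induction X arbitrary: Y rule: finite_ne_induct)
    case (singleton x)
    have xm: "x \<in> Q {} Y" using singleton by (intro mem) auto
    have "sph (Q {} Y) (lam w)" using singleton by (intro sphA') auto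
    moreover have "acy (Q {} Y - {x})" unfolding Q_delete using singleton S(2) by (simp add: Q_empty)
    ultimately show ?case
      using sph_link_of_acy_deletion [OF QW xm] rk [of "{x}" Y] singleton by (auto simp: Q_link)
  next
    case (insert x X)
    have xm: "x \<in> Q X Y" using insert by (intro mem) auto
    have "acy (Q X Y)" using insert by (intro Z) auto
    moreover obtain l where l: "lam w = Suc l" "sph (Q X Y - {x}) l"
      unfolding Q_delete using insert.IH [of "insert x Y"] insert.prems insert.hyps by auto
    ultimately show ?case
      using sph_link_of_acy [OF QW xm] rk [of "insert x X" Y] insert.prems by (auto simp: Q_link)
  qed
  \<comment> \<open>Without deletions each further link costs one degree, because the corresponding
    deletion is acyclic by \<open>Z\<close>.\<close>
  have b: "\<exists>s. sph (Q (insert w B) {}) s \<and> s + card (insert w B) = Suc (ml w)"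
    if "finite B" "insert w B \<subset> S" for B
    using that
  proof (induction B rule: finite_induct)
    case empty
    then show ?case using sph_ml [of w] S(1) w by (auto simp: Q_def)
  next
    case (insert x B)
    show ?case
    proof (cases "x = w")
      case True then show ?thesis using insert by simp
    next
      case False
      let ?X = "insert w B"
      have xm: "x \<in> Q ?X {}" using insert False by (intro mem) auto
      obtain s where s: "sph (Q ?X {}) s" "s + card ?X = Suc (ml w)" using insert by auto
      have "acy (Q ?X {} - {x})"
        unfolding Q_delete using insert False by (intro Z) auto
      moreover have "rank1 (Q ?X {} - cnbr E x)"
        unfolding Q_link using insert.prems by (intro rk) auto
      ultimately obtain j where j: "sph (Q (insert x ?X) {}) j" "s = Suc j"
        using sph_link_of_acy_deletion [OF QW xm s(1)] by (auto simp: Q_link)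
      have "insert w (insert x B) = insert x ?X" "card (insert x ?X) = Suc (card ?X)"
        using insert.hyps False by auto
      then show ?thesis using j s by (metis add_Suc_shift)
    qed
  qed
  have "\<not> S \<subseteq> {w}"
  proof
    assume "S \<subseteq> {w}"
    then have "card S \<le> 1" by (metis card.empty card_insert_le_m1 card_mono finite.emptyI finite.insertI is_singletonI is_singleton_altdef)
    then show False using S(3) by simp
  qed
  then obtain a where x: "a \<in> S" "a \<noteq> w" by auto
  let ?X = "S - {a}"
  have wX: "insert w ?X = ?X" using x w by auto
  then obtain s where s: "sph (Q ?X {}) s" "s + card ?X = Suc (ml w)"
    using b [of ?X] x finS by (metis DiffE finite_Diff insertI1 psubsetI Diff_subset)
  obtain l where l: "lam w = Suc l" "sph (Q ?X {a}) l"
    using a [of ?X "{a}"] x w finS by auto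
  have am: "a \<in> Q ?X {}" using x by (intro mem) auto
  have "rank1 (Q ?X {} - cnbr E a)"
    unfolding Q_link using x by (intro rk) auto
  then have "l = s"
    using sph_deletion_sph [OF QW am s(1), of l] l(2) by (simp add: Q_delete)
  \<comment> \<open>Now \<open>lam w + card ?X = ml w + 2\<close>. Three elements in
    \<open>S\<close> are what pushes \<open>lam w\<close> below \<open>ml w + 1\<close>.\<close>
  moreover have "card ?X \<ge> 2" using S(3) x finS by simp
  ultimately show ?thesis using l s by simp
qed

text \<open>The vertex \<open>v\<close> survives and has become isolated.\<close>

lemma acy_open_nbr: assumes v: "v \<in> V" shows "acy (V - {u. {v, u} \<in> E})"
  using v VW no_loop by (intro acy_isolated [of _ v]) auto

text \<open>All neighbours of \<open>v\<close> together have an acyclic complement, so there is a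
  smallest nonempty set of neighbours with this property. It is no singleton; size two gives the
  first alternative, larger size the second.\<close>

lemma acy_pair_or_lam_le_ml:
  assumes v: "v \<in> V"
  shows "(\<exists>x y. x \<in> V \<and> y \<in> V \<and> {v, x} \<in> E \<and> {v, y} \<in> E \<and> x \<noteq> y \<and> acy (V - {x} - {y}))
    \<or> (\<exists>w\<in>V. {v, w} \<in> E \<and> lam w \<le> ml w)"
proof -
  let ?N = "V \<inter> {u. {v, u} \<in> E}"
  let ?P = "\<lambda>S. S \<noteq> {} \<and> S \<subseteq> ?N \<and> acy (V - S)"
  have "V - ?N = V - {u. {v, u} \<in> E}" by auto
  then have "?P ?N" using acy_open_nbr [OF v] not_isolated [OF v] by auto
  then obtain S where S: "?P S" and min: "\<And>T. ?P T \<Longrightarrow> card S \<le> card T"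
    using ex_has_least_nat [of ?P ?N card] by blast
  have finS: "finite S" using S VW fin finite_subset by (metis le_infE)
  have min': "\<not> acy (V - A)" if "A \<noteq> {}" "A \<subset> S" for A
    using min [of A] that S psubset_card_mono [OF finS, of A] by fastforce
  obtain x where x: "x \<in> S" using S by auto
  have "S \<noteq> {x}" using S x deletion_not_acy [of x] by auto
  then obtain y where y: "y \<in> S" "y \<noteq> x" using x by auto
  show ?thesis
  proof (cases "S = {x, y}")
    case True
    then have "V - {x} - {y} = V - S" by auto
    then show ?thesis using S x y by (intro disjI1 exI [of _ x] exI [of _ y]) auto
  next
    case False
    then have "{x, y} \<subset> S" using x y by auto
    then have "card {x, y} < card S" using finS psubset_card_mono by blast
    then have "3 \<le> card S" using y by simp
    then have "lam x \<le> ml x"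
      using lam_le_ml_of_minimal_acy [OF _ _ _ min' x] S by auto
    then show ?thesis using S x by auto
  qed
qed

text \<open>Combines the degree formula for the two edges at \<open>v\<close> with the one for the
  acyclic pair.\<close>

lemma lam_eq_of_acy_pair_in_nbr:
  assumes "v \<in> V" "x \<in> V" "y \<in> V" "{v, x} \<in> E" "{v, y} \<in> E" "x \<noteq> y" "acy (V - {x} - {y})"
  shows "lam v = Suc (ml v)"
proof -
  have "lam x = Suc (ml y)" using acy_pair_props(1) assms by blast
  moreover have "lam x = Suc (ml v)" "lam v = Suc (ml y)"
    using edge_props(2) [of x v] edge_props(2) [of v y] assms by (auto simp: insert_commute)
  ultimately show ?thesis by simp
qed

text \<open>The bad alternative at \<open>v\<close> yields a neighbour \<open>w\<close>, where the
  good alternative is impossible, hence a neighbour \<open>u\<close> of \<open>w\<close> with the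
  same inequality. Along the edge \<open>lam\<close> and \<open>ml\<close> trade places up to one,
  so both inequalities cannot hold.\<close>

lemma ex_acy_pair_in_nbr:
  assumes v: "v \<in> V"
  shows "\<exists>x y. x \<in> V \<and> y \<in> V \<and> {v, x} \<in> E \<and> {v, y} \<in> E \<and> x \<noteq> y \<and> acy (V - {x} - {y})"
proof (rule ccontr)
  assume "\<not> ?thesis"
  then obtain w where w: "w \<in> V" "{v, w} \<in> E" "lam w \<le> ml w"
    using acy_pair_or_lam_le_ml [OF v] by blast
  from acy_pair_or_lam_le_ml [OF w(1)] show False
  proof (elim disjE exE bexE conjE)
    fix x y assume "x \<in> V" "y \<in> V" "{w, x} \<in> E" "{w, y} \<in> E" "x \<noteq> y" "acy (V - {x} - {y})"
    then show False using lam_eq_of_acy_pair_in_nbr [of w x y] w by auto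
  next
    fix u assume u: "u \<in> V" "{w, u} \<in> E" "lam u \<le> ml u"
    have "lam u = Suc (ml w)" "lam w = Suc (ml u)"
      using edge_props(2) [of u w] edge_props(2) [of w u] u w by (auto simp: insert_commute)
    then show False using u w by simp
  qed
qed

lemma lam_eq: "v \<in> V \<Longrightarrow> lam v = Suc (ml v)"
  using ex_acy_pair_in_nbr lam_eq_of_acy_pair_in_nbr by blast

end

lemma mod3_distinct2:
  fixes a b :: nat
  assumes "a < 3" "b < 3" "a \<noteq> b"
  shows "b = Suc a mod 3 \<or> a = Suc b mod 3"
proof -
  have "a = 0 \<or> a = 1 \<or> a = 2" "b = 0 \<or> b = 1 \<or> b = 2" using assms by linarith+
  then show ?thesis using assms(3) by (elim disjE) simp_all
qed

lemma mod3_distinct3: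
  fixes a b c :: nat
  assumes "a < 3" "b < 3" "c < 3" "a \<noteq> b" "a \<noteq> c" "b \<noteq> c"
  shows "b = Suc a mod 3 \<or> c = Suc a mod 3"
proof -
  have "a = 0 \<or> a = 1 \<or> a = 2" "b = 0 \<or> b = 1 \<or> b = 2" "c = 0 \<or> c = 1 \<or> c = 2"
    using assms by linarith+
  then show ?thesis using assms(4-6) by (elim disjE) simp_all
qed

section \<open>Homology classes of the deletions and the three-colouring\<close>

context critical_graph
begin

definition gen :: "'a \<Rightarrow> 'a chain" where "gen v = (SOME z. nbc (V - {v}) (lam v) z)"

lemma gen: "v \<in> V \<Longrightarrow> nbc (V - {v}) (lam v) (gen v)"
  unfolding gen_def using sph_lam [of v] by (metis (mono_tags, lifting) someI_ex sph_def)

lemma lk_gen: assumes "v \<in> V" shows "lk v (gen v) = 0"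
  using gen [OF assms] by (auto simp: nbc_def cyc_def intro: lk_eq_0 [of "V - {v}"])

text \<open>Whatever dies on the way from the deletion comes from degree \<open>lam v\<close> of the
  link, but the link has homology only in degree \<open>ml v\<close>, one lower.\<close>

lemma gen_nbc: assumes v: "v \<in> V" shows "nbc V (lam v) (gen v)"
proof -
  have vW: "v \<in> W" using v VW by auto
  have g: "dl v (gen v) = gen v"
    using gen [OF v] by (auto simp: nbc_def cyc_def intro: dl_eq [of "V - {v}"])
  have "\<not> bnd V (lam v) (gen v)"
  proof
    assume "bnd V (lam v) (gen v)"
    then obtain c where c: "chain V (Suc (lam v)) c" "gen v = bd c" by (auto simp: bnd_def)
    have "cyc (V - cnbr E v) (lam v) (lk v c)"
      using chain_lk [OF c(1)] lk_gen [OF v] c(2) by (simp add: cyc_def lk_bd [symmetric])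
    then have "bnd (V - cnbr E v) (lam v) (lk v c)"
      using sph_ml [OF v] lam_eq [OF v] unfolding sph_def rank1_def nbc_def
      by (metis n_not_Suc_n)
    then have "bnd (V - {v}) (lam v) (lk v c)" by (rule bnd_mono) simp
    moreover have "gen v = bd (dl v c) + lk v c" using dl_bd [OF vW, of c] g c(2) by simp
    ultimately have "bnd (V - {v}) (lam v) (gen v)"
      using chain_dl [OF c(1), of v] bnd_add [of "V - {v}" "lam v" "bd (dl v c)" "lk v c"]
      by (auto simp: bnd_def)
    then show False using gen [OF v] by (simp add: nbc_def)
  qed
  then show ?thesis using gen [OF v] cyc_mono [of "V - {v}" _ _ V] by (auto simp: nbc_def)
qed

text \<open>By exactness a class of \<open>V\<close> comes from the deletion or has nonzero image in
  the link; \<open>lam_eq\<close> puts both kinds in the same degree.\<close>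

lemma nbc_cases:
  assumes v: "v \<in> V" and z: "nbc V m z"
  shows "m = lam v \<and> (bnd V m (z + gen v) \<or> nbc (V - cnbr E v) (ml v) (lk v z))"
proof (cases "\<exists>j. m = Suc j \<and> \<not> bnd (V - cnbr E v) j (lk v z)")
  case True
  then obtain j where j: "m = Suc j" "\<not> bnd (V - cnbr E v) j (lk v z)" by auto
  then have n: "nbc (V - cnbr E v) j (lk v z)"
    using z lk_cyc [of V j z v] by (simp add: nbc_def)
  then have "j = ml v" using sph_ml [OF v] unfolding sph_def rank1_def by metis
  then show ?thesis using n j lam_eq [OF v] by simp
next
  case False
  have "\<exists>y. cyc (V - {v}) m y \<and> bnd V m (z + y)"
  proof (cases m)
    case 0
    then show ?thesis using z cyc0_pull_to_deletion [OF VW] by (force simp: nbc_def)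
  next
    case (Suc j)
    then show ?thesis using z False cyc_pull_to_deletion [OF VW v, of j z] by (auto simp: nbc_def)
  qed
  then obtain y where y: "cyc (V - {v}) m y" "bnd V m (z + y)" by auto
  then have "\<not> bnd (V - {v}) m y"
    using z bnd_mono [of "V - {v}" m y V] bnd_add_iff by (auto simp: nbc_def)
  then have "m = lam v" "bnd (V - {v}) m (y + gen v)"
    using y gen [OF v] sph_lam [OF v] unfolding sph_def rank1_def nbc_def by metis+
  then show ?thesis using y(2) bnd_mono [of "V - {v}" m "y + gen v" V] bnd_add_trans by blast
qed

lemma lam_const: "u \<in> V \<Longrightarrow> v \<in> V \<Longrightarrow> lam u = lam v"
  using nbc_cases gen_nbc by blast

definition same :: "'a \<Rightarrow> 'a \<Rightarrow> bool" where
  "same u v \<longleftrightarrow> bnd V (lam u) (gen u + gen v)"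

lemma same_sym: "u \<in> V \<Longrightarrow> v \<in> V \<Longrightarrow> same u v \<Longrightarrow> same v u"
  using lam_const [of u v] by (simp add: same_def add.commute)

lemma same_trans: "u \<in> V \<Longrightarrow> v \<in> V \<Longrightarrow> same u v \<Longrightarrow> same v w \<Longrightarrow> same u w"
  unfolding same_def using lam_const bnd_add_trans by metis

text \<open>\<open>V\<close> has homology of rank at most 2, hence at most three nonzero classes.\<close>

lemma same_pigeonhole:
  assumes V: "v \<in> V" "x \<in> V" "y \<in> V" "z \<in> V"
    and n: "\<not> same x v" "\<not> same y v" "\<not> same z v" "\<not> same x y" "\<not> same x z"
  shows "same y z"
proof -
  let ?k = "lam v" and ?L = "V - cnbr E v"
  have k: "lam x = ?k" "lam y = ?k" "lam z = ?k" using lam_const V by blast+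
  \<comment> \<open>\<open>gen x\<close> and \<open>gen w\<close> have the same nonzero image in the
    link, so their sum vanishes there and must be the class of \<open>gen v\<close>.\<close>
  have *: "bnd V ?k (gen x + gen w + gen v)"
    if w: "w \<in> V" "\<not> same w v" "\<not> same x w" for w
  proof -
    have kw: "lam w = ?k" using lam_const V w by blast
    have L: "nbc ?L (ml v) (lk v (gen x))" "nbc ?L (ml v) (lk v (gen w))"
      using nbc_cases [OF V(1) gen_nbc [OF V(2)]] nbc_cases [OF V(1) gen_nbc [OF w(1)]] n w
      by (auto simp: same_def)
    then have "\<not> nbc ?L (ml v) (lk v (gen x + gen w))"
      using sph_ml [OF V(1)] by (auto simp: sph_def rank1_def nbc_def)
    moreover have "nbc V ?k (gen x + gen w)"
      using gen_nbc [OF V(2)] gen_nbc [OF w(1)] w(3) k kw by (auto simp: nbc_def same_def cyc_add)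
    ultimately show ?thesis using nbc_cases [OF V(1), of ?k "gen x + gen w"] by blast
  qed
  have "bnd V ?k ((gen x + gen y + gen v) + (gen x + gen z + gen v))"
    using bnd_add [OF * [of y] * [of z]] V n by simp
  moreover have "(gen x + gen y + gen v) + (gen x + gen z + gen v) = gen y + gen z"
    by (simp add: ac_simps)
  ultimately show ?thesis using k by (simp add: same_def)
qed

text \<open>A Mayer-Vietoris argument for \<open>V - {u}\<close> and \<open>V - {v}\<close>, whose
  intersection is acyclic. A chain bounded by \<open>gen u + gen v\<close> is freed of faces
  containing both vertices and split between the two deletions. The halves then meet in a cycle of
  the intersection, so \<open>gen u\<close> would bound in \<open>V - {u}\<close>.\<close>

lemma not_same_of_acy_pair:
  assumes uv: "u \<in> V" "v \<in> V" "u \<noteq> v" and a: "acy (V - {u} - {v})"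
  shows "\<not> same u v"
proof
  assume s: "same u v"
  let ?k = "lam u"
  have k: "lam v = ?k" using lam_const uv by blast
  have W: "u \<in> W" "v \<in> W" using uv VW by auto
  obtain c where c: "chain V (Suc ?k) c" "gen u + gen v = bd c"
    using s by (auto simp: same_def bnd_def)
  have k': "?k = Suc (ml u)" using lam_eq uv by auto
  have g0: "lk u (lk v (gen u)) = 0" "lk u (lk v (gen v)) = 0"
  proof -
    have "lk u (lk v (gen u)) = lk v (lk u (gen u))"
      by (auto simp: lk_def fun_eq_iff insert_commute)
    then show "lk u (lk v (gen u)) = 0" using lk_gen uv by simp
  qed (simp add: lk_gen uv)
  \<comment> \<open>Adjacent vertices share no face. Otherwise the faces through both form a cycle
    in the acyclic double link, filled by \<open>h\<close>.\<close>
  have "\<exists>c'. chain V (Suc ?k) c' \<and> bd c' = bd c \<and> lk u (lk v c') = 0"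
  proof (cases "{u, v} \<in> E")
    case True
    then have "u \<notin> V - cnbr E v" by (auto simp: cnbr_def insert_commute)
    then have "lk u (lk v c) = 0" using lk_eq_0 [OF chain_lk [OF c(1)]] by blast
    then show ?thesis using c(1) by blast
  next
    case False
    let ?L = "V - cnbr E v - cnbr E u"
    have g: "chain ?L (ml u) (lk u (lk v c))"
      using chain_lk [of "V - cnbr E v" "ml u"] chain_lk [OF c(1)] k' by simp
    have "bd (lk u (lk v c)) = lk u (lk v (bd c))" by (simp add: lk_bd)
    also have "\<dots> = 0" by (simp add: c(2) [symmetric] g0)
    finally have "cyc ?L (ml u) (lk u (lk v c))" using g by (simp add: cyc_def)
    then obtain h where h: "chain ?L (Suc (ml u)) h" "lk u (lk v c) = bd h"
      using acy_pair_props(2) [OF uv a False] by (auto simp: acy_def bnd_def)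
    have uL: "u \<in> V - cnbr E v" using uv False by (auto simp: cnbr_def insert_commute)
    have VL: "V - cnbr E v \<subseteq> W" using VW by auto
    \<comment> \<open>The boundary of the double cone over \<open>h\<close> has \<open>bd h\<close>
      as its part through both vertices, cancelling that part of \<open>c\<close>.\<close>
    have ju: "chain (V - cnbr E v) (Suc ?k) (jn u h)" using chain_jn [OF h(1) uL VL] k' by simp
    have jv: "chain V (Suc (Suc ?k)) (jn v (jn u h))" using chain_jn [OF ju uv(2) VW] by simp
    have "lk u (lk v (bd (jn v (jn u h)))) = bd (lk u (lk v (jn v (jn u h))))" by (simp add: lk_bd)
    also have "\<dots> = bd h" by (simp add: lk_jn [OF ju] lk_jn [OF h(1)] del: lk_jn_eq_dl)
    finally have "lk u (lk v (c + bd (jn v (jn u h)))) = 0" using h(2) by simp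
    moreover have "chain V (Suc ?k) (c + bd (jn v (jn u h)))"
      using c(1) chain_bd [OF jv VW] by auto
    ultimately show ?thesis by (intro exI [of _ "c + bd (jn v (jn u h))"]) simp
  qed
  then obtain d where d: "chain V (Suc ?k) d" "bd d = gen u + gen v" "lk u (lk v d) = 0"
    using c by auto
  define d1 d2 where "d1 = dl u d" and "d2 = jn u (lk u d)"
  have d12: "d = d1 + d2" by (simp add: d1_def d2_def dl_jn_lk)
  have c1: "chain (V - {u}) (Suc ?k) d1" unfolding d1_def by (rule chain_dl [OF d(1)])
  have "chain V (Suc ?k) d2" using d(1) d12 c1 chain_mono [OF c1, of V]
    by (metis Diff_subset chain_add chain_add_self_left)
  moreover have "d2 \<sigma> = 0" if "v \<in> \<sigma>" for \<sigma>
  proof (cases "u \<in> \<sigma>")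
    case True
    have "insert v (insert u (\<sigma> - {u} - {v})) = \<sigma>" using True that by auto
    then have "lk u (lk v d) (\<sigma> - {u} - {v}) = d \<sigma>" using uv(3) by (simp add: lk_def)
    then have "d \<sigma> = 0" using d(3) by simp
    then show ?thesis using True by (simp add: d2_def jn_def lk_def insert_absorb)
  qed (simp add: d2_def jn_def)
  ultimately have c2: "chain (V - {v}) (Suc ?k) d2"
    unfolding chain_def by (metis indep_Diff_singleton)
  let ?e = "gen u + bd d1"
  have e: "?e = gen v + bd d2"
    using d(2) chain_add_eq_iff [of "gen u" "bd d1" "gen v + bd d2"]
    by (simp add: d12) (metis add.assoc add.commute chain_add_self_left)
  have "chain (V - {u}) ?k ?e"
    using gen [OF uv(1)] chain_bd [OF c1] VW by (auto simp: nbc_def cyc_def)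
  moreover have "chain (V - {v}) ?k ?e"
    unfolding e using gen [OF uv(2)] chain_bd [OF c2] VW k by (auto simp: nbc_def cyc_def)
  ultimately have "chain (V - {u} - {v}) ?k ?e"
    unfolding chain_def indep_Diff_singleton by blast
  moreover have "bd ?e = 0" using gen [OF uv(1)] by (simp add: nbc_def cyc_def)
  ultimately have "bnd (V - {u} - {v}) ?k ?e" using a by (auto simp: acy_def cyc_def)
  then have "bnd (V - {u}) ?k ?e" by (rule bnd_mono) auto
  moreover have "bnd (V - {u}) ?k (bd d1)" using c1 by (auto simp: bnd_def)
  ultimately show False using gen [OF uv(1)] bnd_add_iff by (auto simp: nbc_def)
qed

text \<open>A vertex \<open>v0\<close> and an acyclic pair of its neighbours represent three
  classes, and the colour records the class. Every vertex meets both other classes in an acyclic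
  pair of its own neighbours.\<close>

lemma three_colouring:
  assumes "V \<noteq> {}"
  shows "\<exists>col :: 'a \<Rightarrow> nat. (\<forall>u\<in>V. col u < 3) \<and>
    (\<forall>u\<in>V. \<forall>v\<in>V. {u, v} \<in> E \<longrightarrow> col u \<noteq> col v) \<and>
    (\<forall>v\<in>V. \<exists>u\<in>V. {v, u} \<in> E \<and> col u = Suc (col v) mod 3)"
proof -
  obtain v0 where v0: "v0 \<in> V" using assms by auto
  obtain w1 w2 where w: "w1 \<in> V" "w2 \<in> V" "{v0, w1} \<in> E" "{v0, w2} \<in> E" "w1 \<noteq> w2"
    "acy (V - {w1} - {w2})" using ex_acy_pair_in_nbr [OF v0] by blast
  have adj: "\<not> same u v" if "u \<in> V" "v \<in> V" "{u, v} \<in> E" for u v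
  proof -
    have "u \<noteq> v" using that no_loop by auto
    then show ?thesis using not_same_of_acy_pair edge_props(1) that by blast
  qed
  have ns: "\<not> same v0 w1" "\<not> same v0 w2" "\<not> same w1 w2"
    using adj v0 w not_same_of_acy_pair by auto
  define col :: "'a \<Rightarrow> nat" where
    "col u = (if same u v0 then 0 else if same u w1 then 1 else 2)" for u
  have c2: "same u w2" if "u \<in> V" "\<not> same u v0" "\<not> same u w1" for u
    using same_pigeonhole [of v0 w1 u w2] that v0 w ns same_sym by metis
  have sc: "same u v" if h: "u \<in> V" "v \<in> V" "col u = col v" for u v
  proof -
    consider "same u v0" "same v v0" | "same u w1" "same v w1" | "same u w2" "same v w2"
      using h c2 by (auto simp: col_def split: if_splits)
    then show ?thesis
      by cases (use same_trans same_sym h v0 w in blast)+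
  qed
  have cs: "col u \<noteq> col v" if "u \<in> V" "v \<in> V" "\<not> same u v" for u v
    using sc that by blast
  have "\<exists>u\<in>V. {v, u} \<in> E \<and> col u = Suc (col v) mod 3" if v: "v \<in> V" for v
  proof -
    obtain x y where x: "x \<in> V" "y \<in> V" "{v, x} \<in> E" "{v, y} \<in> E" "x \<noteq> y"
      "acy (V - {x} - {y})" using ex_acy_pair_in_nbr [OF v] by blast
    have "col v \<noteq> col x" "col v \<noteq> col y" "col x \<noteq> col y"
      using cs adj x v not_same_of_acy_pair by auto
    moreover have "col v < 3" "col x < 3" "col y < 3" by (simp_all add: col_def)
    ultimately have "col x = Suc (col v) mod 3 \<or> col y = Suc (col v) mod 3"
      using mod3_distinct3 by blast
    then show ?thesis using x by blast
  qed
  moreover have "\<forall>u\<in>V. col u < 3" by (simp add: col_def)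
  ultimately show ?thesis using cs adj by blast
qed

end

section \<open>Shortest directed cycles in a three-coloured graph\<close>

lemma relpow_of_path:
  assumes "\<And>i. i < n \<Longrightarrow> (c i, c (Suc i)) \<in> R" "i \<le> j" "j \<le> n"
  shows "(c i, c j) \<in> R ^^ (j - i)"
  using assms(2,3)
proof (induction rule: dec_induct)
  case (step k)
  then have "(c i, c k) \<in> R ^^ (k - i)" "(c k, c (Suc k)) \<in> R" using assms(1) by auto
  then show ?case using step by (auto simp: Suc_diff_le)
qed simp

text \<open>Orient every edge from colour \<open>i\<close> to colour \<open>i + 1\<close>. A chord of a directed
  cycle is oriented, so it cuts off a shorter directed cycle.\<close>

lemma induced_cycle_of_colouring:
  fixes E :: "'a set set" and col :: "'a \<Rightarrow> nat"
  assumes "finite V" "V \<noteq> {}" and E2: "\<And>e. e \<in> E \<Longrightarrow> card e = 2"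
    and c3: "\<And>u. u \<in> V \<Longrightarrow> col u < 3"
    and proper: "\<And>u v. u \<in> V \<Longrightarrow> v \<in> V \<Longrightarrow> {u, v} \<in> E \<Longrightarrow> col u \<noteq> col v"
    and succ: "\<And>v. v \<in> V \<Longrightarrow> \<exists>u\<in>V. {v, u} \<in> E \<and> col u = Suc (col v) mod 3"
  shows "\<exists>X n. X \<subseteq> V \<and> 3 dvd n \<and> cycle_of_length n (X, {e \<in> E. e \<subseteq> X})"
proof -
  define R where "R = {(u, v). u \<in> V \<and> v \<in> V \<and> {u, v} \<in> E \<and> col v = Suc (col u) mod 3}"
  obtain v0 where v0: "v0 \<in> V" using assms(2) by blast
  have "\<exists>u. (v, u) \<in> R" if "v \<in> V" for v using succ [OF that] that by (auto simp: R_def)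
  then obtain s where s: "\<And>v. v \<in> V \<Longrightarrow> (v, s v) \<in> R" by metis
  have RV: "v \<in> V" if "(u, v) \<in> R" for u v using that by (auto simp: R_def)
  define f where "f i = (s ^^ i) v0" for i
  have fV: "f i \<in> V" for i by (induction i) (use v0 s RV in \<open>auto simp: f_def\<close>)
  have fR: "(f i, f (Suc i)) \<in> R" for i using s [OF fV [of i]] by (simp add: f_def)
  have "\<not> inj f" using fV assms(1) by (metis finite_imageD finite_subset image_subsetI infinite_UNIV_nat)
  then obtain i j where ij: "i < j" "f i = f j" by (metis injI linorder_neqE_nat)
  \<comment> \<open>Closed walks suffice here: minimal length will force their vertices to be
    distinct.\<close>
  let ?P = "\<lambda>n. 0 < n \<and> (\<exists>x. (x, x) \<in> R ^^ n)"
  have "?P (j - i)" using relpow_of_path [of j f R i j] fR ij by auto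
  define n where "n = (LEAST n. ?P n)"
  have n: "?P n" unfolding n_def by (rule LeastI [of ?P, OF \<open>?P (j - i)\<close>])
  have least: "n \<le> m" if "0 < m" "(x, x) \<in> R ^^ m" for m x
    unfolding n_def using that by (intro Least_le) auto
  obtain x c where c: "c 0 = x" "c n = x" "\<And>i. i < n \<Longrightarrow> (c i, c (Suc i)) \<in> R"
    using n relpow_fun_conv [of _ _ n R] by metis
  have cV: "c i \<in> V" if "i < n" for i using c(3) [OF that] by (auto simp: R_def)
  have path: "(c i, c j) \<in> R ^^ (j - i)" if "i \<le> j" "j \<le> n" for i j
    using relpow_of_path [of n c R i j] c(3) that by blast
  have wrap: "(c j, c i) \<in> R ^^ (n - j + i)" if "i \<le> j" "j \<le> n" for i j
    unfolding relpow_add using path [of j n] path [of 0 i] that c(1,2) by auto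
  have col: "col (c i) = (col (c 0) + i) mod 3" if "i \<le> n" for i
    using that
  proof (induction i)
    case 0
    then show ?case using c3 cV n by simp
  next
    case (Suc i)
    then have "col (c (Suc i)) = Suc (col (c i)) mod 3" using c(3) [of i] by (auto simp: R_def)
    then show ?case using Suc by (simp add: mod_Suc_eq)
  qed
  \<comment> \<open>The colour rises by one at each step and is back after \<open>n\<close>
    steps.\<close>
  have "(col (c 0) + n) mod 3 = (col (c 0) + 0) mod 3" using col [of n] col [of 0] c by simp
  then have n3: "3 dvd n" by presburger
  then have n3': "3 \<le> n" using n by (auto dest: dvd_imp_le)
  have inj: "inj_on c {..<n}"
  proof (rule linorder_inj_onI')
    fix i j assume "i \<in> {..<n}" "j \<in> {..<n}" "i < j"
    then show "c i \<noteq> c j" using path [of i j] least [of "j - i" "c i"] by auto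
  qed
  have chord: "j = Suc i \<or> i = 0 \<and> Suc j = n"
    if ij: "i < j" "j < n" "{c i, c j} \<in> E" for i j
  proof -
    have V: "c i \<in> V" "c j \<in> V" using cV ij by auto
    have "col (c i) < 3" "col (c j) < 3" "col (c i) \<noteq> col (c j)" using V c3 proper ij(3) by blast+
    then have "col (c j) = Suc (col (c i)) mod 3 \<or> col (c i) = Suc (col (c j)) mod 3"
      by (rule mod3_distinct2)
    then show ?thesis
    proof
      assume "col (c j) = Suc (col (c i)) mod 3"
      then have "(c i, c j) \<in> R" using V ij by (simp add: R_def)
      \<comment> \<open>A forward chord replaces the stretch from \<open>c i\<close> to
        \<open>c j\<close>; a backward chord, in the other case, closes that stretch up.\<close>
      then have "(c i, c i) \<in> R ^^ Suc (n - j + i)"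
        using wrap [of i j] ij by (meson less_imp_le relpow_Suc_I2)
      then have "n \<le> Suc (n - j + i)" by (rule least [rotated]) simp
      then show ?thesis using ij by linarith
    next
      assume "col (c i) = Suc (col (c j)) mod 3"
      then have "(c j, c i) \<in> R" using V ij by (simp add: R_def insert_commute)
      then have "(c i, c i) \<in> R ^^ Suc (j - i)"
        using path [of i j] ij by (meson less_imp_le relpow_Suc_I)
      then have "n \<le> Suc (j - i)" by (rule least [rotated]) simp
      then show ?thesis using ij by linarith
    qed
  qed
  let ?X = "c ` {..<n}"
  have edge: "{c i, c (Suc i mod n)} \<in> E" if "i < n" for i
  proof (cases "Suc i = n")
    case True then show ?thesis using c(3) [OF that] c(1,2) by (auto simp: R_def)
  next
    case False then show ?thesis using c(3) [OF that] that by (auto simp: R_def)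
  qed
  have "{e \<in> E. e \<subseteq> ?X} = {{c i, c (Suc i mod n)} | i. i < n}"
  proof (intro equalityI subsetI)
    fix e assume e: "e \<in> {e \<in> E. e \<subseteq> ?X}"
    then obtain u v where uv: "e = {u, v}" "u \<noteq> v" using E2 [of e] by (auto simp: card_2_iff)
    then obtain i j where ij: "i < n" "j < n" "u = c i" "v = c j" "i \<noteq> j" using e by auto
    have *: "\<exists>k<n. {c i, c j} = {c k, c (Suc k mod n)}"
      if "i < j" "j < n" "{c i, c j} \<in> E" for i j
      using chord [OF that]
    proof
      assume "j = Suc i" then show ?thesis using that by (intro exI [of _ i]) auto
    next
      assume "i = 0 \<and> Suc j = n" then show ?thesis using that by (intro exI [of _ j]) auto
    qed
    show "e \<in> {{c i, c (Suc i mod n)} | i. i < n}"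
      using * [of i j] * [of j i] ij uv e by (cases "i < j") (auto simp: insert_commute)
  next
    fix e assume "e \<in> {{c i, c (Suc i mod n)} | i. i < n}"
    then show "e \<in> {e \<in> E. e \<subseteq> ?X}" using edge n3' by auto
  qed
  then have "cycle_of_length n (?X, {e \<in> E. e \<subseteq> ?X})"
    unfolding cycle_of_length_def using inj n3' by (auto simp: bij_betw_def intro!: exI [of _ c])
  moreover have "?X \<subseteq> V" using cV by auto
  ultimately show ?thesis using n3 by blast
qed

section \<open>Mapping cones\<close>

abbreviation I01 :: "real topology" where "I01 \<equiv> top_of_set {0..1}"

lemma continuous_map_case_prod_compose:
  assumes "continuous_map (prod_topology A B) Z (\<lambda>(s, y). g s y)"
    and "continuous_map X A f" "continuous_map X B h"
  shows "continuous_map X Z (\<lambda>x. g (f x) (h x))"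
  using continuous_map_compose [OF _ assms(1), of X "\<lambda>x. (f x, h x)"] assms(2,3)
  by (simp add: continuous_map_pairwise o_def)

lemma continuous_map_into_I01:
  assumes "continuous_map X euclideanreal f" "\<And>x. x \<in> topspace X \<Longrightarrow> 0 \<le> f x \<and> f x \<le> 1"
  shows "continuous_map X I01 f"
  using assms by (auto intro!: continuous_map_into_subtopology)

lemma continuous_map_I01_real: "continuous_map X I01 f \<Longrightarrow> continuous_map X euclideanreal f"
  using continuous_map_into_fulltopology by blast

lemma homotopic_with_True_iff:
  "homotopic_with (\<lambda>x. True) X Y p q \<longleftrightarrow>
    (\<exists>h. continuous_map (prod_topology I01 X) Y (\<lambda>(s, x). h s x) \<and>
      (\<forall>x\<in>topspace X. h 0 x = p x) \<and> (\<forall>x\<in>topspace X. h 1 x = q x))"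
  (is "_ \<longleftrightarrow> ?R")
proof
  assume "homotopic_with (\<lambda>x. True) X Y p q"
  then obtain h where "continuous_map (prod_topology I01 X) Y h"
    "\<forall>x. h (0, x) = p x" "\<forall>x. h (1, x) = q x" by (auto simp: homotopic_with_def)
  then show ?R by (intro exI [of _ "\<lambda>s x. h (s, x)"]) auto
next
  assume ?R
  then obtain h where "continuous_map (prod_topology I01 X) Y (\<lambda>(s, x). h s x)"
    "\<forall>x\<in>topspace X. h 0 x = p x" "\<forall>x\<in>topspace X. h 1 x = q x" by blast
  then show "homotopic_with (\<lambda>x. True) X Y p q"
    by (subst homotopic_with) (auto intro!: exI [of _ "\<lambda>(s, x). h s x"])
qed

lemma closedin_image_of_preimage:
  assumes "compact_space A" "Hausdorff_space X" "continuous_map A X p"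
    and "continuous_map A Z (\<lambda>a. f (p a))" "closedin Z T"
  shows "closedin X (p ` {a \<in> topspace A. f (p a) \<in> T})"
proof -
  have "closedin A {a \<in> topspace A. f (p a) \<in> T}"
    using closedin_continuous_map_preimage [OF assms(4,5)] by simp
  then have "compactin A {a \<in> topspace A. f (p a) \<in> T}"
    using assms(1) by (rule closedin_compact_space [rotated])
  then show ?thesis
    using assms(2,3) by (meson compactin_imp_closedin image_compactin)
qed

text \<open>Images of compact spaces in a Hausdorff space are closed, so the preimage of a closed
  set is a union of three closed pieces.\<close>

lemma continuous_map_compact_cover:
  assumes "Hausdorff_space X" "compact_space A" "compact_space B" "compact_space C"
    and "continuous_map A X p" "continuous_map B X q" "continuous_map C X r"
    and "continuous_map A Z (\<lambda>a. f (p a))" "continuous_map B Z (\<lambda>b. f (q b))"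
      "continuous_map C Z (\<lambda>c. f (r c))"
    and cover: "topspace X \<subseteq> p ` topspace A \<union> q ` topspace B \<union> r ` topspace C"
  shows "continuous_map X Z f"
  unfolding continuous_map_closedin
proof (intro conjI allI impI)
  show "f \<in> topspace X \<rightarrow> topspace Z"
    using cover assms(8-10) by (auto simp: continuous_map_def Pi_iff)
  fix T assume T: "closedin Z T"
  let ?P = "p ` {a \<in> topspace A. f (p a) \<in> T}" and ?Q = "q ` {b \<in> topspace B. f (q b) \<in> T}"
    and ?R = "r ` {c \<in> topspace C. f (r c) \<in> T}"
  have "{x \<in> topspace X. f x \<in> T} = ?P \<union> ?Q \<union> ?R"
    using cover assms(5-7) by (auto simp: continuous_map_def Pi_iff)
  moreover have "closedin X (?P \<union> ?Q \<union> ?R)"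
    by (intro closedin_Un closedin_image_of_preimage [OF _ assms(1)]) (use assms T in auto)
  ultimately show "closedin X {x \<in> topspace X. f x \<in> T}" by simp
qed

text \<open>\<open>X\<close> is the mapping cone of \<open>\<phi>\<close>, with apex \<open>a\<close>, presented by its structure maps.\<close>

locale mapping_cone =
  fixes X :: "'x topology" and D :: "'d topology" and L :: "'l topology"
    and \<phi> :: "'l \<Rightarrow> 'd" and \<iota> :: "'d \<Rightarrow> 'x" and \<pi> :: "real \<Rightarrow> 'l \<Rightarrow> 'x" and a :: 'x
  assumes Hausdorff: "Hausdorff_space X" and compact_D: "compact_space D" and compact_L: "compact_space L"
    and cont_\<iota>: "continuous_map D X \<iota>" and cont_\<phi>: "continuous_map L D \<phi>"
    and cont_\<pi>: "continuous_map (prod_topology I01 L) X (\<lambda>(t, y). \<pi> t y)"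
    and \<pi>_0: "\<And>y. y \<in> topspace L \<Longrightarrow> \<pi> 0 y = \<iota> (\<phi> y)"
    and \<pi>_1: "\<And>y. y \<in> topspace L \<Longrightarrow> \<pi> 1 y = a"
    and apex: "a \<in> topspace X" "a \<notin> \<iota> ` topspace D"
    and inj_\<iota>: "inj_on \<iota> (topspace D)"
    and cover: "\<And>x. x \<in> topspace X \<Longrightarrow>
      x \<in> \<iota> ` topspace D \<or> x = a \<or> (\<exists>t y. 0 < t \<and> t < 1 \<and> y \<in> topspace L \<and> x = \<pi> t y)"
    and \<pi>_notin: "\<And>t y. 0 < t \<Longrightarrow> t < 1 \<Longrightarrow> y \<in> topspace L \<Longrightarrow> \<pi> t y \<notin> \<iota> ` topspace D \<and> \<pi> t y \<noteq> a"
    and \<pi>_inj: "\<And>t y t' y'. 0 < t \<Longrightarrow> t < 1 \<Longrightarrow> y \<in> topspace L \<Longrightarrow> 0 < t' \<Longrightarrow> t' < 1 \<Longrightarrow>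
      y' \<in> topspace L \<Longrightarrow> \<pi> t y = \<pi> t' y' \<Longrightarrow> t = t' \<and> y = y'"
begin

text \<open>The universal property holds for homotopies at once, since the interval times each
  compact piece is compact. The apex has a track \<open>w\<close> of its own because
  \<open>L\<close> may be empty.\<close>

lemma map_out_homotopy:
  assumes f: "continuous_map (prod_topology I01 D) Z (\<lambda>(s, d). f s d)"
    and g: "continuous_map (prod_topology I01 (prod_topology I01 L)) Z (\<lambda>(s, t, y). g s t y)"
    and w: "continuous_map I01 Z w"
    and g0: "\<And>s y. 0 \<le> s \<Longrightarrow> s \<le> 1 \<Longrightarrow> y \<in> topspace L \<Longrightarrow> g s 0 y = f s (\<phi> y)"
    and g1: "\<And>s y. 0 \<le> s \<Longrightarrow> s \<le> 1 \<Longrightarrow> y \<in> topspace L \<Longrightarrow> g s 1 y = w s"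
  shows "\<exists>\<Phi>. continuous_map (prod_topology I01 X) Z (\<lambda>(s, x). \<Phi> s x) \<and>
    (\<forall>s d. 0 \<le> s \<longrightarrow> s \<le> 1 \<longrightarrow> d \<in> topspace D \<longrightarrow> \<Phi> s (\<iota> d) = f s d) \<and>
    (\<forall>s t y. 0 \<le> s \<longrightarrow> s \<le> 1 \<longrightarrow> 0 \<le> t \<longrightarrow> t \<le> 1 \<longrightarrow> y \<in> topspace L \<longrightarrow> \<Phi> s (\<pi> t y) = g s t y) \<and>
    (\<forall>s. 0 \<le> s \<longrightarrow> s \<le> 1 \<longrightarrow> \<Phi> s a = w s)"
proof -
  define P where "P x p \<longleftrightarrow> 0 < fst p \<and> fst p < 1 \<and> snd p \<in> topspace L \<and> x = \<pi> (fst p) (snd p)" for x p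
  define \<Phi> where "\<Phi> s x = (if x \<in> \<iota> ` topspace D then f s (inv_into (topspace D) \<iota> x)
    else if x = a then w s else g s (fst (SOME p. P x p)) (snd (SOME p. P x p)))" for s x
  have 1: "\<Phi> s (\<iota> d) = f s d" if "d \<in> topspace D" for s d
    using that inj_\<iota> by (simp add: \<Phi>_def)
  have 2: "\<Phi> s a = w s" for s using apex by (simp add: \<Phi>_def)
  have 3: "\<Phi> s (\<pi> t y) = g s t y"
    if st: "0 \<le> s" "s \<le> 1" "0 \<le> t" "t \<le> 1" and y: "y \<in> topspace L" for s t y
  proof -
    consider "t = 0" | "t = 1" | "0 < t" "t < 1" using st by linarith
    then show ?thesis
    proof cases
      case 1
      have "\<phi> y \<in> topspace D" using cont_\<phi> y by (auto simp: continuous_map_def)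
      then show ?thesis using 1 \<pi>_0 [OF y] g0 st y \<open>\<And>s d. d \<in> topspace D \<Longrightarrow> \<Phi> s (\<iota> d) = f s d\<close> by simp
    next
      case 2
      then show ?thesis using \<pi>_1 [OF y] g1 st y \<open>\<And>s. \<Phi> s a = w s\<close> by simp
    next
      case 3
      have "P (\<pi> t y) (SOME p. P (\<pi> t y) p)"
        using 3 y by (intro someI [of "P (\<pi> t y)" "(t, y)"]) (simp add: P_def)
      then have "t = fst (SOME p. P (\<pi> t y) p) \<and> y = snd (SOME p. P (\<pi> t y) p)"
        unfolding P_def by (intro \<pi>_inj) (use 3 y in auto)
      then show ?thesis using \<pi>_notin [OF 3 y] unfolding \<Phi>_def by auto
    qed
  qed
  have "continuous_map (prod_topology I01 X) Z (\<lambda>(s, x). \<Phi> s x)"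
  proof (rule continuous_map_compact_cover
      [of _ "prod_topology I01 D" "prod_topology I01 (prod_topology I01 L)" I01
        "\<lambda>(s, d). (s, \<iota> d)" "\<lambda>(s, t, y). (s, \<pi> t y)" "\<lambda>s. (s, a)"])
    show "Hausdorff_space (prod_topology I01 X)"
      using Hausdorff by (simp add: Hausdorff_space_prod_topology Hausdorff_space_subtopology)
    show "compact_space (prod_topology I01 D)" "compact_space (prod_topology I01 (prod_topology I01 L))"
      "compact_space I01"
      using compact_D compact_L by (simp_all add: compact_space_prod_topology compact_space_subtopology)
    show "continuous_map (prod_topology I01 D) (prod_topology I01 X) (\<lambda>(s, d). (s, \<iota> d))"
      using continuous_map_compose [OF continuous_map_snd cont_\<iota>, of I01]
      by (auto simp: continuous_map_pairwise o_def case_prod_unfold continuous_map_fst)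
    have "continuous_map (prod_topology I01 (prod_topology I01 L)) X (\<lambda>p. \<pi> (fst (snd p)) (snd (snd p)))"
      using continuous_map_compose [OF continuous_map_snd cont_\<pi>, of I01]
      by (simp add: o_def case_prod_unfold)
    then show "continuous_map (prod_topology I01 (prod_topology I01 L)) (prod_topology I01 X) (\<lambda>(s, t, y). (s, \<pi> t y))"
      by (auto simp: continuous_map_pairwise o_def case_prod_unfold continuous_map_fst)
    show "continuous_map I01 (prod_topology I01 X) (\<lambda>s. (s, a))"
      using apex by (simp add: continuous_map_pairwise o_def)
    show "continuous_map (prod_topology I01 D) Z (\<lambda>p. case case p of (s, d) \<Rightarrow> (s, \<iota> d) of (s, x) \<Rightarrow> \<Phi> s x)"
      by (rule continuous_map_eq [OF f]) (auto simp: 1)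
    show "continuous_map (prod_topology I01 (prod_topology I01 L)) Z
        (\<lambda>p. case case p of (s, t, y) \<Rightarrow> (s, \<pi> t y) of (s, x) \<Rightarrow> \<Phi> s x)"
      by (rule continuous_map_eq [OF g]) (auto simp: 3)
    show "continuous_map I01 Z (\<lambda>s. case (s, a) of (s, x) \<Rightarrow> \<Phi> s x)"
      using w by (simp add: 2)
    show "topspace (prod_topology I01 X) \<subseteq> (\<lambda>(s, d). (s, \<iota> d)) ` topspace (prod_topology I01 D) \<union>
      (\<lambda>(s, t, y). (s, \<pi> t y)) ` topspace (prod_topology I01 (prod_topology I01 L)) \<union> (\<lambda>s. (s, a)) ` topspace I01"
    proof (clarsimp, goal_cases)
      case (1 s x)
      from cover [OF 1(3)] show ?case
      proof (elim disjE exE conjE)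
        assume "x \<in> \<iota> ` topspace D"
        then show ?thesis using 1 by (auto simp: image_iff)
      next
        assume "x = a" then show ?thesis using 1 by (auto simp: image_iff)
      next
        fix t y assume "0 < t" "t < 1" "y \<in> topspace L" "x = \<pi> t y"
        then have "(s, x) \<in> (\<lambda>(s, t, y). (s, \<pi> t y)) ` ({0..1} \<times> {0..1} \<times> topspace L)"
          using 1 by (intro image_eqI [of _ _ "(s, t, y)"]) auto
        then show ?thesis using 1 by auto
      qed
    qed
  qed
  then show ?thesis using 1 2 3 by blast
qed

lemma map_out:
  assumes f: "continuous_map D Z f"
    and g: "continuous_map (prod_topology I01 L) Z (\<lambda>(t, y). g t y)"
    and w: "w \<in> topspace Z"
    and g0: "\<And>y. y \<in> topspace L \<Longrightarrow> g 0 y = f (\<phi> y)"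
    and g1: "\<And>y. y \<in> topspace L \<Longrightarrow> g 1 y = w"
  shows "\<exists>F. continuous_map X Z F \<and> (\<forall>d. d \<in> topspace D \<longrightarrow> F (\<iota> d) = f d) \<and>
    (\<forall>t y. 0 \<le> t \<longrightarrow> t \<le> 1 \<longrightarrow> y \<in> topspace L \<longrightarrow> F (\<pi> t y) = g t y) \<and> F a = w"
proof -
  have "continuous_map (prod_topology I01 D) Z (\<lambda>(s, d). f d)"
    using continuous_map_compose [OF continuous_map_snd f, of I01] by (simp add: o_def case_prod_unfold)
  moreover have "continuous_map (prod_topology I01 (prod_topology I01 L)) Z (\<lambda>(s, t, y). g t y)"
    using continuous_map_compose [OF continuous_map_snd g, of I01] by (simp add: o_def case_prod_unfold)
  moreover have "continuous_map I01 Z (\<lambda>s. w)" using w by simp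
  ultimately obtain \<Phi> where \<Phi>: "continuous_map (prod_topology I01 X) Z (\<lambda>(s, x). \<Phi> s x)"
    "\<And>s d. 0 \<le> s \<Longrightarrow> s \<le> 1 \<Longrightarrow> d \<in> topspace D \<Longrightarrow> \<Phi> s (\<iota> d) = f d"
    "\<And>s t y. 0 \<le> s \<Longrightarrow> s \<le> 1 \<Longrightarrow> 0 \<le> t \<Longrightarrow> t \<le> 1 \<Longrightarrow> y \<in> topspace L \<Longrightarrow> \<Phi> s (\<pi> t y) = g t y"
    "\<And>s. 0 \<le> s \<Longrightarrow> s \<le> 1 \<Longrightarrow> \<Phi> s a = w"
    using map_out_homotopy [of Z "\<lambda>s d. f d" "\<lambda>s t y. g t y" "\<lambda>s. w"] g0 g1 by blast
  have "continuous_map X Z (\<Phi> 0)"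
    using continuous_map_case_prod_compose [OF \<Phi>(1), of X "\<lambda>x. 0" "\<lambda>x. x"] by (simp add: eta_contract_eq)
  then show ?thesis using \<Phi>(2-4) [of 0] by (intro exI [of _ "\<Phi> 0"]) auto
qed

lemma eq_onI:
  assumes "\<And>d. d \<in> topspace D \<Longrightarrow> F (\<iota> d) = G (\<iota> d)"
    and "\<And>t y. 0 < t \<Longrightarrow> t < 1 \<Longrightarrow> y \<in> topspace L \<Longrightarrow> F (\<pi> t y) = G (\<pi> t y)"
    and "F a = G a" and "x \<in> topspace X"
  shows "F x = G x"
  using cover [OF assms(4)] assms(1-3) by blast

text \<open>A contraction \<open>h\<close> of \<open>L\<close> pushes the cone into \<open>D\<close>: the retraction is
  \<open>\<pi> t y \<mapsto> \<phi> (h t y)\<close>. The homotopy to the identity first moves \<open>y\<close> and then lowers \<open>t\<close>,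
  so that one of the two parameters is always at 1 over the apex.\<close>

theorem homotopy_equivalent_base:
  assumes L: "contractible_space L" "topspace L \<noteq> {}"
  shows "X homotopy_equivalent_space D"
proof -
  obtain p where p: "homotopic_with (\<lambda>x. True) L L id (\<lambda>x. p)"
    using L(1) by (auto simp: contractible_space_def)
  then have pL: "p \<in> topspace L"
    using L(2) homotopic_with_imp_continuous_maps [OF p] by auto
  obtain h where h: "continuous_map (prod_topology I01 L) L (\<lambda>(s, y). h s y)"
    "\<And>y. y \<in> topspace L \<Longrightarrow> h 0 y = y" "\<And>y. y \<in> topspace L \<Longrightarrow> h 1 y = p"
    using p by (auto simp: homotopic_with_True_iff)
  have hL: "h s y \<in> topspace L" if "0 \<le> s" "s \<le> 1" "y \<in> topspace L" for s y
    using h(1) that unfolding continuous_map_def by (force simp: Pi_iff)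
  have \<phi>D: "\<phi> y \<in> topspace D" if "y \<in> topspace L" for y
    using cont_\<phi> that by (auto simp: continuous_map_def)
  have "continuous_map (prod_topology I01 L) D (\<lambda>(t, y). \<phi> (h t y))"
    using continuous_map_compose [OF h(1) cont_\<phi>] by (simp add: o_def case_prod_unfold)
  then obtain \<rho> where \<rho>: "continuous_map X D \<rho>" "\<And>d. d \<in> topspace D \<Longrightarrow> \<rho> (\<iota> d) = d"
    "\<And>t y. 0 \<le> t \<Longrightarrow> t \<le> 1 \<Longrightarrow> y \<in> topspace L \<Longrightarrow> \<rho> (\<pi> t y) = \<phi> (h t y)" "\<rho> a = \<phi> p"
    using map_out [of D "\<lambda>d. d" "\<lambda>t y. \<phi> (h t y)" "\<phi> p"] h \<phi>D pL by force
  let ?u = "\<lambda>s. min 1 (2 - 2 * s)" and ?v = "\<lambda>s. min 1 (2 * s) :: real"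
  let ?J = "prod_topology I01 (prod_topology I01 L)"
  have u: "0 \<le> ?u s" "?u s \<le> 1" "0 \<le> ?v s" "?v s \<le> 1" if "0 \<le> s" "s \<le> 1" for s
    using that by auto
  have s: "continuous_map ?J I01 fst" and t: "continuous_map ?J I01 (\<lambda>p. fst (snd p))"
    and y: "continuous_map ?J L (\<lambda>p. snd (snd p))"
    by (auto intro: continuous_map_fst continuous_map_snd_of continuous_map_fst_of [unfolded o_def]
        continuous_map_compose [OF continuous_map_snd continuous_map_fst, unfolded o_def]
        continuous_map_compose [OF continuous_map_snd continuous_map_snd, unfolded o_def])
  have tu: "continuous_map ?J I01 (\<lambda>p. fst (snd p) * ?u (fst p))"
    and tv: "continuous_map ?J I01 (\<lambda>p. fst (snd p) * ?v (fst p))"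
    using s t u by (auto intro!: continuous_map_into_I01 continuous_intros mult_le_one mult_nonneg_nonneg
        dest: continuous_map_I01_real)
  have "continuous_map ?J L (\<lambda>p. h (fst (snd p) * ?v (fst p)) (snd (snd p)))"
    by (rule continuous_map_case_prod_compose [OF h(1) tv y])
  then have g: "continuous_map ?J X (\<lambda>(s, t, y). \<pi> (t * ?u s) (h (t * ?v s) y))"
    using continuous_map_case_prod_compose [OF cont_\<pi> tu] by (simp add: case_prod_unfold)
  have f: "continuous_map (prod_topology I01 D) X (\<lambda>(s, d). \<iota> d)"
    using continuous_map_compose [OF continuous_map_snd cont_\<iota>, of I01] by (simp add: o_def case_prod_unfold)
  have uI: "continuous_map I01 I01 ?u"
    by (intro continuous_map_into_I01) (auto intro!: continuous_intros continuous_map_from_subtopology)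
  have w: "continuous_map I01 X (\<lambda>s. \<pi> (?u s) p)"
    by (rule continuous_map_case_prod_compose [OF cont_\<pi> uI]) (use pL in auto)
  have "\<pi> (?u s) (h (?v s) y) = \<pi> (?u s) p" if "0 \<le> s" "s \<le> 1" "y \<in> topspace L" for s y
  proof (cases "s \<le> 1/2")
    case True
    then have "?u s = 1" by simp
    then show ?thesis using \<pi>_1 hL u that pL by metis
  next
    case False
    then have "?v s = 1" by simp
    then show ?thesis using h(3) that by simp
  qed
  then obtain \<Phi> where \<Phi>: "continuous_map (prod_topology I01 X) X (\<lambda>(s, x). \<Phi> s x)"
    "\<And>s d. 0 \<le> s \<Longrightarrow> s \<le> 1 \<Longrightarrow> d \<in> topspace D \<Longrightarrow> \<Phi> s (\<iota> d) = \<iota> d"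
    "\<And>s t y. 0 \<le> s \<Longrightarrow> s \<le> 1 \<Longrightarrow> 0 \<le> t \<Longrightarrow> t \<le> 1 \<Longrightarrow> y \<in> topspace L \<Longrightarrow>
      \<Phi> s (\<pi> t y) = \<pi> (t * ?u s) (h (t * ?v s) y)"
    "\<And>s. 0 \<le> s \<Longrightarrow> s \<le> 1 \<Longrightarrow> \<Phi> s a = \<pi> (?u s) p"
    using map_out_homotopy [OF f g w] \<pi>_0 h(2) by force
  have "homotopic_with (\<lambda>x. True) X X id (\<iota> \<circ> \<rho>)"
    unfolding homotopic_with_True_iff
  proof (intro exI [of _ \<Phi>] conjI ballI)
    fix x assume x: "x \<in> topspace X"
    show "\<Phi> 0 x = id x"
      by (rule eq_onI [OF _ _ _ x]) (use \<Phi>(2-4) [of 0] h(2) \<pi>_1 pL in auto)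
    show "\<Phi> 1 x = (\<iota> \<circ> \<rho>) x"
      by (rule eq_onI [OF _ _ _ x]) (use \<Phi>(2-4) [of 1] \<rho> \<pi>_0 hL pL in auto)
  qed (rule \<Phi>(1))
  then have "homotopic_with (\<lambda>x. True) X X (\<iota> \<circ> \<rho>) id" by (rule homotopic_with_sym [THEN iffD1])
  moreover have "homotopic_with (\<lambda>x. True) D D (\<rho> \<circ> \<iota>) id"
    by (rule homotopic_with_equal)
      (use \<rho> cont_\<iota> in \<open>auto intro: continuous_map_compose\<close>)
  ultimately show ?thesis
    unfolding homotopy_equivalent_space_def using \<rho>(1) cont_\<iota> by blast
qed

end

context mapping_cone
begin

text \<open>If \<open>D\<close> contracts to \<open>p\<close>, extend the cone coordinate to \<open>[-1, 1]\<close>: \<open>e \<alpha> y\<close> is \<open>\<pi> \<alpha> y\<close>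
  for \<open>\<alpha> \<ge> 0\<close> and runs along the contraction of \<open>\<phi> y\<close> for \<open>\<alpha> \<le> 0\<close>. Stretching \<open>[0, 1]\<close> linearly
  to \<open>[-1, 1]\<close> deforms the identity of \<open>X\<close> into a map that is constant on \<open>D\<close>.\<close>

theorem homotopy_equivalent_suspension:
  assumes S: "mapping_cone S P M \<psi> j \<omega> b" and P: "topspace P = {q}"
    and D: "contractible_space D" "topspace D \<noteq> {}"
    and LM: "L homotopy_equivalent_space M"
  shows "X homotopy_equivalent_space S"
proof -
  interpret S: mapping_cone S P M \<psi> j \<omega> b by (rule S)
  obtain p where p: "homotopic_with (\<lambda>x. True) D D id (\<lambda>x. p)"
    using D(1) by (auto simp: contractible_space_def)
  have pD: "p \<in> topspace D"
    using D(2) homotopic_with_imp_continuous_maps [OF p] by auto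
  obtain c where c: "continuous_map (prod_topology I01 D) D (\<lambda>(s, d). c s d)"
    "\<And>d. d \<in> topspace D \<Longrightarrow> c 0 d = d" "\<And>d. d \<in> topspace D \<Longrightarrow> c 1 d = p"
    using p by (auto simp: homotopic_with_True_iff)
  obtain f g where f: "continuous_map L M f" and g: "continuous_map M L g"
    and gf: "homotopic_with (\<lambda>x. True) L L (g \<circ> f) id" and fg: "homotopic_with (\<lambda>x. True) M M (f \<circ> g) id"
    using LM by (auto simp: homotopy_equivalent_space_def)
  obtain k where k: "continuous_map (prod_topology I01 L) L (\<lambda>(s, y). k s y)"
    "\<And>y. y \<in> topspace L \<Longrightarrow> k 0 y = g (f y)" "\<And>y. y \<in> topspace L \<Longrightarrow> k 1 y = y"
    using gf by (auto simp: homotopic_with_True_iff)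
  obtain k' where k': "continuous_map (prod_topology I01 M) M (\<lambda>(s, y). k' s y)"
    "\<And>y. y \<in> topspace M \<Longrightarrow> k' 0 y = f (g y)" "\<And>y. y \<in> topspace M \<Longrightarrow> k' 1 y = y"
    using fg by (auto simp: homotopic_with_True_iff)
  have \<phi>D: "\<phi> y \<in> topspace D" if "y \<in> topspace L" for y
    using cont_\<phi> that by (auto simp: continuous_map_def)
  have \<psi>P: "\<psi> m = q" if "m \<in> topspace M" for m
    using S.cont_\<phi> that P by (auto simp: continuous_map_def)
  have fM: "f y \<in> topspace M" if "y \<in> topspace L" for y using f that by (auto simp: continuous_map_def)
  have gL: "g m \<in> topspace L" if "m \<in> topspace M" for m using g that by (auto simp: continuous_map_def)
  have kL: "k s y \<in> topspace L" if "0 \<le> s" "s \<le> 1" "y \<in> topspace L" for s y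
    using k(1) that unfolding continuous_map_def by (force simp: Pi_iff)
  have k'M: "k' s y \<in> topspace M" if "0 \<le> s" "s \<le> 1" "y \<in> topspace M" for s y
    using k'(1) that unfolding continuous_map_def by (force simp: Pi_iff)
  let ?J = "top_of_set {-1..1::real}"
  \<comment> \<open>The clamps \<open>max 0\<close> make both branches continuous on all of [-1, 1],
    so that they can be pasted along 0.\<close>
  define e where "e \<alpha> y = (if \<alpha> \<le> 0 then \<iota> (c (max 0 (- \<alpha>)) (\<phi> y)) else \<pi> (max 0 \<alpha>) y)" for \<alpha> y
  have e_neg: "e \<alpha> y = \<iota> (c (- \<alpha>) (\<phi> y))" if "\<alpha> \<le> 0" for \<alpha> y
    using that by (simp add: e_def)
  have e_pos: "e \<alpha> y = \<pi> \<alpha> y" if "0 \<le> \<alpha>" "y \<in> topspace L" for \<alpha> y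
    using that c(2) \<phi>D \<pi>_0 by (cases "\<alpha> = 0") (auto simp: e_def)
  have fstJ: "continuous_map (prod_topology ?J L) euclideanreal fst"
    by (metis continuous_map_fst continuous_map_into_fulltopology)
  have e: "continuous_map (prod_topology ?J L) X (\<lambda>(\<alpha>, y). e \<alpha> y)"
  proof -
    have "continuous_map (prod_topology ?J L) D (\<lambda>x. c (max 0 (- fst x)) (\<phi> (snd x)))"
      using continuous_map_compose [OF continuous_map_snd cont_\<phi>, of ?J] fstJ
      by (intro continuous_map_case_prod_compose [OF c(1)] continuous_map_into_I01 continuous_intros)
        (auto simp: o_def)
    then have "continuous_map (prod_topology ?J L) X (\<lambda>x. \<iota> (c (max 0 (- fst x)) (\<phi> (snd x))))"
      using continuous_map_compose [OF _ cont_\<iota>] by (simp add: o_def)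
    moreover have "continuous_map (prod_topology ?J L) X (\<lambda>x. \<pi> (max 0 (fst x)) (snd x))"
      using fstJ
      by (intro continuous_map_case_prod_compose [OF cont_\<pi>] continuous_map_into_I01 continuous_intros continuous_map_snd)
        auto
    ultimately have "continuous_map (prod_topology ?J L) X
        (\<lambda>x. if fst x \<le> 0 then \<iota> (c (max 0 (- fst x)) (\<phi> (snd x))) else \<pi> (max 0 (fst x)) (snd x))"
      using fstJ c(2) \<phi>D \<pi>_0
      by (intro continuous_map_cases_le continuous_map_from_subtopology) auto
    then show ?thesis by (simp add: e_def case_prod_unfold)
  qed
  have comp_e: "continuous_map Y X (\<lambda>x. e (u x) (v x))"
    if "continuous_map Y euclideanreal u" "\<And>x. x \<in> topspace Y \<Longrightarrow> -1 \<le> u x \<and> u x \<le> 1" "continuous_map Y L v"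
    for Y :: "'z topology" and u v
    using that by (intro continuous_map_case_prod_compose [OF e])
      (auto intro!: continuous_map_into_subtopology)
  let ?K = "prod_topology I01 (prod_topology I01 L)" and ?K' = "prod_topology I01 (prod_topology I01 M)"
  have proj: "continuous_map (prod_topology I01 (prod_topology I01 Y)) euclideanreal fst"
    "continuous_map (prod_topology I01 (prod_topology I01 Y)) I01 fst"
    "continuous_map (prod_topology I01 (prod_topology I01 Y)) euclideanreal (\<lambda>p. fst (snd p))"
    "continuous_map (prod_topology I01 (prod_topology I01 Y)) Y (\<lambda>p. snd (snd p))"
    "continuous_map (prod_topology I01 Y) euclideanreal fst"
    "continuous_map (prod_topology I01 Y) I01 fst"
    "continuous_map (prod_topology I01 Y) Y snd"
    for Y :: "'z topology"
    by (auto intro: continuous_map_fst continuous_map_snd continuous_map_I01_real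
        continuous_map_compose [OF continuous_map_snd continuous_map_fst, unfolded o_def]
        continuous_map_compose [OF continuous_map_snd continuous_map_snd, unfolded o_def])
  have "continuous_map (prod_topology I01 L) S (\<lambda>(t, y). \<omega> t (f y))"
    unfolding case_prod_unfold
    by (intro continuous_map_case_prod_compose [OF S.cont_\<pi>] proj continuous_map_compose [OF proj(7) f, unfolded o_def])
  \<comment> \<open>\<open>F\<close> collapses \<open>D\<close> to the base point. \<open>G\<close>,
    constructed next, follows the stretched cone coordinate, whose lower half runs inside
    \<open>D\<close>.\<close>
  then obtain F where F: "continuous_map X S F" "\<And>d. d \<in> topspace D \<Longrightarrow> F (\<iota> d) = j q"
    "\<And>t y. 0 \<le> t \<Longrightarrow> t \<le> 1 \<Longrightarrow> y \<in> topspace L \<Longrightarrow> F (\<pi> t y) = \<omega> t (f y)" "F a = b"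
    using map_out [of S "\<lambda>d. j q" "\<lambda>t y. \<omega> t (f y)" b] S.apex S.\<pi>_0 S.\<pi>_1 fM \<psi>P P S.cont_\<iota>
    by (force simp: continuous_map_def)
  have "continuous_map (prod_topology I01 M) X (\<lambda>(t, m). e (2 * t - 1) (g m))"
    unfolding case_prod_unfold
    by (intro comp_e continuous_intros proj continuous_map_compose [OF proj(7) g, unfolded o_def]) auto
  moreover have "\<iota> p \<in> topspace X" using cont_\<iota> pD by (auto simp: continuous_map_def)
  ultimately obtain G where G: "continuous_map S X G" "G (j q) = \<iota> p"
    "\<And>t m. 0 \<le> t \<Longrightarrow> t \<le> 1 \<Longrightarrow> m \<in> topspace M \<Longrightarrow> G (\<omega> t m) = e (2 * t - 1) (g m)" "G b = a"
    using S.map_out [of X "\<lambda>d. \<iota> p" "\<lambda>t m. e (2 * t - 1) (g m)" a] apex P e_neg e_pos gL \<phi>D \<pi>_1 c(3)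
    by auto
  have Fe: "F (e \<alpha> y) = \<omega> (max 0 \<alpha>) (f y)" if "-1 \<le> \<alpha>" "\<alpha> \<le> 1" "y \<in> topspace L" for \<alpha> y
  proof (cases "\<alpha> \<le> 0")
    case True
    have "c (- \<alpha>) (\<phi> y) \<in> topspace D"
      using c(1) that True \<phi>D unfolding continuous_map_def by (force simp: Pi_iff)
    then show ?thesis using True that F(2) S.\<pi>_0 fM \<psi>P by (simp add: e_neg max_def)
  qed (use that F(3) e_pos in \<open>auto simp: max_def\<close>)
  have "homotopic_with (\<lambda>x. True) S S (F \<circ> G) id"
  proof -
    have t: "0 \<le> (1 - s) * max 0 (2 * t - 1) + s * t \<and> (1 - s) * max 0 (2 * t - 1) + s * t \<le> 1"
      if "0 \<le> s" "s \<le> 1" "0 \<le> t" "t \<le> 1" for s t :: real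
      using that by (intro conjI add_nonneg_nonneg mult_nonneg_nonneg convex_bound_le) auto
    have "continuous_map ?K' S (\<lambda>(s, t, m). \<omega> ((1 - s) * max 0 (2 * t - 1) + s * t) (k' s m))"
      unfolding case_prod_unfold
      by (intro continuous_map_case_prod_compose [OF S.cont_\<pi>] continuous_map_case_prod_compose [OF k'(1)]
        continuous_map_into_I01 continuous_intros proj t) auto
    moreover have "continuous_map (prod_topology I01 P) S (\<lambda>(s, d). j d)"
      using continuous_map_compose [OF continuous_map_snd S.cont_\<iota>, of I01] by (simp add: o_def case_prod_unfold)
    moreover have "continuous_map I01 S (\<lambda>s. b)" using S.apex by simp
    ultimately obtain \<Psi> where \<Psi>: "continuous_map (prod_topology I01 S) S (\<lambda>(s, x). \<Psi> s x)"
      "\<And>s d. 0 \<le> s \<Longrightarrow> s \<le> 1 \<Longrightarrow> d \<in> topspace P \<Longrightarrow> \<Psi> s (j d) = j d"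
      "\<And>s t m. 0 \<le> s \<Longrightarrow> s \<le> 1 \<Longrightarrow> 0 \<le> t \<Longrightarrow> t \<le> 1 \<Longrightarrow> m \<in> topspace M \<Longrightarrow>
        \<Psi> s (\<omega> t m) = \<omega> ((1 - s) * max 0 (2 * t - 1) + s * t) (k' s m)"
      "\<And>s. 0 \<le> s \<Longrightarrow> s \<le> 1 \<Longrightarrow> \<Psi> s b = b"
      using S.map_out_homotopy [of S "\<lambda>s d. j d"
          "\<lambda>s t m. \<omega> ((1 - s) * max 0 (2 * t - 1) + s * t) (k' s m)" "\<lambda>s. b"] S.\<pi>_0 S.\<pi>_1 k'M \<psi>P
      by force
    show ?thesis
      unfolding homotopic_with_True_iff
    proof (intro exI [of _ \<Psi>] conjI ballI)
      fix x assume x: "x \<in> topspace S"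
      show "\<Psi> 0 x = (F \<circ> G) x"
        by (rule S.eq_onI [OF _ _ _ x]) (use \<Psi>(2-4) [of 0] G F Fe k'(2) P pD gL in auto)
      show "\<Psi> 1 x = id x"
        by (rule S.eq_onI [OF _ _ _ x]) (use \<Psi>(2-4) [of 1] k'(3) in auto)
    qed (rule \<Psi>(1))
  qed
  moreover have "homotopic_with (\<lambda>x. True) X X (G \<circ> F) id"
  proof -
    \<comment> \<open>First stage of the homotopy: \<open>g (f y)\<close> moves to \<open>y\<close>
      under the full stretch, while \<open>D\<close> stays at \<open>p\<close>.\<close>
    have ends: "e (2 * 0 - 1) (k s y) = \<iota> p" "e (2 * 1 - 1) (k s y) = a"
      if "0 \<le> s" "s \<le> 1" "y \<in> topspace L" for s y
      using kL [OF that] e_neg e_pos \<phi>D \<pi>_1 c(3) by auto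
    have "continuous_map (prod_topology I01 D) X (\<lambda>(s, d). \<iota> p)"
      using cont_\<iota> pD by (auto simp: case_prod_unfold continuous_map_def)
    moreover have "continuous_map ?K X (\<lambda>(s, t, y). e (2 * t - 1) (k s y))"
      unfolding case_prod_unfold
      by (intro comp_e continuous_map_case_prod_compose [OF k(1)] continuous_intros proj) auto
    moreover have "continuous_map I01 X (\<lambda>s. a)" using apex by simp
    ultimately obtain \<Phi> where \<Phi>: "continuous_map (prod_topology I01 X) X (\<lambda>(s, x). \<Phi> s x)"
      "\<And>s d. 0 \<le> s \<Longrightarrow> s \<le> 1 \<Longrightarrow> d \<in> topspace D \<Longrightarrow> \<Phi> s (\<iota> d) = \<iota> p"
      "\<And>s t y. 0 \<le> s \<Longrightarrow> s \<le> 1 \<Longrightarrow> 0 \<le> t \<Longrightarrow> t \<le> 1 \<Longrightarrow> y \<in> topspace L \<Longrightarrow>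
        \<Phi> s (\<pi> t y) = e (2 * t - 1) (k s y)"
      "\<And>s. 0 \<le> s \<Longrightarrow> s \<le> 1 \<Longrightarrow> \<Phi> s a = a"
      using map_out_homotopy [of X "\<lambda>s d. \<iota> p" "\<lambda>s t y. e (2 * t - 1) (k s y)" "\<lambda>s. a"]
        ends by blast
    \<comment> \<open>Second stage: the range of the cone coordinate shrinks from [-1, 1] to [0, 1],
      with lower end \<open>- (1 - s)\<close>, and \<open>D\<close> runs its contraction
      backwards.\<close>
    have ends': "e (0 * (2 - s) - (1 - s)) y = \<iota> (c (1 - s) (\<phi> y))" "e (1 * (2 - s) - (1 - s)) y = a"
      if "0 \<le> s" "s \<le> 1" "y \<in> topspace L" for s y
      using that e_neg e_pos \<pi>_1 by auto
    have c': "continuous_map (prod_topology I01 D) D (\<lambda>x. c (1 - fst x) (snd x))"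
      by (intro continuous_map_case_prod_compose [OF c(1)] continuous_map_into_I01 continuous_intros proj) auto
    have "continuous_map (prod_topology I01 D) X (\<lambda>(s, d). \<iota> (c (1 - s) d))"
      using continuous_map_compose [OF c' cont_\<iota>] by (simp add: case_prod_unfold o_def)
    moreover have t: "-1 \<le> t * (2 - s) - (1 - s) \<and> t * (2 - s) - (1 - s) \<le> 1"
      if "0 \<le> s" "s \<le> 1" "0 \<le> t" "t \<le> 1" for s t :: real
    proof -
      define u where "u = t * (2 - s)"
      have "0 \<le> u" "u \<le> 2 - s"
        unfolding u_def using that mult_right_mono [of t 1 "2 - s"] by auto
      then show ?thesis unfolding u_def [symmetric] using that by auto
    qed
    have "continuous_map ?K X (\<lambda>(s, t, y). e (t * (2 - s) - (1 - s)) y)"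
      unfolding case_prod_unfold
      by (intro comp_e continuous_intros proj t) auto
    moreover have "continuous_map I01 X (\<lambda>s. a)" using apex by simp
    ultimately obtain \<Theta> where \<Theta>: "continuous_map (prod_topology I01 X) X (\<lambda>(s, x). \<Theta> s x)"
      "\<And>s d. 0 \<le> s \<Longrightarrow> s \<le> 1 \<Longrightarrow> d \<in> topspace D \<Longrightarrow> \<Theta> s (\<iota> d) = \<iota> (c (1 - s) d)"
      "\<And>s t y. 0 \<le> s \<Longrightarrow> s \<le> 1 \<Longrightarrow> 0 \<le> t \<Longrightarrow> t \<le> 1 \<Longrightarrow> y \<in> topspace L \<Longrightarrow>
        \<Theta> s (\<pi> t y) = e (t * (2 - s) - (1 - s)) y"
      "\<And>s. 0 \<le> s \<Longrightarrow> s \<le> 1 \<Longrightarrow> \<Theta> s a = a"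
      using map_out_homotopy [of X "\<lambda>s d. \<iota> (c (1 - s) d)" "\<lambda>s t y. e (t * (2 - s) - (1 - s)) y" "\<lambda>s. a"]
        ends' by blast
    have "homotopic_with (\<lambda>x. True) X X (G \<circ> F) (\<Phi> 1)"
      unfolding homotopic_with_True_iff
    proof (intro exI [of _ \<Phi>] conjI ballI)
      fix x assume x: "x \<in> topspace X"
      show "\<Phi> 0 x = (G \<circ> F) x"
        by (rule eq_onI [OF _ _ _ x]) (use \<Phi>(2-4) [of 0] G F k(2) fM in auto)
    qed (use \<Phi>(1) in auto)
    moreover have "homotopic_with (\<lambda>x. True) X X (\<Phi> 1) id"
      unfolding homotopic_with_True_iff
    proof (intro exI [of _ \<Theta>] conjI ballI)
      fix x assume x: "x \<in> topspace X"
      show "\<Theta> 0 x = \<Phi> 1 x"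
        by (rule eq_onI [OF _ _ _ x]) (use \<Phi>(2-4) [of 1] \<Theta>(2-4) [of 0] k(3) c(3) in \<open>auto simp: mult.commute\<close>)
      show "\<Theta> 1 x = id x"
        by (rule eq_onI [OF _ _ _ x]) (use \<Theta>(2-4) [of 1] c(2) e_pos in auto)
    qed (rule \<Theta>(1))
    ultimately show ?thesis by (rule homotopic_with_trans)
  qed
  ultimately show ?thesis
    unfolding homotopy_equivalent_space_def using F(1) G(1) by blast
qed

end

section \<open>Realizations of independence complexes\<close>

lemma compact_space_powertop_real:
  fixes S :: "('a \<Rightarrow> real) set"
  assumes "closed S" "\<And>x i. x \<in> S \<Longrightarrow> l \<le> x i \<and> x i \<le> u"
  shows "compact_space (subtopology (powertop_real UNIV) S)"
proof -
  have "compactin (powertop_real UNIV) (Pi\<^sub>E UNIV (\<lambda>i::'a. {l..u}))"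
    by (simp add: compactin_PiE)
  moreover have "closedin (powertop_real UNIV) S"
    using assms(1) by (simp add: euclidean_product_topology)
  ultimately have "compactin (powertop_real UNIV) (S \<inter> Pi\<^sub>E UNIV (\<lambda>i. {l..u}))"
    by (intro closed_Int_compactin)
  moreover have "S \<inter> Pi\<^sub>E UNIV (\<lambda>i. {l..u}) = S" using assms(2) by (auto simp: PiE_def Pi_iff)
  ultimately show ?thesis by (simp add: compact_space_subtopology)
qed

lemma Hausdorff_space_powertop_real: "Hausdorff_space (subtopology (powertop_real UNIV) S)"
  by (intro Hausdorff_space_subtopology) (simp add: Hausdorff_space_product_topology)

lemma continuous_map_coordinate:
  "continuous_map (subtopology (powertop_real UNIV) S) euclideanreal (\<lambda>x. x u)"
  by (blast intro: continuous_map_from_subtopology [OF continuous_map_product_projection])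

lemma continuous_map_into_powertop_real:
  assumes "\<And>u. continuous_map Y euclideanreal (\<lambda>p. f p u)" "\<And>p. p \<in> topspace Y \<Longrightarrow> f p \<in> S"
  shows "continuous_map Y (subtopology (powertop_real UNIV) S) f"
  using assms by (auto intro!: continuous_map_into_subtopology simp: continuous_map_componentwise_UNIV)

text \<open>\<open>sphere_top k\<close> is the sphere of dimension \<open>k - 1\<close>; it is empty for \<open>k = 0\<close>.\<close>

definition sphere_set :: "nat \<Rightarrow> (nat \<Rightarrow> real) set" where
  "sphere_set k = {x. (\<Sum>i<k. (x i)\<^sup>2) = 1 \<and> (\<forall>i\<ge>k. x i = 0)}"

definition sphere_top :: "nat \<Rightarrow> (nat \<Rightarrow> real) topology" where
  "sphere_top k = subtopology (powertop_real UNIV) (sphere_set k)"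

lemma topspace_sphere_top [simp]: "topspace (sphere_top k) = sphere_set k"
  by (simp add: sphere_top_def)

lemma sphere_top_0: "topspace (sphere_top 0) = {}"
  by (simp add: sphere_set_def)

lemma sphere_top_Suc: "sphere_top (Suc n) = nsphere n"
  unfolding sphere_top_def nsphere sphere_set_def
  by (simp add: lessThan_Suc_atMost Suc_le_eq)

lemma sphere_set_bound: assumes "x \<in> sphere_set k" shows "- 1 \<le> x i \<and> x i \<le> 1"
proof (cases "i < k")
  case True
  then have "(x i)\<^sup>2 \<le> (\<Sum>i<k. (x i)\<^sup>2)" by (intro member_le_sum) auto
  then have "(x i)\<^sup>2 \<le> 1" using assms by (simp add: sphere_set_def)
  then show ?thesis by (simp add: abs_square_le_1 abs_le_iff)
qed (use assms in \<open>simp add: sphere_set_def\<close>)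

lemma compact_space_sphere_top: "compact_space (sphere_top k)"
  unfolding sphere_top_def
proof (rule compact_space_powertop_real)
  show "closed (sphere_set k)"
    unfolding sphere_set_def
    by (intro closed_Collect_conj closed_Collect_all closed_Collect_imp closed_Collect_eq
        continuous_intros open_Collect_const continuous_on_product_coordinates)
qed (rule sphere_set_bound)

text \<open>The sphere as a suspension, coned from the south pole. Height \<open>2 * t - 1\<close>
  and radius \<open>2 * sqrt (t * (1 - t))\<close> satisfy the equation of the circle. For
  \<open>k = 0\<close> the link is empty and only the two poles remain.\<close>

lemma mapping_cone_sphere_top:
  "mapping_cone (sphere_top (Suc k)) (discrete_topology {()}) (sphere_top k) (\<lambda>_. ())
    (\<lambda>_ i. if i = k then - 1 else 0)
    (\<lambda>t y i. if i = k then 2 * t - 1 else 2 * sqrt (t * (1 - t)) * y i)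
    (\<lambda>i. if i = k then 1 else 0)"
  (is "mapping_cone ?X ?D ?L ?\<phi> ?\<iota> ?\<pi> ?a")
proof
  have \<pi>S: "?\<pi> t y \<in> sphere_set (Suc k)" if "0 \<le> t" "t \<le> 1" "y \<in> sphere_set k" for t y
  proof -
    have "(\<Sum>i<k. (?\<pi> t y i)\<^sup>2) = (\<Sum>i<k. 4 * (t * (1 - t)) * (y i)\<^sup>2)"
      using that by (intro sum.cong) (auto simp: power_mult_distrib)
    also have "\<dots> = 4 * (t * (1 - t))"
      using that by (simp add: sum_distrib_left [symmetric] sphere_set_def)
    finally show ?thesis
      using that by (auto simp: sphere_set_def power2_eq_square algebra_simps)
  qed
  have sq: "(\<Sum>i<k. (if i = k then c else 0)\<^sup>2) = (0::real)" for c
    by (intro sum.neutral) auto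
  show "Hausdorff_space ?X" by (simp add: sphere_top_def Hausdorff_space_powertop_real)
  show "compact_space ?D" by (simp add: compact_space_discrete_topology)
  show "compact_space ?L" by (rule compact_space_sphere_top)
  show "continuous_map ?D ?X ?\<iota>" using sq by (auto simp: sphere_set_def)
  show "continuous_map ?L ?D ?\<phi>" by simp
  have t: "continuous_map (prod_topology I01 ?L) euclideanreal fst"
    by (metis continuous_map_fst continuous_map_I01_real)
  have y: "continuous_map (prod_topology I01 ?L) euclideanreal (\<lambda>p. snd p i)" for i
    using continuous_map_compose [OF continuous_map_snd continuous_map_coordinate, of I01 "sphere_set k" i]
    by (simp add: sphere_top_def o_def)
  have "continuous_map (prod_topology I01 ?L) euclideanreal (\<lambda>p. sqrt (fst p * (1 - fst p)))"
    using continuous_map_compose [of _ euclideanreal "\<lambda>p. fst p * (1 - fst p)" euclideanreal sqrt] t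
    by (auto simp: o_def intro!: continuous_intros)
  then show "continuous_map (prod_topology I01 ?L) ?X (\<lambda>(t, y). ?\<pi> t y)"
    unfolding sphere_top_def case_prod_unfold
  proof (intro continuous_map_into_powertop_real, goal_cases)
    case (1 u)
    then show ?case using t y [of u] unfolding sphere_top_def
      by (cases "u = k") (auto intro!: continuous_intros)
  next
    case (2 p)
    then show ?case using \<pi>S [of "fst p" "snd p"] by (auto simp: sphere_top_def)
  qed
  show "?\<pi> 0 y = ?\<iota> (?\<phi> y)" if "y \<in> topspace ?L" for y by (simp add: fun_eq_iff)
  show "?\<pi> 1 y = ?a" if "y \<in> topspace ?L" for y by (simp add: fun_eq_iff)
  show "?a \<in> topspace ?X" using sq by (auto simp: sphere_set_def)
  show "?a \<notin> ?\<iota> ` topspace ?D" by (auto simp: fun_eq_iff)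
  show "inj_on ?\<iota> (topspace ?D)" by auto
  fix x assume x: "x \<in> topspace ?X"
  define t where "t = (1 + x k) / 2"
  have xk: "- 1 \<le> x k" "x k \<le> 1" using x sphere_set_bound [of x "Suc k" k] by auto
  have sx: "(\<Sum>i<k. (x i)\<^sup>2) = 1 - (x k)\<^sup>2" using x by (simp add: sphere_set_def)
  have x0: "x i = 0" if "i > k" for i using x that by (auto simp: sphere_set_def)
  show "x \<in> ?\<iota> ` topspace ?D \<or> x = ?a \<or> (\<exists>t y. 0 < t \<and> t < 1 \<and> y \<in> topspace ?L \<and> x = ?\<pi> t y)"
  proof (cases "(x k)\<^sup>2 = 1")
    case True
    then have "(\<Sum>i<k. (x i)\<^sup>2) = 0" using sx by simp
    then have "\<forall>i<k. x i = 0" by (subst (asm) sum_nonneg_eq_0_iff) auto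
    then have x0': "x i = 0" if "i \<noteq> k" for i using x0 that by (metis linorder_neqE_nat)
    have "x k = 1 \<or> x k = - 1" using True by (simp add: power2_eq_1_iff)
    then have "x = ?a \<or> x = ?\<iota> ()" using x0' by (auto simp: fun_eq_iff)
    then show ?thesis by auto
  next
    case False
    then have "x k \<noteq> 1" "x k \<noteq> - 1" by auto
    then have t: "0 < t" "t < 1" using xk by (auto simp: t_def)
    define r where "r = 2 * sqrt (t * (1 - t))"
    have r: "r > 0" "r\<^sup>2 = 1 - (x k)\<^sup>2"
      using t by (auto simp: r_def power_mult_distrib) (simp add: t_def power2_eq_square field_simps)
    define y where "y i = (if i < k then x i / r else 0)" for i
    have "(\<Sum>i<k. (y i)\<^sup>2) = (\<Sum>i<k. (x i)\<^sup>2) / r\<^sup>2"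
      by (simp add: y_def power_divide sum_divide_distrib)
    also have "\<dots> = 1" using r sx by auto
    finally have "y \<in> topspace ?L" by (simp add: sphere_set_def y_def)
    moreover have "2 * t - 1 = x k" by (simp add: t_def field_simps)
    then have "x = ?\<pi> t y"
      unfolding r_def [symmetric] using r x0 by (auto simp: fun_eq_iff y_def)
    ultimately show ?thesis using t by blast
  qed
next
  fix t :: real and y assume t: "0 < t" "t < 1"
  have "f \<notin> ?\<iota> ` topspace ?D \<and> f \<noteq> ?a" if "f k \<noteq> - 1" "f k \<noteq> 1" for f :: "nat \<Rightarrow> real"
    using that by auto
  then show "?\<pi> t y \<notin> ?\<iota> ` topspace ?D \<and> ?\<pi> t y \<noteq> ?a" using t by simp
next
  fix t y t' y' assume *: "0 < t" "t < (1::real)" "y \<in> topspace ?L" "0 < t'" "t' < 1" "y' \<in> topspace ?L"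
    and eq: "?\<pi> t y = ?\<pi> t' y'"
  have tt: "t = t'" using fun_cong [OF eq, of k] by simp
  have "y i = y' i" for i
    using fun_cong [OF eq, of i] * tt by (cases "i = k") (auto simp: sphere_set_def)
  then show "t = t' \<and> y = y'" using tt by auto
qed

definition bary :: "'a set set \<Rightarrow> 'a set \<Rightarrow> ('a \<Rightarrow> real) set" where
  "bary E U = {x. (\<forall>v. 0 \<le> x v) \<and> {v. x v \<noteq> 0} \<in> indep E U \<and> (\<Sum>v\<in>{v. x v \<noteq> 0}. x v) = 1}"

abbreviation realization :: "'a set set \<Rightarrow> 'a set \<Rightarrow> ('a \<Rightarrow> real) topology" where
  "realization E U \<equiv> geometric_realization (indep E U)"

lemma realization_eq: "realization E U = subtopology (powertop_real UNIV) (bary E U)"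
  by (simp add: geometric_realization_def bary_def)

lemma topspace_realization [simp]: "topspace (realization E U) = bary E U"
  by (simp add: realization_eq)

lemma bary_iff:
  assumes "finite A" "U \<subseteq> A"
  shows "x \<in> bary E U \<longleftrightarrow> (\<forall>v. 0 \<le> x v) \<and> {v. x v \<noteq> 0} \<in> indep E U \<and> (\<Sum>v\<in>A. x v) = 1"
proof -
  have "(\<Sum>v\<in>{v. x v \<noteq> 0}. x v) = (\<Sum>v\<in>A. x v)" if "{v. x v \<noteq> 0} \<in> indep E U"
    using that assms by (intro sum.mono_neutral_left) (auto simp: indep_def)
  then show ?thesis by (auto simp: bary_def)
qed

lemma bary_outside: "x \<in> bary E U \<Longrightarrow> v \<notin> U \<Longrightarrow> x v = 0"
  by (auto simp: bary_def indep_def)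

lemma bary_bound: assumes "finite U" "x \<in> bary E U" shows "0 \<le> x v \<and> x v \<le> 1"
proof (cases "v \<in> U")
  case True
  have x: "\<forall>v. 0 \<le> x v" "(\<Sum>v\<in>U. x v) = 1" using assms bary_iff [of U U x E] by auto
  then have "x v \<le> (\<Sum>v\<in>U. x v)" using True assms(1) by (intro member_le_sum) auto
  then show ?thesis using x by simp
qed (simp add: bary_outside [OF assms(2)])

lemma compact_space_realization:
  assumes "finite U" shows "compact_space (realization E U)"
  unfolding realization_eq
proof (rule compact_space_powertop_real)
  \<comment> \<open>A condition on the support is not visibly closed; a finite union of closed faces
    is.\<close>
  let ?F = "\<lambda>\<sigma>. {x :: 'a \<Rightarrow> real. (\<forall>v. 0 \<le> x v) \<and> (\<forall>v. v \<notin> \<sigma> \<longrightarrow> x v = 0) \<and> (\<Sum>v\<in>U. x v) = 1}"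
  have "indep E U \<subseteq> Pow U" by (auto simp: indep_def)
  then have "finite (indep E U)" using assms by (simp add: finite_subset)
  then have "closed (\<Union>\<sigma>\<in>indep E U. ?F \<sigma>)"
    by (intro closed_UN ballI closed_Collect_conj closed_Collect_all closed_Collect_imp
        closed_Collect_eq closed_Collect_le open_Collect_const continuous_intros continuous_on_product_coordinates)
  moreover have "(\<Union>\<sigma>\<in>indep E U. ?F \<sigma>) = bary E U"
  proof (intro equalityI subsetI)
    fix x assume "x \<in> (\<Union>\<sigma>\<in>indep E U. ?F \<sigma>)"
    then obtain \<sigma> where \<sigma>: "\<sigma> \<in> indep E U" "x \<in> ?F \<sigma>" by auto
    then have "{v. x v \<noteq> 0} \<in> indep E U" by (intro indep_down [OF \<sigma>(1)]) auto
    then show "x \<in> bary E U" using \<sigma> bary_iff [OF assms order_refl] by auto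
  next
    fix x assume "x \<in> bary E U"
    then show "x \<in> (\<Union>\<sigma>\<in>indep E U. ?F \<sigma>)"
      using bary_iff [OF assms order_refl, of x E] by (intro UN_I [of "{v. x v \<noteq> 0}"]) auto
  qed
  ultimately show "closed (bary E U)" by simp
qed (rule bary_bound [OF assms])

lemma bary_deletion: "bary E (U - {v}) = {x \<in> bary E U. x v = 0}"
  by (auto simp: bary_def indep_Diff_singleton)

lemma bary_cone:
  assumes U: "finite U" "v \<in> U" "{v} \<notin> E" and y: "y \<in> bary E (U - cnbr E v)" and t: "0 \<le> t" "t \<le> 1"
  shows "(\<lambda>u. (1 - t) * y u + (if u = v then t else 0)) \<in> bary E U" (is "?z \<in> _")
proof -
  let ?S = "{u. y u \<noteq> 0}"
  have y': "\<forall>u. 0 \<le> y u" "?S \<in> indep E (U - cnbr E v)" "(\<Sum>u\<in>U. y u) = 1"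
    using y bary_iff [of U "U - cnbr E v" y E] U by auto
  have "v \<notin> ?S" using bary_outside [OF y, of v] by simp
  then have "insert v ?S \<in> indep E U" using insert_in_indep_iff [OF U(3), of ?S U] y'(2) U(2) by simp
  then have "{u. ?z u \<noteq> 0} \<in> indep E U"
    by (rule indep_down) (auto split: if_splits)
  moreover have "(\<Sum>u\<in>U. ?z u) = 1"
    using y' U by (simp add: sum.distrib sum_distrib_left [symmetric])
  moreover have "\<forall>u. 0 \<le> ?z u" using y' t by auto
  ultimately show ?thesis using bary_iff [OF U(1) order_refl] by blast
qed

text \<open>The coordinate at \<open>v\<close> is the cone parameter. If it lies strictly between 0
  and 1, dropping it and rescaling the others gives a point of the link.\<close>

lemma mapping_cone_realization:
  assumes U: "finite U" "v \<in> U" "{v} \<notin> E"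
  shows "mapping_cone (realization E U) (realization E (U - {v})) (realization E (U - cnbr E v))
    (\<lambda>y. y) (\<lambda>y. y) (\<lambda>t y u. (1 - t) * y u + (if u = v then t else 0)) (\<lambda>u. if u = v then 1 else 0)"
  (is "mapping_cone ?X ?D ?L ?\<phi> ?\<iota> ?\<pi> ?a")
proof
  have LD: "bary E (U - cnbr E v) \<subseteq> bary E (U - {v})"
    using indep_mono [of "U - cnbr E v" "U - {v}" E] by (auto simp: bary_def)
  have Lv: "y v = 0" if "y \<in> bary E (U - cnbr E v)" for y
    using that by (rule bary_outside) simp
  show "Hausdorff_space ?X" by (simp add: realization_eq Hausdorff_space_powertop_real)
  show "compact_space ?D" "compact_space ?L" using U by (simp_all add: compact_space_realization)
  show "continuous_map ?D ?X ?\<iota>"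
    unfolding realization_eq
    by (intro continuous_map_into_powertop_real continuous_map_coordinate) (simp add: bary_deletion)
  show "continuous_map ?L ?D ?\<phi>"
    unfolding realization_eq
    by (intro continuous_map_into_powertop_real continuous_map_coordinate) (use LD in auto)
  have t: "continuous_map (prod_topology I01 ?L) euclideanreal fst"
    by (metis continuous_map_fst continuous_map_I01_real)
  have y: "continuous_map (prod_topology I01 ?L) euclideanreal (\<lambda>p. snd p i)" for i
    using continuous_map_compose [OF continuous_map_snd continuous_map_coordinate, of I01 "bary E (U - cnbr E v)" i]
    by (simp add: realization_eq o_def)
  show "continuous_map (prod_topology I01 ?L) ?X (\<lambda>(t, y). ?\<pi> t y)"
    unfolding realization_eq [of E U] case_prod_unfold
  proof (intro continuous_map_into_powertop_real, goal_cases)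
    case (1 u)
    then show ?case using t y [of u] by (cases "u = v") (auto intro!: continuous_intros)
  next
    case (2 p)
    then show ?case using bary_cone [OF U, of "snd p" "fst p"] by auto
  qed
  show "?\<pi> 0 y = ?\<iota> (?\<phi> y)" if "y \<in> topspace ?L" for y by (simp add: fun_eq_iff)
  show "?\<pi> 1 y = ?a" if "y \<in> topspace ?L" for y by (simp add: fun_eq_iff)
  have sv: "{u. (if u = v then (1::real) else 0) \<noteq> 0} = {v}" by auto
  have "{v} \<in> indep E U" using U by (auto simp: indep_def)
  then show "?a \<in> topspace ?X" by (simp add: bary_def sv)
  show "?a \<notin> ?\<iota> ` topspace ?D" by (auto simp: bary_deletion)
  show "inj_on ?\<iota> (topspace ?D)" by auto
  fix x assume "x \<in> topspace ?X"
  then have xb: "x \<in> bary E U" by simp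
  then have x: "\<forall>u. 0 \<le> x u" "{u. x u \<noteq> 0} \<in> indep E U" "(\<Sum>u\<in>U. x u) = 1"
    using bary_iff [OF U(1) order_refl] by auto
  have xv: "0 \<le> x v" "x v \<le> 1" using bary_bound [OF U(1) xb] by auto
  have sx: "(\<Sum>u\<in>U - {v}. x u) = 1 - x v" using x(3) U by (simp add: sum_diff1)
  show "x \<in> ?\<iota> ` topspace ?D \<or> x = ?a \<or> (\<exists>t y. 0 < t \<and> t < 1 \<and> y \<in> topspace ?L \<and> x = ?\<pi> t y)"
  proof -
    consider "x v = 0" | "x v = 1" | "0 < x v" "x v < 1" using xv by linarith
    then show ?thesis
    proof cases
      case 1 then show ?thesis using xb by (simp add: bary_deletion)
    next
      case 2
      then have "(\<Sum>u\<in>U - {v}. x u) = 0" using sx by simp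
      then have "\<forall>u\<in>U - {v}. x u = 0" using x(1) U(1) by (subst (asm) sum_nonneg_eq_0_iff) auto
      then have "x = ?a" using 2 bary_outside [OF xb] by (auto simp: fun_eq_iff)
      then show ?thesis by simp
    next
      case 3
      define y where "y u = (if u = v then 0 else x u / (1 - x v))" for u
      have "insert v {u. y u \<noteq> 0} = {u. x u \<noteq> 0}" using 3 by (auto simp: y_def)
      then have "{u. y u \<noteq> 0} \<in> indep E (U - cnbr E v)"
        using insert_in_indep_iff [OF U(3), of "{u. y u \<noteq> 0}" U] x(2) by (auto simp: y_def)
      moreover have "(\<Sum>u\<in>U. y u) = 1"
      proof -
        have "(\<Sum>u\<in>U. y u) = (\<Sum>u\<in>U - {v}. x u / (1 - x v))"
          using U by (intro sum.mono_neutral_cong_right) (auto simp: y_def)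
        also have "\<dots> = 1" using sx 3 by (simp add: sum_divide_distrib [symmetric])
        finally show ?thesis .
      qed
      moreover have "\<forall>u. 0 \<le> y u" using x(1) 3 by (simp add: y_def)
      ultimately have "y \<in> topspace ?L" using bary_iff [of U "U - cnbr E v" y E] U by auto
      moreover have "x = ?\<pi> (x v) y" using 3 by (auto simp: fun_eq_iff y_def)
      ultimately show ?thesis using 3 by blast
    qed
  qed
next
  fix t :: real and y assume t: "0 < t" "t < 1" "y \<in> topspace ?L"
  then have "?\<pi> t y v = t" using bary_outside [of y E "U - cnbr E v" v] by simp
  moreover have "f \<notin> ?\<iota> ` topspace ?D \<and> f \<noteq> ?a" if "f v \<noteq> 0" "f v \<noteq> 1" for f
    using that by (auto simp: bary_deletion)
  ultimately show "?\<pi> t y \<notin> ?\<iota> ` topspace ?D \<and> ?\<pi> t y \<noteq> ?a" using t by simp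
next
  fix t y t' y' assume *: "0 < t" "t < (1::real)" "y \<in> topspace ?L" "0 < t'" "t' < 1" "y' \<in> topspace ?L"
    and eq: "?\<pi> t y = ?\<pi> t' y'"
  have v: "y v = 0" "y' v = 0" using * bary_outside [of _ E "U - cnbr E v" v] by auto
  have tt: "t = t'" using fun_cong [OF eq, of v] v by simp
  have "y i = y' i" for i
    using fun_cong [OF eq, of i] * tt by auto
  then show "t = t' \<and> y = y'" using tt by auto
qed

text \<open>Any face may be enlarged by \<open>v\<close>, so segments to that vertex stay in the
  realization.\<close>

lemma contractible_realization_isolated:
  assumes U: "finite U" "v \<in> U" "{v} \<notin> E" and iso: "\<And>u. u \<in> U \<Longrightarrow> {v, u} \<notin> E"
  shows "contractible_space (realization E U)" "bary E U \<noteq> {}"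
proof -
  let ?a = "\<lambda>u. if u = v then 1 else 0 :: real"
  let ?h = "\<lambda>t x u. (1 - t) * x u + t * ?a u"
  have av: "?a \<in> bary E U"
    using mapping_cone.apex(1) [OF mapping_cone_realization [OF U]] by simp
  have h: "?h t x \<in> bary E U" if x: "x \<in> bary E U" and t: "0 \<le> t" "t \<le> 1" for t x
  proof -
    have x': "\<forall>u. 0 \<le> x u" "{u. x u \<noteq> 0} \<in> indep E U" "(\<Sum>u\<in>U. x u) = 1"
      using x bary_iff [OF U(1) order_refl] by auto
    have "insert v {u. x u \<noteq> 0} \<in> indep E U"
      using x'(2) iso U by (auto simp: indep_def insert_commute)
    then have "{u. ?h t x u \<noteq> 0} \<in> indep E U"
      by (rule indep_down) (auto split: if_splits)
    moreover have "(\<Sum>u\<in>U. ?h t x u) = 1"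
      using x' U by (simp add: sum.distrib sum_distrib_left [symmetric])
    moreover have "\<forall>u. 0 \<le> ?h t x u" using x' t by auto
    ultimately show ?thesis using bary_iff [OF U(1) order_refl] by blast
  qed
  let ?P = "prod_topology I01 (realization E U)"
  have t: "continuous_map ?P euclideanreal fst"
    by (metis continuous_map_fst continuous_map_I01_real)
  have y: "continuous_map ?P euclideanreal (\<lambda>p. snd p i)" for i
    using continuous_map_compose [OF continuous_map_snd continuous_map_coordinate, of I01 "bary E U" i]
    by (simp add: realization_eq o_def)
  have "continuous_map ?P (subtopology (powertop_real UNIV) (bary E U)) (\<lambda>(t, x). ?h t x)"
    unfolding case_prod_unfold
    by (intro continuous_map_into_powertop_real continuous_intros t y) (use h in auto)
  then have "continuous_map ?P (realization E U) (\<lambda>(t, x). ?h t x)"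
    by (simp only: realization_eq)
  then have "homotopic_with (\<lambda>x. True) (realization E U) (realization E U) id (\<lambda>x. ?a)"
    unfolding homotopic_with_True_iff by (intro exI [of _ ?h]) (auto simp: fun_eq_iff)
  then show "contractible_space (realization E U)" by (auto simp: contractible_space_def)
  show "bary E U \<noteq> {}" using av by auto
qed

section \<open>Homotopy types by induction over induced subgraphs\<close>

context stable_complex
begin

text \<open>Homotopy type and mod 2 homology are carried together with matching degrees, so
  acyclicity of a smaller complex can be read as contractibility without a comparison theorem.
  Nonemptiness is explicit because the empty space satisfies
  \<open>contractible_space\<close>.\<close>

definition homotopy_tame :: "'a set \<Rightarrow> bool" where
  "homotopy_tame U \<longleftrightarrow> contractible_space (realization E U) \<and> bary E U \<noteq> {} \<and> acy U \<or>
    (\<exists>k. realization E U homotopy_equivalent_space sphere_top k \<and> sph U k)"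

lemma homotopy_tame_acy:
  "homotopy_tame U \<Longrightarrow> acy U \<Longrightarrow> contractible_space (realization E U) \<and> bary E U \<noteq> {}"
  using sph_not_acy by (auto simp: homotopy_tame_def)

lemma homotopy_tame_empty: "homotopy_tame {}"
proof -
  have "bary E {} = {}" by (auto simp: bary_def indep_def)
  then have "topspace (realization E {}) = {}" "topspace (sphere_top 0) = {}"
    by (simp_all only: topspace_realization sphere_top_0)
  then have "realization E {} homeomorphic_space sphere_top 0"
    unfolding homeomorphic_space_def homeomorphic_maps_def continuous_map_def by auto
  then show ?thesis
    using sph_empty homeomorphic_imp_homotopy_equivalent_space by (auto simp: homotopy_tame_def)
qed

lemma homotopy_tame_acy_link:
  assumes U: "U \<subseteq> W" "v \<in> U" and L: "homotopy_tame (U - cnbr E v)" "acy (U - cnbr E v)"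
    and D: "homotopy_tame (U - {v})"
  shows "homotopy_tame U"
proof -
  have fU: "finite U" using U fin finite_subset by blast
  interpret mapping_cone "realization E U" "realization E (U - {v})" "realization E (U - cnbr E v)"
    "\<lambda>y. y" "\<lambda>y. y" "\<lambda>t y u. (1 - t) * y u + (if u = v then t else 0)" "\<lambda>u. if u = v then 1 else 0"
    using mapping_cone_realization [OF fU U(2) no_loop] .
  have eq: "realization E U homotopy_equivalent_space realization E (U - {v})"
    using homotopy_tame_acy [OF L] by (intro homotopy_equivalent_base) auto
  have ne: "bary E U \<noteq> {}" using apex(1) by auto
  from D show ?thesis
    unfolding homotopy_tame_def
  proof (elim disjE exE conjE)
    assume "contractible_space (realization E (U - {v}))" "acy (U - {v})"
    then show "contractible_space (realization E U) \<and> bary E U \<noteq> {} \<and> acy U \<or>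
      (\<exists>k. realization E U homotopy_equivalent_space sphere_top k \<and> sph U k)"
      using homotopy_equivalent_space_contractibility [OF eq] acy_of_acy_link [OF U L(2)] ne by auto
  next
    fix k assume "realization E (U - {v}) homotopy_equivalent_space sphere_top k" "sph (U - {v}) k"
    then show "contractible_space (realization E U) \<and> bary E U \<noteq> {} \<and> acy U \<or>
      (\<exists>k. realization E U homotopy_equivalent_space sphere_top k \<and> sph U k)"
      using homotopy_eqv_trans [OF eq] sph_of_acy_link [OF U L(2)] by auto
  qed
qed

lemma homotopy_tame_acy_deletion:
  assumes U: "U \<subseteq> W" "v \<in> U" and L: "homotopy_tame (U - cnbr E v)" "\<not> acy (U - cnbr E v)"
    and D: "homotopy_tame (U - {v})" "acy (U - {v})"
  shows "homotopy_tame U"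
proof -
  have fU: "finite U" using U fin finite_subset by blast
  interpret mapping_cone "realization E U" "realization E (U - {v})" "realization E (U - cnbr E v)"
    "\<lambda>y. y" "\<lambda>y. y" "\<lambda>t y u. (1 - t) * y u + (if u = v then t else 0)" "\<lambda>u. if u = v then 1 else 0"
    using mapping_cone_realization [OF fU U(2) no_loop] .
  obtain k where k: "realization E (U - cnbr E v) homotopy_equivalent_space sphere_top k"
    "sph (U - cnbr E v) k"
    using L by (auto simp: homotopy_tame_def)
  have "realization E U homotopy_equivalent_space sphere_top (Suc k)"
    using homotopy_tame_acy [OF D]
    by (intro homotopy_equivalent_suspension [OF mapping_cone_sphere_top _ _ _ k(1)]) auto
  then show ?thesis using sph_of_acy_deletion [OF U D(2) k(2)] by (auto simp: homotopy_tame_def)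
qed

theorem homotopy_tame_of_no_cycle:
  assumes E2: "\<And>e. e \<in> E \<Longrightarrow> card e = 2"
    and no_cycle: "\<And>X n. X \<subseteq> W \<Longrightarrow> cycle_of_length n (X, {e \<in> E. e \<subseteq> X}) \<Longrightarrow> \<not> 3 dvd n"
    and U: "U \<subseteq> W"
  shows "homotopy_tame U"
proof -
  have "finite U" using U fin finite_subset by blast
  then show ?thesis using U
  proof (induction U rule: finite_psubset_induct)
    case (psubset U)
    have IH: "homotopy_tame A" if "A \<subset> U" for A
      using psubset.IH [OF that] that psubset.prems by auto
    show ?case
    proof (cases "U = {}")
      case True then show ?thesis using homotopy_tame_empty by simp
    next
      case ne: False
      have tame: "homotopy_tame (U - {v})" "homotopy_tame (U - cnbr E v)" if "v \<in> U" for v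
        using that self_mem_cnbr [of v E] by (intro IH; blast)+
      show ?thesis
      proof (cases "\<exists>v\<in>U. \<forall>u\<in>U. {v, u} \<notin> E")
        case True
        then obtain v where v: "v \<in> U" "\<And>u. u \<in> U \<Longrightarrow> {v, u} \<notin> E" by blast
        then show ?thesis
          using contractible_realization_isolated [OF psubset.hyps v(1) no_loop v(2)]
            acy_isolated [OF psubset.prems v] by (auto simp: homotopy_tame_def)
      next
        case nbr: False
        show ?thesis
        proof (cases "\<exists>v\<in>U. acy (U - cnbr E v)")
          case True
          then show ?thesis using homotopy_tame_acy_link psubset.prems tame by blast
        next
          case nL: False
          show ?thesis
          proof (cases "\<exists>v\<in>U. acy (U - {v})")
            case True
            then show ?thesis using homotopy_tame_acy_deletion psubset.prems tame nL by blast
          next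
            case nD: False
            \<comment> \<open>What remains is a minimal counterexample, and its colouring produces a
              forbidden cycle.\<close>
            have "critical_graph W E U"
            proof
              show "rank1 A" if "A \<subset> U" for A
                using IH [OF that] acy_rank1 sph_rank1 by (auto simp: homotopy_tame_def)
              show "\<exists>u\<in>U. {v, u} \<in> E" if "v \<in> U" for v using nbr that by blast
              show "\<not> acy (U - {v})" "\<not> acy (U - cnbr E v)" if "v \<in> U" for v using nL nD that by blast+
            qed (rule psubset.prems)
            then interpret critical_graph W E U .
            from three_colouring [OF ne] obtain col :: "'a \<Rightarrow> nat" where col: "\<forall>u\<in>U. col u < 3"
              "\<forall>u\<in>U. \<forall>v\<in>U. {u, v} \<in> E \<longrightarrow> col u \<noteq> col v"
              "\<forall>v\<in>U. \<exists>u\<in>U. {v, u} \<in> E \<and> col u = Suc (col v) mod 3"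
              by (elim exE conjE)
            have "\<exists>X n. X \<subseteq> U \<and> 3 dvd n \<and> cycle_of_length n (X, {e \<in> E. e \<subseteq> X})"
            proof (rule induced_cycle_of_colouring [OF psubset.hyps ne E2, where col = col])
              show "\<exists>u\<in>U. {v, u} \<in> E \<and> col u = Suc (col v) mod 3" if "v \<in> U" for v
                using col(3) that by (rule bspec)
            qed (use col(1,2) in simp_all)
            then show ?thesis using no_cycle psubset.prems by blast
          qed
        qed
      qed
    qed
  qed
qed

end

section \<open>Cycles of length divisible by 3\<close>

definition normed :: "nat \<Rightarrow> (nat \<Rightarrow> real) \<Rightarrow> nat \<Rightarrow> real" where
  "normed m z = (\<lambda>i. if i < m then z i / sqrt (\<Sum>l<m. (z l)\<^sup>2) else 0)"

lemma sum_squares_pos: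
  fixes z :: "nat \<Rightarrow> real"
  assumes "l < m" "z l \<noteq> 0"
  shows "0 < (\<Sum>l<m. (z l)\<^sup>2)"
  using assms by (intro sum_pos2 [of _ l]) auto

lemma normed_in_sphere_set:
  assumes "l < m" "z l \<noteq> 0"
  shows "normed m z \<in> sphere_set m"
proof -
  have "(\<Sum>i<m. (normed m z i)\<^sup>2) = (\<Sum>i<m. (z i)\<^sup>2 / (\<Sum>l<m. (z l)\<^sup>2))"
    by (intro sum.cong) (auto simp: normed_def power_divide sum_nonneg)
  also have "\<dots> = 1"
    using sum_squares_pos [of l m z, OF assms] by (simp add: sum_divide_distrib [symmetric])
  finally show ?thesis by (simp add: sphere_set_def normed_def)
qed

lemma continuous_map_normed:
  assumes "\<And>l. l < m \<Longrightarrow> continuous_map Y euclideanreal (\<lambda>p. f p l)"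
    and "\<And>p. p \<in> topspace Y \<Longrightarrow> \<exists>l<m. f p l \<noteq> 0"
  shows "continuous_map Y (sphere_top m) (\<lambda>p. normed m (f p))"
  unfolding sphere_top_def
proof (rule continuous_map_into_powertop_real)
  fix u
  have "continuous_map Y euclideanreal (\<lambda>p. \<Sum>l<m. (f p l)\<^sup>2)"
    by (intro continuous_map_sum continuous_map_real_pow assms(1)) auto
  then have "continuous_map Y euclideanreal (\<lambda>p. sqrt (\<Sum>l<m. (f p l)\<^sup>2))"
    using continuous_map_compose [of Y euclideanreal _ euclideanreal sqrt]
    by (auto simp: o_def intro!: continuous_intros)
  moreover have "sqrt (\<Sum>l<m. (f p l)\<^sup>2) \<noteq> 0" if "p \<in> topspace Y" for p
    using assms(2) [OF that] sum_squares_pos by fastforce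
  ultimately show "continuous_map Y euclideanreal (\<lambda>p. normed m (f p) u)"
    using assms(1) by (cases "u < m") (auto simp: normed_def intro!: continuous_map_real_divide)
next
  fix p assume "p \<in> topspace Y"
  then show "normed m (f p) \<in> sphere_set m" using assms(2) normed_in_sphere_set by blast
qed

lemma sphere_set_nonzero: "y \<in> sphere_set m \<Longrightarrow> \<exists>l<m. y l \<noteq> 0"
  unfolding sphere_set_def by (metis (mono_tags, lifting) lessThan_iff mem_Collect_eq sum.neutral zero_neq_one zero_power2)

lemma continuous_map_sphere_top_coordinate:
  "continuous_map (sphere_top m) euclideanreal (\<lambda>y. y i)"
  unfolding sphere_top_def by (rule continuous_map_coordinate)

text \<open>The segment from a nonzero vector with nonnegative coordinates to the first basis vector
  misses the origin, so it can be normalised onto the sphere.\<close>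

lemma null_of_nonneg:
  assumes g: "continuous_map (sphere_top m) (sphere_top m) g" and m: "0 < m"
    and nn: "\<And>y i. y \<in> sphere_set m \<Longrightarrow> 0 \<le> g y i"
  shows "\<exists>a. homotopic_with (\<lambda>x. True) (sphere_top m) (sphere_top m) g (\<lambda>x. a)"
proof -
  let ?e = "\<lambda>i::nat. if i = 0 then 1 else 0 :: real"
  let ?h = "\<lambda>s y. normed m (\<lambda>i. (1 - s) * g y i + s * ?e i)"
  let ?P = "prod_topology I01 (sphere_top m)"
  have gS: "g y \<in> sphere_set m" if "y \<in> sphere_set m" for y
    using g that by (auto simp: continuous_map_def)
  have "continuous_map ?P (sphere_top m) (\<lambda>p. ?h (fst p) (snd p))"
  proof (rule continuous_map_normed)
    fix l
    have "continuous_map ?P euclideanreal (\<lambda>p. g (snd p) l)"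
      using continuous_map_compose [OF continuous_map_compose [OF continuous_map_snd g]
          continuous_map_sphere_top_coordinate, of I01] by (simp add: o_def)
    moreover have "continuous_map ?P euclideanreal fst"
      by (metis continuous_map_fst continuous_map_I01_real)
    ultimately show "continuous_map ?P euclideanreal (\<lambda>p. (1 - fst p) * g (snd p) l + fst p * ?e l)"
      by (auto intro!: continuous_intros)
  next
    fix p assume "p \<in> topspace ?P"
    then have p: "0 \<le> fst p" "fst p \<le> 1" "snd p \<in> sphere_set m" by auto
    show "\<exists>l<m. (1 - fst p) * g (snd p) l + fst p * ?e l \<noteq> 0"
    proof (cases "fst p = 0")
      case True
      then show ?thesis using sphere_set_nonzero [OF gS [OF p(3)]] by simp
    next
      case False
      then have "0 < (1 - fst p) * g (snd p) 0 + fst p * ?e 0"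
        using p nn by (intro add_nonneg_pos mult_nonneg_nonneg) auto
      then show ?thesis using m by (intro exI [of _ 0]) auto
    qed
  qed
  moreover have "?h 0 y = g y" if "y \<in> sphere_set m" for y
    using gS [OF that] by (auto simp: normed_def sphere_set_def fun_eq_iff)
  ultimately have "homotopic_with (\<lambda>x. True) (sphere_top m) (sphere_top m) g (\<lambda>x. ?h 1 x)"
    unfolding homotopic_with_True_iff by (intro exI [of _ ?h]) (auto simp: case_prod_unfold)
  then show ?thesis by auto
qed

text \<open>The two vertices \<open>p i\<close> and \<open>q i\<close> carry the positive and the negative part of the
  \<open>i\<close>-th coordinate.\<close>

definition emb :: "nat \<Rightarrow> (nat \<Rightarrow> 'a) \<Rightarrow> (nat \<Rightarrow> 'a) \<Rightarrow> (nat \<Rightarrow> real) \<Rightarrow> 'a \<Rightarrow> real" where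
  "emb m p q y = (\<lambda>u. (\<Sum>i<m. (if u = p i then max 0 (y i) else 0) + (if u = q i then max 0 (- y i) else 0))
      / (\<Sum>i<m. \<bar>y i\<bar>))"

text \<open>Intended for a vertex \<open>q i\<close> adjacent to \<open>p i\<close> and
  \<open>r i\<close>: an independent set cannot meet both sides of the difference, so the signs
  never cancel.\<close>

definition ret :: "nat \<Rightarrow> (nat \<Rightarrow> 'a) \<Rightarrow> (nat \<Rightarrow> 'a) \<Rightarrow> (nat \<Rightarrow> 'a) \<Rightarrow> ('a \<Rightarrow> real) \<Rightarrow> nat \<Rightarrow> real" where
  "ret m p q r x = normed m (\<lambda>i. x (p i) + x (r i) - x (q i))"

section \<open>Spheres spanned by induced matchings, and retractions onto them\<close>

locale induced_matching =
  fixes E :: "'a set set" and U :: "'a set" and m :: nat and p q :: "nat \<Rightarrow> 'a"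
  assumes fin: "finite U" and pU: "\<And>i. i < m \<Longrightarrow> p i \<in> U" and qU: "\<And>i. i < m \<Longrightarrow> q i \<in> U"
    and inj_p: "inj_on p {..<m}" and inj_q: "inj_on q {..<m}"
    and pq: "\<And>i j. i < m \<Longrightarrow> j < m \<Longrightarrow> p i \<noteq> q j"
    and no_pp: "\<And>i j. i < m \<Longrightarrow> j < m \<Longrightarrow> {p i, p j} \<notin> E"
    and no_qq: "\<And>i j. i < m \<Longrightarrow> j < m \<Longrightarrow> {q i, q j} \<notin> E"
    and no_pq: "\<And>i j. i < m \<Longrightarrow> j < m \<Longrightarrow> {p i, q j} \<in> E \<Longrightarrow> i = j"
begin

lemma emb_p: assumes "i < m" shows "emb m p q y (p i) = max 0 (y i) / (\<Sum>i<m. \<bar>y i\<bar>)"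
proof -
  have "(\<Sum>l<m. (if p i = p l then max 0 (y l) else 0) + (if p i = q l then max 0 (- y l) else 0))
    = (\<Sum>l<m. if l = i then max 0 (y l) else 0)"
    using assms inj_p pq by (intro sum.cong) (auto simp: inj_on_def)
  then show ?thesis using assms by (simp add: emb_def)
qed

lemma emb_q: assumes "i < m" shows "emb m p q y (q i) = max 0 (- y i) / (\<Sum>i<m. \<bar>y i\<bar>)"
proof -
  have "(\<Sum>l<m. (if q i = p l then max 0 (y l) else 0) + (if q i = q l then max 0 (- y l) else 0))
    = (\<Sum>l<m. if l = i then max 0 (- y l) else 0)"
    using assms inj_q pq [symmetric] by (intro sum.cong) (auto simp: inj_on_def)
  then show ?thesis using assms by (simp add: emb_def)
qed

lemma emb_other: assumes "\<And>i. i < m \<Longrightarrow> u \<noteq> p i" "\<And>i. i < m \<Longrightarrow> u \<noteq> q i" shows "emb m p q y u = 0"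
  using assms by (simp add: emb_def)

lemma emb_nonneg: "0 \<le> emb m p q y u"
  unfolding emb_def by (intro divide_nonneg_nonneg sum_nonneg) auto

lemma norm1_pos: assumes "y \<in> sphere_set m" shows "0 < (\<Sum>i<m. \<bar>y i\<bar>)"
  using sphere_set_nonzero [OF assms] by (auto intro: sum_pos2)

text \<open>At most one of \<open>p i\<close> and \<open>q i\<close> has weight, and different pairs
  are not joined, so the support is independent. Dividing by the sum of absolute values projects the
  round sphere to the boundary of a cross-polytope.\<close>

lemma emb_in_bary: assumes y: "y \<in> sphere_set m" shows "emb m p q y \<in> bary E U"
proof -
  let ?x = "emb m p q y"
  have supp: "(\<exists>i<m. u = p i \<and> 0 < y i) \<or> (\<exists>i<m. u = q i \<and> y i < 0)" if u: "?x u \<noteq> 0" for u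
  proof -
    from u have "(\<exists>i<m. u = p i) \<or> (\<exists>i<m. u = q i)" using emb_other by blast
    then show ?thesis
    proof (elim disjE exE conjE)
      fix i assume "i < m" "u = p i"
      then show ?thesis using u emb_p [of i y] by (auto simp: max_def split: if_splits)
    next
      fix i assume "i < m" "u = q i"
      then show ?thesis using u emb_q [of i y] by (auto simp: max_def split: if_splits)
    qed
  qed
  have "{u. ?x u \<noteq> 0} \<in> indep E U"
    unfolding indep_def
  proof (clarsimp, intro conjI subsetI allI impI, goal_cases)
    case (1 u)
    then show ?case using supp [of u] pU qU by auto
  next
    case (2 u v)
    then show ?case using supp [of u] supp [of v] no_pp no_qq no_pq
      by (metis insert_commute less_asym)
  qed
  moreover have "(\<Sum>u\<in>U. ?x u) = 1"
  proof -
    have "(\<Sum>u\<in>U. ?x u) = (\<Sum>u\<in>U. \<Sum>i<m. (if u = p i then max 0 (y i) else 0) + (if u = q i then max 0 (- y i) else 0))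
        / (\<Sum>i<m. \<bar>y i\<bar>)"
      by (simp add: emb_def sum_divide_distrib)
    also have "(\<Sum>u\<in>U. \<Sum>i<m. (if u = p i then max 0 (y i) else 0) + (if u = q i then max 0 (- y i) else 0))
      = (\<Sum>i<m. \<Sum>u\<in>U. (if u = p i then max 0 (y i) else 0) + (if u = q i then max 0 (- y i) else 0))"
      by (rule sum.swap)
    also have "\<dots> = (\<Sum>i<m. \<bar>y i\<bar>)"
      using fin pU qU by (intro sum.cong) (auto simp: sum.distrib max_def)
    finally show ?thesis using norm1_pos [OF y] by simp
  qed
  ultimately show ?thesis using bary_iff [OF fin order_refl] emb_nonneg by blast
qed

lemma continuous_map_emb: "continuous_map (sphere_top m) (realization E U) (emb m p q)"
  unfolding realization_eq
proof (rule continuous_map_into_powertop_real)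
  fix u
  show "continuous_map (sphere_top m) euclideanreal (\<lambda>y. emb m p q y u)"
    unfolding emb_def
  proof (intro continuous_map_real_divide continuous_map_sum continuous_map_real_abs
      continuous_map_sphere_top_coordinate)
    show "continuous_map (sphere_top m) euclideanreal
        (\<lambda>y. (if u = p i then max 0 (y i) else 0) + (if u = q i then max 0 (- y i) else 0))" for i
      using continuous_map_sphere_top_coordinate [of m i]
      by (cases "u = p i"; cases "u = q i") (auto intro!: continuous_intros)
  qed (use norm1_pos in force)+
qed (use emb_in_bary in auto)

text \<open>The vertices \<open>r i\<close> lie off the matching and have weight 0; normalising
  undoes the positive factor introduced by \<open>emb\<close>.\<close>

lemma ret_emb:
  assumes r: "\<And>i j. i < m \<Longrightarrow> j < m \<Longrightarrow> r i \<noteq> p j \<and> r i \<noteq> q j" and y: "y \<in> sphere_set m"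
  shows "ret m p q r (emb m p q y) = y"
proof -
  let ?N = "\<Sum>i<m. \<bar>y i\<bar>"
  have N: "0 < ?N" using norm1_pos [OF y] .
  have z: "emb m p q y (p i) + emb m p q y (r i) - emb m p q y (q i) = y i / ?N" if "i < m" for i
  proof -
    have "emb m p q y (r i) = 0" using r that by (intro emb_other) auto
    then show ?thesis using emb_p emb_q that by (simp add: max_def diff_divide_distrib [symmetric])
  qed
  have "(\<Sum>l<m. (y l / ?N)\<^sup>2) = (1 / ?N)\<^sup>2"
    using y by (simp add: power_divide sum_divide_distrib [symmetric] sphere_set_def)
  then have "sqrt (\<Sum>l<m. (emb m p q y (p l) + emb m p q y (r l) - emb m p q y (q l))\<^sup>2) = 1 / ?N"
    using z N by (simp add: real_sqrt_divide)
  then show ?thesis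
    using z N y by (auto simp: ret_def normed_def sphere_set_def fun_eq_iff)
qed

end

text \<open>Some vertex has weight and lies in a triple; the two edges at the centre
  \<open>q i\<close> prevent cancellation, so that coordinate is nonzero and normalising is
  allowed.\<close>

lemma continuous_map_ret:
  assumes "finite U"
    and cover: "\<And>u. u \<in> U \<Longrightarrow> \<exists>i<m. u = p i \<or> u = q i \<or> u = r i"
    and edge: "\<And>i. i < m \<Longrightarrow> {q i, p i} \<in> E \<and> {q i, r i} \<in> E"
  shows "continuous_map (realization E U) (sphere_top m) (ret m p q r)"
  unfolding ret_def
proof (rule continuous_map_normed)
  fix l
  have "continuous_map (realization E U) euclideanreal (\<lambda>x. x u)" for u
    unfolding realization_eq by (rule continuous_map_coordinate)
  then show "continuous_map (realization E U) euclideanreal (\<lambda>x. x (p l) + x (r l) - x (q l))"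
    by (intro continuous_intros)
next
  fix x assume "x \<in> topspace (realization E U)"
  then have x: "\<forall>u. 0 \<le> x u" "{u. x u \<noteq> 0} \<in> indep E U" "(\<Sum>u\<in>U. x u) = 1"
    using bary_iff [OF assms(1) order_refl] by auto
  then obtain u where u: "u \<in> U" "x u \<noteq> 0" by (metis sum.neutral zero_neq_one)
  then obtain i where i: "i < m" "u = p i \<or> u = q i \<or> u = r i" using cover by blast
  have e: "x (q i) = 0 \<or> x (p i) = 0 \<and> x (r i) = 0"
    using x(2) edge [OF i(1)] by (auto simp: indep_def)
  have "x (p i) + x (r i) - x (q i) \<noteq> 0"
  proof (cases "x (q i) = 0")
    case True
    then have "x (p i) \<noteq> 0 \<or> x (r i) \<noteq> 0" using u i by auto
    then show ?thesis using True x(1) by (metis add_nonneg_eq_0_iff diff_zero)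
  qed (use e in auto)
  then show "\<exists>l<m. x (p l) + x (r l) - x (q l) \<noteq> 0" using i by blast
qed

text \<open>A space into which \<open>S\<^sup>k\<close> embeds in two independent ways, as detected by retractions, has
  the homotopy type of no sphere: a self-map of \<open>S\<^sup>k\<close> would have degrees
  \<open>b\<^sub>0 a\<^sub>0 = b\<^sub>1 a\<^sub>1 = 1\<close> and \<open>b\<^sub>0 a\<^sub>1 = 0\<close>.\<close>

lemma not_sphere_of_two_retracts:
  fixes X :: "'x topology"
  assumes i0: "continuous_map (nsphere k) X i0" and i1: "continuous_map (nsphere k) X i1"
    and r0: "continuous_map X (nsphere k) r0" and r1: "continuous_map X (nsphere k) r1"
    and r0i0: "\<And>y. y \<in> topspace (nsphere k) \<Longrightarrow> r0 (i0 y) = y"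
    and r1i1: "\<And>y. y \<in> topspace (nsphere k) \<Longrightarrow> r1 (i1 y) = y"
    and null: "homotopic_with (\<lambda>x. True) (nsphere k) (nsphere k) (r0 \<circ> i1) (\<lambda>x. a)"
  shows "\<not> contractible_space X \<and> \<not> homotopy_equivalent_to_sphere X"
proof
  show nc: "\<not> contractible_space X"
  proof
    assume "contractible_space X"
    moreover have "retraction_map X (nsphere k) r0"
      using i0 r0 r0i0 by (auto simp: retraction_map_def retraction_maps_def)
    ultimately show False
      using contractible_space_retraction_map_image non_contractible_space_nsphere by blast
  qed
  have ne: "topspace X \<noteq> {}"
    using nc by (metis contractible_space_empty null_topspace_iff_trivial)
  have "\<not> X homotopy_equivalent_space nsphere d" for d
  proof
    assume eq: "X homotopy_equivalent_space nsphere d"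
    show False
    proof (cases "d = k")
      \<comment> \<open>The identity on the reduced homology of the \<open>k\<close>-sphere would
        factor through a trivial group.\<close>
      case False
      let ?G = "reduced_homology_group (int k) (nsphere k)" and ?H = "reduced_homology_group (int k) X"
      have "trivial_group (reduced_homology_group (int k) (nsphere d))"
        using False by (simp add: trivial_reduced_homology_group_nsphere)
      then have "trivial_group ?H"
        using isomorphic_group_triviality [OF homotopy_equivalent_space_imp_isomorphic_reduced_homology_groups [OF eq]]
        by simp
      then have H: "carrier ?H = {one ?H}" by (simp add: trivial_group_def)
      have hi: "hom_induced k (nsphere k) {} X {} i0 \<in> hom ?G ?H"
        and hr: "hom_induced k X {} (nsphere k) {} r0 \<in> hom ?H ?G"
        by (simp_all add: hom_induced_reduced_hom)
      have "x = one ?G" if x: "x \<in> carrier ?G" for x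
      proof -
        have "hom_induced k (nsphere k) {} X {} i0 x = one ?H"
          using hi x H by (auto simp: hom_def)
        moreover have "hom_induced k X {} (nsphere k) {} r0 (one ?H) = one ?G"
          using hr by (intro hom_one) auto
        moreover have "hom_induced k X {} (nsphere k) {} r0 (hom_induced k (nsphere k) {} X {} i0 x)
            = hom_induced k (nsphere k) {} (nsphere k) {} (r0 \<circ> i0) x"
          using i0 r0 by (simp add: hom_induced_compose')
        moreover have "hom_induced k (nsphere k) {} (nsphere k) {} (r0 \<circ> i0) x
            = hom_induced k (nsphere k) {} (nsphere k) {} id x"
          using r0i0 by (intro hom_induced_eq [THEN fun_cong]) auto
        moreover have "x \<in> carrier (homology_group k (nsphere k))"
          using x carrier_reduced_homology_group_subset by blast
        ultimately show ?thesis by (simp add: hom_induced_id)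
      qed
      then have "trivial_group ?G"
        by (auto simp: group.trivial_group_alt [OF group_reduced_homology_group])
      then show False by (simp add: trivial_reduced_homology_group_nsphere)
    next
      case True
      then obtain f g where f: "continuous_map X (nsphere k) f" and g: "continuous_map (nsphere k) X g"
        and gf: "homotopic_with (\<lambda>x. True) X X (g \<circ> f) id"
        using eq by (auto simp: homotopy_equivalent_space_def)
      let ?deg = "Brouwer_degree2 k"
      \<comment> \<open>The degrees \<open>?deg (f \<circ> i)\<close> are the a's and
        \<open>?deg (r \<circ> g)\<close> the b's of the argument.\<close>
      have comp: "?deg (r \<circ> g) * ?deg (f \<circ> i) = ?deg (r \<circ> i)"
        if i: "continuous_map (nsphere k) X i" and r: "continuous_map X (nsphere k) r" for i r
      proof -
        have "homotopic_with (\<lambda>x. True) (nsphere k) (nsphere k) (r \<circ> (g \<circ> f) \<circ> i) (r \<circ> id \<circ> i)"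
          by (intro homotopic_with_compose_continuous_map_right [OF _ i]
              homotopic_with_compose_continuous_map_left [OF gf r]) auto
        then have "?deg ((r \<circ> g) \<circ> (f \<circ> i)) = ?deg (r \<circ> i)"
          using Brouwer_degree2_homotopic by (metis comp_assoc comp_id)
        moreover have "?deg ((r \<circ> g) \<circ> (f \<circ> i)) = ?deg (r \<circ> g) * ?deg (f \<circ> i)"
          by (intro Brouwer_degree2_compose continuous_map_compose [OF i f] continuous_map_compose [OF g r])
        ultimately show ?thesis by simp
      qed
      have "?deg (r0 \<circ> i0) = 1" "?deg (r1 \<circ> i1) = 1"
        using Brouwer_degree2_eq [of k "r0 \<circ> i0" id] Brouwer_degree2_eq [of k "r1 \<circ> i1" id] r0i0 r1i1
        by simp_all
      moreover have "?deg (r0 \<circ> i1) = 0" using Brouwer_degree2_nullhomotopic [OF null] .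
      ultimately show False
        using comp [OF i0 r0] comp [OF i1 r1] comp [OF i1 r0] by auto
    qed
  qed
  then show "\<not> homotopy_equivalent_to_sphere X"
    using ne by (simp add: homotopy_equivalent_to_sphere_def)
qed

theorem realization_cycle_not_sphere:
  assumes cyc: "cycle_of_length n (U, E)" and n3: "3 dvd n"
  shows "\<not> contractible_space (realization E U) \<and> \<not> homotopy_equivalent_to_sphere (realization E U)"
proof -
  obtain c where c: "bij_betw c {..<n} U" and E: "E = {{c i, c (Suc i mod n)} | i. i < n}" and "3 \<le> n"
    using cyc by (auto simp: cycle_of_length_def)
  obtain m where m: "n = 3 * m" "0 < m" using n3 \<open>3 \<le> n\<close> by (auto elim: dvdE)
  have inj: "c i = c j \<longleftrightarrow> i = j" if "i < n" "j < n" for i j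
    using c that by (auto simp: bij_betw_def inj_on_def)
  have fU: "finite U" using c bij_betw_finite by blast
  have cU: "c i \<in> U" if "i < n" for i using c that by (auto simp: bij_betw_def)
  \<comment> \<open>Since 3 divides \<open>n\<close>, residues mod 3 survive the wrap-around: they
    colour the cycle properly, which separates the vertex families below.\<close>
  have mod3: "i mod n mod 3 = i mod 3" for i using n3 by (rule mod_mod_cancel)
  have edge: "{c i, c (Suc i mod n)} \<in> E" if "i < n" for i using that E by auto
  have adj: "j = Suc i mod n \<or> i = Suc j mod n" if ij: "i < n" "j < n" and e: "{c i, c j} \<in> E" for i j
  proof -
    obtain l where l: "l < n" "{c i, c j} = {c l, c (Suc l mod n)}" using e E by auto
    have "Suc l mod n < n" using m by simp
    then show ?thesis using l ij inj by (auto simp: doubleton_eq_iff)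
  qed
  have adj3: "j mod 3 = Suc i mod 3 \<or> i mod 3 = Suc j mod 3" if "i < n" "j < n" "{c i, c j} \<in> E" for i j
    using adj [OF that] by (metis mod3)
  \<comment> \<open>\<open>P i\<close> is the predecessor of \<open>A i\<close>; adding
    \<open>n - 1\<close> replaces subtracting 1, which would fail at \<open>i = 0\<close>.\<close>
  define A B C P where "A i = c (3 * i)" and "B i = c (3 * i + 1)" and "C i = c (3 * i + 2)"
    and "P i = c ((3 * i + (n - 1)) mod n)" for i
  have lt: "3 * i < n" "3 * i + 1 < n" "3 * i + 2 < n" "(3 * i + (n - 1)) mod n < n" if "i < m" for i
    using that m by auto
  have P3: "(3 * i + (n - 1)) mod n mod 3 = 2" for i
  proof -
    have "3 * i + (n - 1) = 3 * (i + (m - 1)) + 2" using m by simp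
    then show ?thesis unfolding mod3 by (simp only: mod_mult_self4) simp
  qed
  have neq: "c i \<noteq> c j" if "i < n" "j < n" "i mod 3 \<noteq> j mod 3" for i j
    using that inj by auto
  have res: "3 * i mod 3 = 0" "(3 * i + 1) mod 3 = 1" "(3 * i + 2) mod 3 = 2" for i :: nat
    by (simp_all only: mod_mult_self4 mod_mult_self1_is_0) simp_all
  have same3: "{c i, c j} \<notin> E" if "i < n" "j < n" "i mod 3 = j mod 3" for i j
  proof
    have "Suc i mod 3 \<noteq> j mod 3" "Suc j mod 3 \<noteq> i mod 3" using that(3) by (auto simp: mod_Suc)
    moreover assume "{c i, c j} \<in> E"
    ultimately show False using adj3 that(1,2) by metis
  qed
  have AA: "{A i, A j} \<notin> E" and BB: "{B i, B j} \<notin> E" and CC: "{C i, C j} \<notin> E"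
    and BA: "B i \<noteq> A j" and CB: "C i \<noteq> B j" and AC: "A i \<noteq> C j"
    and PA: "P i \<noteq> A j" and PB: "P i \<noteq> B j"
    if ij: "i < m" "j < m" for i j
    unfolding A_def B_def C_def P_def
    by (intro same3 neq lt ij; unfold res P3; simp)+
  have sPA: "Suc ((3 * i + (n - 1)) mod n) mod n = 3 * i" if "i < m" for i
    using that m by (simp add: mod_Suc_eq)
  have M0: "induced_matching E U m B A"
  proof
    fix i j assume ij: "i < m" "j < m"
    show "B i \<noteq> A j" "{B i, B j} \<notin> E" "{A i, A j} \<notin> E" using BA BB AA ij by auto
    show "i = j" if "{B i, A j} \<in> E"
    proof -
      have "3 * j = Suc (3 * i + 1) mod n \<or> 3 * i + 1 = Suc (3 * j) mod n"
        using adj [of "3 * i + 1" "3 * j"] lt ij that by (simp add: A_def B_def)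
      moreover have "Suc (3 * i + 1) mod n = 3 * i + 2" "Suc (3 * j) mod n = 3 * j + 1" using lt ij by auto
      ultimately have "3 * j = 3 * i + 2 \<or> 3 * i + 1 = 3 * j + 1" by simp
      then show ?thesis by presburger
    qed
  qed (use fU cU lt inj in \<open>auto simp: A_def B_def inj_on_def\<close>)
  have M1: "induced_matching E U m C B"
  proof
    fix i j assume ij: "i < m" "j < m"
    show "C i \<noteq> B j" "{C i, C j} \<notin> E" "{B i, B j} \<notin> E" using CB CC BB ij by auto
    show "i = j" if e: "{C i, B j} \<in> E"
    proof -
      have "3 * j + 1 = Suc (3 * i + 2) mod n \<or> 3 * i + 2 = Suc (3 * j + 1) mod n"
        using adj [of "3 * i + 2" "3 * j + 1"] lt ij e by (simp add: C_def B_def)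
      moreover have "Suc (3 * j + 1) mod n = 3 * j + 2" using lt ij by auto
      \<comment> \<open>The successor of \<open>C i\<close>, wrapped or not, has residue 0.\<close>
      moreover have "Suc (3 * i + 2) mod n \<noteq> 3 * j + 1"
      proof
        assume "Suc (3 * i + 2) mod n = 3 * j + 1"
        then have "Suc (3 * i + 2) mod 3 = (3 * j + 1) mod 3" using mod3 by metis
        then show False by (simp only: mod_Suc res) simp
      qed
      ultimately show ?thesis by auto
    qed
  qed (use fU cU lt inj in \<open>auto simp: C_def B_def inj_on_def\<close>)
  have cover: "\<exists>i<m. u = B i \<or> u = A i \<or> u = C i" if u: "u \<in> U" for u
  proof -
    obtain j where j: "j < n" "u = c j" using u c by (auto simp: bij_betw_def)
    have "j = 3 * (j div 3) + j mod 3" by simp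
    moreover have "j mod 3 = 0 \<or> j mod 3 = 1 \<or> j mod 3 = 2" by auto
    moreover have "j div 3 < m" using j m by auto
    ultimately show ?thesis using j by (metis A_def B_def C_def add.right_neutral)
  qed
  \<comment> \<open>The predecessors of the \<open>A\<close>'s are all the \<open>C\<close>'s, so
    the triples around the \<open>A\<close>'s exhaust the cycle.\<close>
  have CP: "\<exists>j<m. C i = P j" if i: "i < m" for i
  proof (cases "Suc i < m")
    case True
    have "3 * Suc i + (n - 1) = 3 * i + 2 + n" using m by simp
    then have "(3 * Suc i + (n - 1)) mod n = (3 * i + 2) mod n" by (simp only: mod_add_self2)
    also have "\<dots> = 3 * i + 2" using lt(3) [OF i] by (rule mod_less)
    finally have "(3 * Suc i + (n - 1)) mod n = 3 * i + 2" .
    then show ?thesis using True by (auto simp: C_def P_def)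
  next
    case False
    then have "i = m - 1" using i by simp
    then have "(3 * 0 + (n - 1)) mod n = 3 * i + 2" using m by auto
    then show ?thesis using m by (auto simp: C_def P_def intro!: exI [of _ 0])
  qed
  have r0: "continuous_map (realization E U) (sphere_top m) (ret m B A P)"
  proof (rule continuous_map_ret [OF fU])
    show "\<exists>i<m. u = B i \<or> u = A i \<or> u = P i" if "u \<in> U" for u using cover [OF that] CP by metis
    show "{A i, B i} \<in> E \<and> {A i, P i} \<in> E" if "i < m" for i
      using edge [of "3 * i"] edge [of "(3 * i + (n - 1)) mod n"] lt [OF that] sPA [OF that]
      by (simp add: A_def B_def P_def insert_commute)
  qed
  have r1: "continuous_map (realization E U) (sphere_top m) (ret m C B A)"
  proof (rule continuous_map_ret [OF fU])
    show "\<exists>i<m. u = C i \<or> u = B i \<or> u = A i" if "u \<in> U" for u using cover [OF that] by metis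
    show "{B i, C i} \<in> E \<and> {B i, A i} \<in> E" if "i < m" for i
      using edge [of "3 * i"] edge [of "3 * i + 1"] lt [OF that]
      by (simp add: A_def B_def C_def insert_commute)
  qed
  interpret M0: induced_matching E U m B A by (rule M0)
  interpret M1: induced_matching E U m C B by (rule M1)
  have e0: "ret m B A P (emb m B A y) = y" if "y \<in> sphere_set m" for y
  proof (rule M0.ret_emb [OF _ that])
    fix i j assume "i < m" "j < m"
    then show "P i \<noteq> B j \<and> P i \<noteq> A j"
      using PA PB by simp
  qed
  have e1: "ret m C B A (emb m C B y) = y" if "y \<in> sphere_set m" for y
  proof (rule M1.ret_emb [OF _ that])
    fix i j assume "i < m" "j < m"
    then show "A i \<noteq> C j \<and> A i \<noteq> B j"
      using AC BA by metis
  qed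
  \<comment> \<open>The second sphere puts no weight on the \<open>A\<close>'s, the only vertices
    that the first retraction counts negatively.\<close>
  have "0 \<le> ret m B A P (emb m C B y) i" if "y \<in> sphere_set m" for y i
  proof -
    have "emb m C B y (A l) = 0" if "l < m" for l
      using that AC BA by (intro M1.emb_other) metis+
    then show ?thesis
      by (auto simp: ret_def normed_def M1.emb_nonneg sum_nonneg intro!: divide_nonneg_nonneg add_nonneg_nonneg)
  qed
  then obtain a where a: "homotopic_with (\<lambda>x. True) (sphere_top m) (sphere_top m)
      (ret m B A P \<circ> emb m C B) (\<lambda>x. a)"
    using null_of_nonneg [OF continuous_map_compose [OF M1.continuous_map_emb r0] m(2)] by auto
  obtain k where k: "m = Suc k" using m(2) gr0_implies_Suc by blast
  have S: "sphere_top m = nsphere k" using k sphere_top_Suc by simp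
  show ?thesis
    by (rule not_sphere_of_two_retracts [OF M0.continuous_map_emb [unfolded S] M1.continuous_map_emb [unfolded S]
        r0 [unfolded S] r1 [unfolded S] _ _ a [unfolded S]])
      (use e0 e1 S in \<open>metis topspace_sphere_top\<close>)+
qed

lemma independence_complex_induced:
  assumes "induced_subgraph H G"
  shows "independence_complex H = indep (edges G) (verts H)"
proof -
  have "{u, v} \<in> edges H \<longleftrightarrow> {u, v} \<in> edges G" if "u \<in> verts H" "v \<in> verts H" for u v
    using assms that by (simp add: induced_subgraph_def)
  then show ?thesis
    unfolding independence_complex_def indep_def by blast
qed

theorem theorem1p1:
  fixes G :: "'a graph"
  assumes "finite_simple_graph G"
  shows "ternary G \<longleftrightarrow>
    (\<forall>H. induced_subgraph H G \<longrightarrow>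
       contractible_space (geometric_realization (independence_complex H)) \<or>
       homotopy_equivalent_to_sphere (geometric_realization (independence_complex H)))"
proof
  have E2: "card e = 2" if "e \<in> edges G" for e
    using assms that by (simp add: finite_simple_graph_def)
  assume t: "ternary G"
  interpret stable_complex "verts G" "edges G"
  proof
    show "finite (verts G)" using assms by (simp add: finite_simple_graph_def)
    show "{v} \<notin> edges G" for v using E2 [of "{v}"] by auto
  qed
  show "\<forall>H. induced_subgraph H G \<longrightarrow>
       contractible_space (geometric_realization (independence_complex H)) \<or>
       homotopy_equivalent_to_sphere (geometric_realization (independence_complex H))"
  proof (intro allI impI)
    fix H assume H: "induced_subgraph H G"
    have "homotopy_tame (verts H)"
    proof (rule homotopy_tame_of_no_cycle [OF E2])
      fix X n assume "X \<subseteq> verts G" "cycle_of_length n (X, {e \<in> edges G. e \<subseteq> X})"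
      moreover from this(1) have "induced_subgraph (X, {e \<in> edges G. e \<subseteq> X}) G"
        by (simp add: induced_subgraph_def)
      ultimately show "\<not> 3 dvd n" using t unfolding ternary_def by blast
    qed (use H in \<open>auto simp: induced_subgraph_def\<close>)
    then have "contractible_space (realization (edges G) (verts H)) \<or>
      homotopy_equivalent_to_sphere (realization (edges G) (verts H))"
      unfolding homotopy_tame_def
    proof (elim disjE exE conjE)
      fix k assume eq: "realization (edges G) (verts H) homotopy_equivalent_space sphere_top k"
      show "contractible_space (realization (edges G) (verts H)) \<or>
        homotopy_equivalent_to_sphere (realization (edges G) (verts H))"
      proof (cases k)
        \<comment> \<open>An equivalence with the empty \<open>sphere_top 0\<close> forces the
          realization to be empty, the sphere of dimension -1.\<close>
        case 0
        then obtain f where "continuous_map (realization (edges G) (verts H)) (sphere_top 0) f"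
          using eq by (auto simp: homotopy_equivalent_space_def)
        then have "topspace (realization (edges G) (verts H)) = {}"
          using sphere_top_0 by (auto simp: continuous_map_def)
        then show ?thesis by (simp add: homotopy_equivalent_to_sphere_def)
      next
        case (Suc d)
        then show ?thesis
          using eq by (auto simp: homotopy_equivalent_to_sphere_def sphere_top_Suc)
      qed
    qed simp
    then show "contractible_space (geometric_realization (independence_complex H)) \<or>
       homotopy_equivalent_to_sphere (geometric_realization (independence_complex H))"
      by (simp only: independence_complex_induced [OF H])
  qed
next
  assume R: "\<forall>H. induced_subgraph H G \<longrightarrow>
       contractible_space (geometric_realization (independence_complex H)) \<or>
       homotopy_equivalent_to_sphere (geometric_realization (independence_complex H))"
  show "ternary G"
    unfolding ternary_def
  proof clarify
    fix U F n assume C: "induced_subgraph (U, F) G" "cycle_of_length n (U, F)" "3 dvd n"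
    have "independence_complex (U, F) = indep F U"
      by (simp add: independence_complex_def indep_def)
    then show False
      using R [rule_format, OF C(1)] realization_cycle_not_sphere [OF C(2,3)] by simp
  qed
qed

end
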